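(* Let $n\geq 2$ be an integer, let $0<p_1,\ldots,p_n<\infty$ satisfy $\frac12\leq\frac1{p_1}+\cdots+\frac1{p_n}<1$, and let $\frac2n\leq q<\infty$. Let $E_1,\ldots,E_n,F$ be Banach spaces. The following are equivalent for $A\in\mathcal{L}(E_1,\ldots,E_n;F)$: (a) $A$ is of type $(p_1,\ldots,p_n)$ (of cotype $q$, respectively); (b) all Aron-Berner extensions of $A$ are of type $(p_1,\ldots,p_n)$ (of cotype $q$, respectively); (c) some Aron-Berner extension of $A$ is of type $(p_1,\ldots,p_n)$ (of cotype $q$, respectively).
   Context: All Banach spaces are over $\mathbb{K}=\mathbb{R}$ or $\mathbb{C}$; $\mathcal{L}(E_1,\ldots,E_n;F)$ is the space of continuous $n$-linear operators from $E_1\times\cdots\times E_n$ to $F$. Let $(r_j)_{j=1}^\infty$ be the Rademacher functions on $[0,1]$. For a finite sequence $(x_j)_{j=1}^k$ in $E$ put $\|(x_j)_{j=1}^k\|_{\mathrm{Rad}(E)} = \left(\int_0^1 \| \sum_{j=1}^k r_j(t)x_j\|^2 dt\right)^{1/2}$ and $\|(x_j)_{j=1}^k\|_{p} = (\sum_{j=1}^k\|x_j\|^p)^{1/p}$. $T \in \mathcal{L}(E_1,\ldots,E_n;F)$ has type $(p_1,\ldots,p_n)$ if there is $C>0$ such that for all $k\in\mathbb{N}$ and $x_j^{(i)}\in E_i$ ($1\le i\le n$, $1\le j\le k$), $$\|(T(x_j^{(1)},\ldots,x_j^{(n)}))_{j=1}^k\|_{\mathrm{Rad}(F)} \leq C\prod_{i=1}^n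 \|(x_j^{(i)})_{j=1}^k\|_{p_i}.$$ $T$ has cotype $q$ if there is $M>0$ such that for all such vectors $$\|(T(x_j^{(1)},\ldots,x_j^{(n)}))_{j=1}^k\|_{q} \leq M\prod_{i=1}^n \|(x_j^{(i)})_{j=1}^k\|_{\mathrm{Rad}(E_i)}.$$ Aron-Berner extensions: let $J_E\colon E\to E''$ be the canonical embedding. For $A\in\mathcal{L}(E_1,\ldots,E_n;F)$ and $y_j''\in E_j''$, choose nets $(x_{\alpha_j})_{\alpha_j}$ in $E_j$ such that $(J_{E_j}(x_{\alpha_j}))_{\alpha_j}$ converges to $y_j''$ in the weak-star topology, $j=1,\ldots,n$. An Aron-Berner extension of $A$ is the continuous $n$-linear operator from $E_1''\times\cdots\times E_n''$ to $F''$ given by the iterated weak-star limit $$(y_1'',\ldots,y_n'')\mapsto \underset{\alpha_{\sigma(1)}}{w^*\text{-}\lim}\cdots\underset{\alpha_{\sigma(n)}}{w^*\text{-}\lim}\,(J_F\circ A)(x_{\alpha_1},\ldots,x_{\alpha_n}),$$ where $\sigma$ is a permutation of $\{1,\ldots,n\}$ fixing the order in which the limits are taken. Thus $A$ has at most $n!$ different Aron-Berner extensions. *)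

theory Defs
  imports "HOL-Analysis.Analysis" "HOL-Library.Function_Algebras" "HOL-Combinatorics.Permutations"
begin

text \<open>
  The scalar fields: isometric copies of the real or of the complex numbers.
\<close>

class real_or_complex = real_normed_field +
  fixes to_complex :: "'a \<Rightarrow> complex"
  assumes to_complex_add: "to_complex (a + b) = to_complex a + to_complex b"
    and to_complex_mult: "to_complex (a * b) = to_complex a * to_complex b"
    and to_complex_scaleR: "to_complex (r *\<^sub>R a) = r *\<^sub>R to_complex a"
    and norm_to_complex: "cmod (to_complex a) = norm a"
    and range_to_complex: "range to_complex = \<real> \<or> range to_complex = UNIV"

instantiation real :: real_or_complex
begin
definition to_complex_real :: "real \<Rightarrow> complex" where "to_complex_real = complex_of_real"
instance by standard (auto simp: to_complex_real_def Reals_def scaleR_conv_of_real)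
end

instantiation complex :: real_or_complex
begin
definition to_complex_complex :: "complex \<Rightarrow> complex" where "to_complex_complex = id"
instance by standard (auto simp: to_complex_complex_def)
end

text \<open>
  Finitely many Banach spaces, possibly all different, have to share one type of elements.
  A space is therefore a subspace \<open>carr X\<close> of an ambient vector space, which carries no
  topology, with its own scalar multiplication and its own norm; the values of \<open>nrm X\<close>
  outside of \<open>carr X\<close> are irrelevant.  This is no restriction, since \<open>E\<^sub>1, \<dots>, E\<^sub>n\<close> are subspaces
  of the vector space \<open>E\<^sub>1 \<times> \<dots> \<times> E\<^sub>n\<close>.
\<close>

record ('k, 'a) nspace =
  scl :: "'k \<Rightarrow> 'a \<Rightarrow> 'a"
  carr :: "'a set"
  nrm :: "'a \<Rightarrow> real"

locale normed_space = vector_space "scl X"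
  for X :: "('k::real_or_complex, 'a::ab_group_add) nspace" +
  assumes subspace_carr: "subspace (carr X)"
    and nrm_nonneg: "x \<in> carr X \<Longrightarrow> 0 \<le> nrm X x"
    and nrm_eq_0_iff: "x \<in> carr X \<Longrightarrow> nrm X x = 0 \<longleftrightarrow> x = 0"
    and nrm_scl: "x \<in> carr X \<Longrightarrow> nrm X (scl X c x) = norm c * nrm X x"
    and nrm_triangle: "x \<in> carr X \<Longrightarrow> y \<in> carr X \<Longrightarrow> nrm X (x + y) \<le> nrm X x + nrm X y"

locale banach_space = normed_space +
  assumes complete:
    "\<lbrakk>\<And>m. s m \<in> carr X; \<And>e. e > 0 \<Longrightarrow> \<exists>N. \<forall>i\<ge>N. \<forall>j\<ge>N. nrm X (s i - s j) < e\<rbrakk>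
      \<Longrightarrow> \<exists>l\<in>carr X. (\<lambda>m. nrm X (s m - l)) \<longlonglongrightarrow> 0"

text \<open>
  Functionals vanish outside of \<open>carr X\<close>, so that each one is represented by exactly one function.
\<close>

definition dual :: "('k::real_or_complex, 'a::ab_group_add) nspace \<Rightarrow> ('k, 'a \<Rightarrow> 'k) nspace" where
  "dual X = \<lparr>
     scl = (\<lambda>c f x. c * f x),
     carr = {f. (\<forall>x\<in>carr X. \<forall>y\<in>carr X. f (x + y) = f x + f y) \<and>
                (\<forall>c. \<forall>x\<in>carr X. f (scl X c x) = c * f x) \<and>
                (\<exists>C. \<forall>x\<in>carr X. norm (f x) \<le> C * nrm X x) \<and>
                (\<forall>x. x \<notin> carr X \<longrightarrow> f x = 0)},
     nrm = (\<lambda>f. SUP x\<in>{x \<in> carr X. nrm X x \<le> 1}. norm (f x)) \<rparr>"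

abbreviation bidual where "bidual X \<equiv> dual (dual X)"

definition canon ::
    "('k::real_or_complex, 'a::ab_group_add) nspace \<Rightarrow> 'a \<Rightarrow> ('a \<Rightarrow> 'k) \<Rightarrow> 'k" where
  "canon X x = (\<lambda>f. if f \<in> carr (dual X) then f x else 0)"

text \<open>
  Points of \<open>E\<^sub>1 \<times> \<dots> \<times> E\<^sub>n\<close> are extensional families indexed by \<open>{1..n}\<close>; operators are
  extensional too, so that each continuous \<open>n\<close>-linear operator is represented exactly once.
\<close>

definition multilinear_ops ::
    "nat \<Rightarrow> (nat \<Rightarrow> ('k::real_or_complex, 'a::ab_group_add) nspace) \<Rightarrow>
     ('k, 'b::ab_group_add) nspace \<Rightarrow> ((nat \<Rightarrow> 'a) \<Rightarrow> 'b) set" where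
  "multilinear_ops n E F =
     {T \<in> (\<Pi>\<^sub>E x\<in>(\<Pi>\<^sub>E i\<in>{1..n}. carr (E i)). carr F).
        (\<forall>x\<in>(\<Pi>\<^sub>E i\<in>{1..n}. carr (E i)). \<forall>i\<in>{1..n}. \<forall>u\<in>carr (E i). \<forall>v\<in>carr (E i).
           T (x(i := u + v)) = T (x(i := u)) + T (x(i := v))) \<and>
        (\<forall>x\<in>(\<Pi>\<^sub>E i\<in>{1..n}. carr (E i)). \<forall>i\<in>{1..n}. \<forall>u\<in>carr (E i). \<forall>c.
           T (x(i := scl (E i) c u)) = scl F c (T (x(i := u)))) \<and>
        (\<forall>x\<in>(\<Pi>\<^sub>E i\<in>{1..n}. carr (E i)). \<forall>e>0. \<exists>d>0. \<forall>y\<in>(\<Pi>\<^sub>E i\<in>{1..n}. carr (E i)).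
           (\<forall>i\<in>{1..n}. nrm (E i) (y i - x i) < d) \<longrightarrow> nrm F (T y - T x) < e)}"

definition rademacher :: "nat \<Rightarrow> real \<Rightarrow> real" where
  "rademacher j t = sgn (sin (2 ^ j * pi * t))"

definition rad_norm ::
    "('k::real_or_complex, 'a::ab_group_add) nspace \<Rightarrow> nat \<Rightarrow> (nat \<Rightarrow> 'a) \<Rightarrow> real" where
  "rad_norm X k x =
     sqrt (LINT t:{0..1}|lborel. (nrm X (\<Sum>j=1..k. scl X (of_real (rademacher j t)) (x j)))\<^sup>2)"

definition lp_norm ::
    "('k::real_or_complex, 'a::ab_group_add) nspace \<Rightarrow> real \<Rightarrow> nat \<Rightarrow> (nat \<Rightarrow> 'a) \<Rightarrow> real" where
  "lp_norm X p k x = (\<Sum>j=1..k. nrm X (x j) powr p) powr (1 / p)"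

definition has_type ::
    "nat \<Rightarrow> (nat \<Rightarrow> ('k::real_or_complex, 'a::ab_group_add) nspace) \<Rightarrow>
     ('k, 'b::ab_group_add) nspace \<Rightarrow> (nat \<Rightarrow> real) \<Rightarrow> ((nat \<Rightarrow> 'a) \<Rightarrow> 'b) \<Rightarrow> bool" where
  "has_type n E F p T \<longleftrightarrow>
     (\<exists>C>0. \<forall>k. \<forall>x :: nat \<Rightarrow> nat \<Rightarrow> 'a. (\<forall>i\<in>{1..n}. \<forall>j\<in>{1..k}. x i j \<in> carr (E i)) \<longrightarrow>
        rad_norm F k (\<lambda>j. T (\<lambda>i\<in>{1..n}. x i j)) \<le> C * (\<Prod>i=1..n. lp_norm (E i) (p i) k (x i)))"

definition has_cotype ::
    "nat \<Rightarrow> (nat \<Rightarrow> ('k::real_or_complex, 'a::ab_group_add) nspace) \<Rightarrow>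
     ('k, 'b::ab_group_add) nspace \<Rightarrow> real \<Rightarrow> ((nat \<Rightarrow> 'a) \<Rightarrow> 'b) \<Rightarrow> bool" where
  "has_cotype n E F q T \<longleftrightarrow>
     (\<exists>M>0. \<forall>k. \<forall>x :: nat \<Rightarrow> nat \<Rightarrow> 'a. (\<forall>i\<in>{1..n}. \<forall>j\<in>{1..k}. x i j \<in> carr (E i)) \<longrightarrow>
        lp_norm F q k (\<lambda>j. T (\<lambda>i\<in>{1..n}. x i j)) \<le> M * (\<Prod>i=1..n. rad_norm (E i) k (x i)))"

definition weak_star_lim ::
    "('k::real_or_complex, 'a::ab_group_add) nspace \<Rightarrow> ('u \<Rightarrow> 'a \<Rightarrow> 'k) \<Rightarrow> ('a \<Rightarrow> 'k) \<Rightarrow>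
     'u filter \<Rightarrow> bool" where
  "weak_star_lim Y h z \<F> \<longleftrightarrow>
     z \<in> carr (dual Y) \<and> (\<forall>\<^sub>F u in \<F>. h u \<in> carr (dual Y)) \<and>
     (\<forall>f\<in>carr Y. ((\<lambda>u. h u f) \<longlongrightarrow> z f) \<F>)"

text \<open>
  A net in \<open>E\<^sub>j\<close> is represented by the proper filter it generates on \<open>E\<^sub>j\<close> (every proper filter
  arises in this way).  The predicate \<open>iter_weak_star_lim Y N [j\<^sub>1, \<dots>, j\<^sub>m] G x z\<close> says that the
  iterated weak-star limit in \<open>dual Y\<close>, first along \<open>N j\<^sub>m\<close> and last along \<open>N j\<^sub>1\<close>, of
  \<open>G (x(j\<^sub>1 := u\<^sub>1, \<dots>, j\<^sub>m := u\<^sub>m))\<close> exists and equals \<open>z\<close>.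
\<close>

primrec iter_weak_star_lim ::
    "('k::real_or_complex, 'b::ab_group_add) nspace \<Rightarrow> (nat \<Rightarrow> 'a filter) \<Rightarrow> nat list \<Rightarrow>
     ((nat \<Rightarrow> 'a) \<Rightarrow> 'b \<Rightarrow> 'k) \<Rightarrow> (nat \<Rightarrow> 'a) \<Rightarrow> ('b \<Rightarrow> 'k) \<Rightarrow> bool" where
  "iter_weak_star_lim Y N [] G x z \<longleftrightarrow> z = G x"
| "iter_weak_star_lim Y N (j # js) G x z \<longleftrightarrow>
     (\<exists>h. (\<forall>\<^sub>F u in N j. iter_weak_star_lim Y N js G (x(j := u)) (h u)) \<and>
          weak_star_lim Y h z (N j))"

text \<open>
  The value at \<open>y\<close> is the iterated limit for every choice of nets converging to
  \<open>y 1, \<dots>, y n\<close>; by Goldstine's theorem such nets exist, and the limit does not depend on them.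
  All coordinates of the starting point \<open>\<lambda>_. undefined\<close> in \<open>{1..n}\<close> get overwritten.
\<close>

definition aron_berner_extensions ::
    "nat \<Rightarrow> (nat \<Rightarrow> ('k::real_or_complex, 'a::ab_group_add) nspace) \<Rightarrow>
     ('k, 'b::ab_group_add) nspace \<Rightarrow> ((nat \<Rightarrow> 'a) \<Rightarrow> 'b) \<Rightarrow>
     ((nat \<Rightarrow> ('a \<Rightarrow> 'k) \<Rightarrow> 'k) \<Rightarrow> ('b \<Rightarrow> 'k) \<Rightarrow> 'k) set" where
  "aron_berner_extensions n E F A =
     {B \<in> multilinear_ops n (\<lambda>i. bidual (E i)) (bidual F).
        \<exists>\<sigma>. \<sigma> permutes {1..n} \<and>
          (\<forall>y\<in>(\<Pi>\<^sub>E i\<in>{1..n}. carr (bidual (E i))). \<forall>N.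
             (\<forall>i\<in>{1..n}. N i \<noteq> bot \<and> (\<forall>\<^sub>F u in N i. u \<in> carr (E i)) \<and>
                weak_star_lim (dual (E i)) (canon (E i)) (y i) (N i)) \<longrightarrow>
             iter_weak_star_lim (dual F) N (map \<sigma> [1..<n + 1]) (\<lambda>x. canon F (A x))
               (\<lambda>_. undefined) (B y))}"

end

theory Submission
  imports Defs
begin

text \<open>
  An Aron-Berner extension is evaluated one variable at a time: its value at \<open>y\<close>, tested against
  \<open>\<phi>\<close>, is \<open>y (\<sigma> 1) (\<lambda>u\<^sub>1. \<dots> y (\<sigma> n) (\<lambda>u\<^sub>n. \<phi> (A u)))\<close>.  Both \<open>Rad\<close> and \<open>\<ell>\<^sub>p\<close> norms of a finite sequence
  depend monotonically on finitely many norms of linear combinations of its terms.  By local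
  reflexivity, finitely many functionals and the norms of finitely many combinations of vectors of
  \<open>E''\<close> are realized, up to an arbitrarily small error in the norms, by vectors of \<open>E\<close>.  Applied
  successively in the \<open>n\<close> variables, with functionals that almost norm the values of the extension, this
  transports type and cotype estimates from \<open>A\<close> to its extensions, with the same constant.  The converse
  holds because an extension restricts to \<open>A\<close> on the isometric images of the \<open>E\<^sub>i\<close>.
\<close>

section \<open>Hahn-Banach over the real or complex scalars\<close>

text \<open>A weak-star net approximates a single point of a bidual, whereas a Rad norm involves all
  sign combinations of the chosen vectors at once, and weak-star convergence gives no upper bound
  for their norms. This is the obstacle that calls for local reflexivity. A one-sided form of it
  suffices: norms in \<open>E i\<close> have to be bounded above, norms in \<open>F\<close> below,
  and the lower bounds come from finitely many functionals on which the values of the extension are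
  matched exactly. The order of the variables is forced. The functional to which \<open>y j\<close>
  is applied contains the bidual points of the inner variables and the vectors already chosen for
  the outer ones, so it is known only after the outer choices have been made; a finite set of such
  functionals is prescribed anew for each variable. The error is an additive number d > 0 in each of
  the finitely many norms. Both kinds of means are continuous in these norms, so letting d tend to 0
  leaves the constant unchanged.\<close>

definition sublinear_on :: "(real \<Rightarrow> 'v \<Rightarrow> 'v) \<Rightarrow> 'v::ab_group_add set \<Rightarrow> ('v \<Rightarrow> real) \<Rightarrow> bool" where
  "sublinear_on s V q \<longleftrightarrow>
     (\<forall>x\<in>V. \<forall>y\<in>V. q (x + y) \<le> q x + q y) \<and> (\<forall>x\<in>V. \<forall>r\<ge>0. q (s r x) \<le> r * q x)"

lemma sublinear_onD:
  assumes "sublinear_on s V q" "x \<in> V"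
  shows "y \<in> V \<Longrightarrow> q (x + y) \<le> q x + q y" "r \<ge> 0 \<Longrightarrow> q (s r x) \<le> r * q x"
  using assms by (auto simp: sublinear_on_def)

section \<open>Shifts and chains of real sublinear functionals\<close>

context
  fixes s :: "real \<Rightarrow> 'v::ab_group_add \<Rightarrow> 'v" and V :: "'v set"
  assumes vs: "vector_space s" and V: "module.subspace s V"
begin

interpretation S: vector_space s by (fact vs)

text \<open>The reverse inequality is the assumed one applied to \<open>s r x\<close> with the
  factor 1/r.\<close>

lemma sublinear_on_scale:
  assumes q: "sublinear_on s V q" and x: "x \<in> V" and r: "r \<ge> 0"
  shows "q (s r x) = r * q x"
proof -
  have z: "q 0 = 0"
    using sublinear_onD(1)[OF q, of 0 0] sublinear_onD(2)[OF q, of 0 0] S.subspace_0[OF V] by auto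
  show ?thesis
  proof (cases "r = 0")
    case False
    have "q x = q (s (1 / r) (s r x))" using False by simp
    also have "\<dots> \<le> 1 / r * q (s r x)"
      using sublinear_onD(2)[OF q, of "s r x" "1 / r"] S.subspace_scale[OF V x] r by simp
    finally have "r * q x \<le> q (s r x)" using False r by (simp add: field_simps)
    then show ?thesis using sublinear_onD(2)[OF q x r] by simp
  qed (use z in simp)
qed

lemma sublinear_on_lower:
  assumes q: "sublinear_on s V q" and x: "x \<in> V"
  shows "- q (- x) \<le> q x"
proof -
  have "q 0 = 0" using sublinear_on_scale[OF q x, of 0] by simp
  then show ?thesis using sublinear_onD(1)[OF q x, of "- x"] S.subspace_neg[OF V x] by simp
qed

text \<open>The infimum defining \<open>q'\<close> runs over t \<ge> 0: t = 0 gives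
  \<open>q' x \<le> q x\<close>, and t = 1 gives the bound that involves \<open>a\<close>. The value
  0 outside \<open>V\<close> lets the pointwise order of functions on the whole type serve as the
  order on functionals.\<close>

lemma sublinear_on_shift:
  assumes q: "sublinear_on s V q" and a: "a \<in> V"
  obtains q' where "sublinear_on s V q'" "\<And>x. x \<in> V \<Longrightarrow> q' x \<le> q x"
    "\<And>x. x \<in> V \<Longrightarrow> q' x \<le> q (x + a) - q a" "\<And>x. x \<notin> V \<Longrightarrow> q' x = 0"
proof
  define h where "h x t = q (x + s t a) - t * q a" for x t
  define q' where "q' x = (if x \<in> V then INF t\<in>{0..}. h x t else 0)" for x
  note [simp] = S.subspace_add[OF V] S.subspace_scale[OF V] a
  \<comment> \<open>A lower bound independent of t, by subadditivity at
    \<open>s t a = (x + s t a) + (- x)\<close>; it makes the infimum meaningful.\<close>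
  have lo: "- q (- x) \<le> h x t" if "x \<in> V" "t \<ge> 0" for x t
  proof -
    have "q (s t a) \<le> q (x + s t a) + q (- x)"
      using sublinear_onD(1)[OF q, of "x + s t a" "- x"] that S.subspace_neg[OF V] by simp
    then show ?thesis using sublinear_on_scale[OF q a that(2)] by (simp add: h_def)
  qed
  have le: "q' x \<le> h x t" if "x \<in> V" "t \<ge> 0" for x t
  proof -
    have "bdd_below (h x ` {0..})" using lo that by (intro bdd_belowI2[of _ "- q (- x)"]) auto
    then show ?thesis using that by (auto simp: q'_def intro!: cINF_lower)
  qed
  have ge: "b \<le> q' x" if "x \<in> V" "\<And>t. t \<ge> 0 \<Longrightarrow> b \<le> h x t" for x b
    using that by (auto simp: q'_def intro!: cINF_greatest)
  show "q' x \<le> q x" if "x \<in> V" for x using le[OF that, of 0] by (simp add: h_def)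
  show "q' x \<le> q (x + a) - q a" if "x \<in> V" for x using le[OF that, of 1] by (simp add: h_def)
  show "q' x = 0" if "x \<notin> V" for x using that by (simp add: q'_def)
  show "sublinear_on s V q'"
    unfolding sublinear_on_def
  proof (intro conjI ballI allI impI)
    fix x y assume x: "x \<in> V" and y: "y \<in> V"
    \<comment> \<open>The parameters of \<open>x\<close> and \<open>y\<close> add up, so t and t'
      stay independent and the two infima can be taken one after the other.\<close>
    have 1: "q' (x + y) \<le> h x t + h y t'" if "t \<ge> 0" "t' \<ge> 0" for t t'
    proof -
      have "q' (x + y) \<le> h (x + y) (t + t')" using le[of "x + y" "t + t'"] x y that by simp
      also have "x + y + s (t + t') a = (x + s t a) + (y + s t' a)" by (simp add: S.scale_left_distrib)
      then have "h (x + y) (t + t') \<le> h x t + h y t'"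
        using sublinear_onD(1)[OF q, of "x + s t a" "y + s t' a"] x y by (simp add: h_def algebra_simps)
      finally show ?thesis .
    qed
    have "q' (x + y) - h y t' \<le> q' x" if "t' \<ge> 0" for t'
      using ge[OF x, of "q' (x + y) - h y t'"] 1[OF _ that] by (simp add: algebra_simps)
    then show "q' (x + y) \<le> q' x + q' y"
      using ge[OF y, of "q' (x + y) - q' x"] by (simp add: algebra_simps)
  next
    fix x and r :: real assume x: "x \<in> V" and r: "r \<ge> 0"
    have 1: "q' (s r x) \<le> r * h x t" if "t \<ge> 0" for t
    proof -
      have "q' (s r x) \<le> h (s r x) (r * t)" using le x r that by simp
      also have "s r x + s (r * t) a = s r (x + s t a)" by (simp add: S.scale_right_distrib)
      then have "h (s r x) (r * t) = r * h x t"
        using sublinear_on_scale[OF q _ r, of "x + s t a"] x by (simp add: h_def algebra_simps)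
      finally show ?thesis .
    qed
    show "q' (s r x) \<le> r * q' x"
    proof (cases "r = 0")
      case False
      then have "q' (s r x) / r \<le> q' x" using ge[OF x, of "q' (s r x) / r"] 1 r by (simp add: field_simps)
      then show ?thesis using False r by (simp add: field_simps)
    qed (use 1[of 0] in simp)
  qed
qed

text \<open>Subadditivity of the pointwise infimum needs the chain: two members, one tested at
  \<open>x\<close> and the other at \<open>y\<close>, are replaced by the smaller of them. The
  common lower bound \<open>b\<close> keeps the infimum finite.\<close>

lemma sublinear_on_chain_Inf:
  assumes C: "C \<noteq> {}" "\<And>q. q \<in> C \<Longrightarrow> sublinear_on s V q"
    and chain: "\<And>q q'. q \<in> C \<Longrightarrow> q' \<in> C \<Longrightarrow> q \<le> q' \<or> q' \<le> q"
    and lo: "\<And>q x. q \<in> C \<Longrightarrow> x \<in> V \<Longrightarrow> b x \<le> q x"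
  obtains q' where "sublinear_on s V q'" "\<And>q x. q \<in> C \<Longrightarrow> x \<in> V \<Longrightarrow> q' x \<le> q x"
    "\<And>x. x \<notin> V \<Longrightarrow> q' x = 0"
proof
  define q' where "q' x = (if x \<in> V then INF q\<in>C. q x else 0)" for x
  have le: "q' x \<le> q x" if "x \<in> V" "q \<in> C" for x q
  proof -
    have "bdd_below ((\<lambda>q. q x) ` C)" using lo that by (intro bdd_belowI2[of _ "b x"]) auto
    then show ?thesis using that by (auto simp: q'_def intro!: cINF_lower)
  qed
  have ge: "b \<le> q' x" if "x \<in> V" "\<And>q. q \<in> C \<Longrightarrow> b \<le> q x" for x b
    using that C by (auto simp: q'_def intro!: cINF_greatest)
  show "q' x \<le> q x" if "q \<in> C" "x \<in> V" for x q using le that by simp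
  show "q' x = 0" if "x \<notin> V" for x using that by (simp add: q'_def)
  show "sublinear_on s V q'"
    unfolding sublinear_on_def
  proof (intro conjI ballI allI impI)
    fix x y assume x: "x \<in> V" and y: "y \<in> V"
    have 1: "q' (x + y) \<le> q1 x + q2 y" if q: "q1 \<in> C" "q2 \<in> C" for q1 q2
    proof -
      obtain q where "q \<in> C" "q \<le> q1" "q \<le> q2" using chain[OF q] q by auto
      then have "q' (x + y) \<le> q (x + y)" "q (x + y) \<le> q x + q y" "q x \<le> q1 x" "q y \<le> q2 y"
        using le[of "x + y"] x y S.subspace_add[OF V] sublinear_onD(1)[OF C(2)] by (auto simp: le_fun_def)
      then show ?thesis by linarith
    qed
    have "q' (x + y) - q2 y \<le> q' x" if "q2 \<in> C" for q2
      using ge[OF x, of "q' (x + y) - q2 y"] 1[OF _ that] by (simp add: algebra_simps)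
    then show "q' (x + y) \<le> q' x + q' y"
      using ge[OF y, of "q' (x + y) - q' x"] by (simp add: algebra_simps)
  next
    fix x and r :: real assume x: "x \<in> V" and r: "r \<ge> 0"
    have 1: "q' (s r x) \<le> r * q x" if "q \<in> C" for q
      using le[of "s r x" q] sublinear_onD(2)[OF C(2) x r] S.subspace_scale[OF V x] that by fastforce
    show "q' (s r x) \<le> r * q' x"
    proof (cases "r = 0")
      case False
      then have "q' (s r x) / r \<le> q' x" using ge[OF x, of "q' (s r x) / r"] 1 r by (simp add: field_simps)
      then show ?thesis using False r by (simp add: field_simps)
    qed (use 1 C(1) in auto)
  qed
qed

text \<open>
  A minimal sublinear functional is linear: it coincides with all its shifts
  \<open>x \<mapsto> inf\<^sub>t (q (x + t a) - t q a)\<close>.  Minimizing below the shift of \<open>p\<close> by \<open>x0\<close> forces the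
  value at \<open>x0\<close>.
\<close>

lemma real_hahn_banach:
  assumes p: "sublinear_on s V p" and x0: "x0 \<in> V"
  obtains f where "\<And>x y. x \<in> V \<Longrightarrow> y \<in> V \<Longrightarrow> f (x + y) = f x + f y"
    "\<And>r x. x \<in> V \<Longrightarrow> f (s r x) = r * f x" "\<And>x. x \<in> V \<Longrightarrow> f x \<le> p x" "f x0 = p x0"
proof -
  obtain p' where p': "sublinear_on s V p'" "\<And>x. x \<in> V \<Longrightarrow> p' x \<le> p x"
    "\<And>x. x \<in> V \<Longrightarrow> p' x \<le> p (x + x0) - p x0" "\<And>x. x \<notin> V \<Longrightarrow> p' x = 0"
    using sublinear_on_shift[OF p x0] by blast
  \<comment> \<open>Since members of \<open>A\<close> vanish outside \<open>V\<close>, minimality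
    yields equality of functions and not merely equality on \<open>V\<close>.\<close>
  define A where "A = {q. sublinear_on s V q \<and> q \<le> p' \<and> (\<forall>x. x \<notin> V \<longrightarrow> q x = 0)}"
  have "\<exists>q\<in>A. \<forall>q'\<in>A. q' \<le> q \<longrightarrow> q' = q"
  \<comment> \<open>The order is reversed, so that the maximal element of Zorn's lemma is a minimal
    functional.\<close>
  proof (rule predicate_Zorn[where P = "\<lambda>x y. y \<le> x"])
    show "partial_order_on A (relation_of (\<lambda>x y. y \<le> x) A)"
      by (rule partial_order_on_relation_ofI) auto
    fix C assume "C \<in> Chains (relation_of (\<lambda>x y. y \<le> x) A)"
    then have C: "C \<subseteq> A" "\<And>q q'. q \<in> C \<Longrightarrow> q' \<in> C \<Longrightarrow> q \<le> q' \<or> q' \<le> q"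
      by (auto simp: Chains_def relation_of_def)
    show "\<exists>u\<in>A. \<forall>a\<in>C. u \<le> a"
    proof (cases "C = {}")
      case True
      then show ?thesis using p' by (auto simp: A_def intro!: exI[of _ p'])
    next
      case False
      \<comment> \<open>Every sublinear q satisfies \<open>- q (- x) \<le> q x\<close>, and q lies
        below \<open>p'\<close> at \<open>- x\<close>; hence one bound serves the whole
        chain.\<close>
      have lo: "- p' (- x) \<le> q x" if "q \<in> C" "x \<in> V" for q x
        using that C(1) sublinear_on_lower[of q x] by (force simp: A_def le_fun_def dest: spec[of _ "- x"])
      obtain q' where q': "sublinear_on s V q'" "\<And>q x. q \<in> C \<Longrightarrow> x \<in> V \<Longrightarrow> q' x \<le> q x"
        "\<And>x. x \<notin> V \<Longrightarrow> q' x = 0"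
        using sublinear_on_chain_Inf[OF False _ C(2), of "\<lambda>x. - p' (- x)"] C(1) lo
        by (auto simp: A_def subset_iff)
      have 1: "q' \<le> q" if "q \<in> C" for q
      proof (rule le_funI)
        show "q' x \<le> q x" for x using q'(2)[OF that, of x] q'(3)[of x] that C(1)
          by (cases "x \<in> V") (auto simp: A_def)
      qed
      moreover have "q' \<le> p'" using False 1 C(1) by (force simp: A_def)
      ultimately show ?thesis using q' by (auto simp: A_def)
    qed
  qed
  then obtain q where q: "q \<in> A" and min: "\<And>q'. q' \<in> A \<Longrightarrow> q' \<le> q \<Longrightarrow> q' = q" by blast
  have sub: "sublinear_on s V q" and qp': "q \<le> p'" using q by (auto simp: A_def)
  have add: "q (x + a) = q x + q a" if x: "x \<in> V" and a: "a \<in> V" for x a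
  proof -
    obtain q' where q': "sublinear_on s V q'" "\<And>x. x \<in> V \<Longrightarrow> q' x \<le> q x"
      "\<And>x. x \<in> V \<Longrightarrow> q' x \<le> q (x + a) - q a" "\<And>x. x \<notin> V \<Longrightarrow> q' x = 0"
      using sublinear_on_shift[OF sub a] by blast
    have "q' \<le> q"
    proof (rule le_funI)
      show "q' x \<le> q x" for x using q'(2,4)[of x] q by (cases "x \<in> V") (auto simp: A_def)
    qed
    moreover from this have "q' \<in> A" using q' q by (auto simp: A_def)
    ultimately have "q' = q" by (intro min)
    then show ?thesis using q'(3)[OF x] sublinear_onD(1)[OF sub x a] by simp
  qed
  note pos = sublinear_on_scale[OF sub]
  have q0: "q 0 = 0" using pos[OF x0, of 0] by simp
  have neg: "q (- x) = - q x" if "x \<in> V" for x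
    using add[OF that S.subspace_neg[OF V that]] q0 by simp
  show thesis
  proof
    show "q (x + y) = q x + q y" if "x \<in> V" "y \<in> V" for x y using add that .
    show "q (s r x) = r * q x" if x: "x \<in> V" for r x
    proof (cases "r \<ge> 0")
      case False
      have "q (s r x) = q (- s (- r) x)" by simp
      also have "\<dots> = r * q x" using neg[OF S.subspace_scale[OF V x], of "- r"] pos[OF x, of "- r"] False by simp
      finally show ?thesis .
    qed (use pos x in simp)
    show le: "q x \<le> p x" if "x \<in> V" for x
      using p'(2)[OF that] le_funD[OF qp', of x] by simp
    \<comment> \<open>The shift by \<open>x0\<close>, evaluated at \<open>- x0\<close>, is at most
      \<open>p 0 - p x0 = - p x0\<close>; linearity turns this into
      \<open>q x0 \<ge> p x0\<close>.\<close>
    have "q (- x0) \<le> p (- x0 + x0) - p x0"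
      using p'(3)[OF S.subspace_neg[OF V x0]] le_funD[OF qp', of "- x0"] by simp
    moreover have "p 0 = 0" using sublinear_on_scale[OF p x0, of 0] by simp
    ultimately show "q x0 = p x0" using neg[OF x0] le[OF x0] by simp
  qed
qed

end

section \<open>Transfer of the scalars to the complex numbers\<close>

text \<open>The image of 1 is idempotent and, by isometry, nonzero; the only such complex number is
  1.\<close>

lemma to_complex_of_real: "to_complex (of_real r :: 'k::real_or_complex) = of_real r"
proof -
  have "to_complex (1::'k) * to_complex (1::'k) = to_complex (1::'k)" by (simp flip: to_complex_mult)
  moreover have "to_complex (1::'k) \<noteq> 0" using norm_to_complex[of "1::'k"] by auto
  ultimately have "to_complex (1::'k) = 1" by simp
  then show ?thesis using to_complex_scaleR[of r "1::'k"] by (simp add: scaleR_conv_of_real)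
qed

lemma to_complex_diff: "to_complex (a - b :: 'k::real_or_complex) = to_complex a - to_complex b"
  using to_complex_add[of "a - b" b] by (simp add: algebra_simps)

lemma inj_to_complex: "inj (to_complex :: 'k::real_or_complex \<Rightarrow> complex)"
proof (rule injI)
  fix a b :: 'k assume "to_complex a = to_complex b"
  then have "norm (a - b) = 0" by (simp add: to_complex_diff norm_to_complex[of "a - b", symmetric])
  then show "a = b" by simp
qed

text \<open>Nothing is extended from a subspace: the point is a functional dominated by the seminorm
  \<open>p\<close> that attains it at \<open>x0\<close>. In this form it yields norming functionals
  and, for a quotient gauge, local reflexivity.\<close>

theorem hahn_banach:
  fixes s :: "'k::real_or_complex \<Rightarrow> 'v::ab_group_add \<Rightarrow> 'v"
  assumes vs: "vector_space s" and V: "module.subspace s V"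
    and p_add: "\<And>x y. x \<in> V \<Longrightarrow> y \<in> V \<Longrightarrow> p (x + y) \<le> p x + p y"
    and p_scale: "\<And>c x. x \<in> V \<Longrightarrow> p (s c x) \<le> norm c * p x"
    and x0: "x0 \<in> V"
  obtains l where "\<And>x y. x \<in> V \<Longrightarrow> y \<in> V \<Longrightarrow> l (x + y) = l x + l y"
    "\<And>c x. x \<in> V \<Longrightarrow> l (s c x) = c * l x" "\<And>x. x \<in> V \<Longrightarrow> norm (l x) \<le> p x" "l x0 = of_real (p x0)"
proof -
  interpret S: vector_space s by fact
  note VI = S.subspace_add[OF V] S.subspace_scale[OF V] S.subspace_neg[OF V]
  define sr where "sr r = s (of_real r)" for r
  have vsr: "vector_space sr" by unfold_locales (auto simp: sr_def algebra_simps)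
  interpret R: vector_space sr by fact
  have Vr: "R.subspace V" by (auto simp: R.subspace_def sr_def S.subspace_0[OF V] VI)
  have "sublinear_on sr V p"
    unfolding sublinear_on_def sr_def
  proof (intro conjI ballI allI impI)
    show "p (s (of_real r) x) \<le> r * p x" if "x \<in> V" "0 \<le> r" for x r
      using p_scale[OF that(1), of "of_real r"] that(2) by simp
  qed (rule p_add)
  from real_hahn_banach[OF vsr Vr this x0] obtain f where
    f_add: "\<And>x y. x \<in> V \<Longrightarrow> y \<in> V \<Longrightarrow> f (x + y) = f x + f y" and
    f_scale: "\<And>r x. x \<in> V \<Longrightarrow> f (s (of_real r) x) = r * f x" and
    f_le: "\<And>x. x \<in> V \<Longrightarrow> f x \<le> p x" and f_x0: "f x0 = p x0"
    unfolding sr_def by metis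
  have f_neg: "f (- x) = - f x" if "x \<in> V" for x
    using f_scale[OF that, of "-1"] by simp
  text \<open>It suffices to make \<open>f\<close> the real part of a \<open>'k\<close>-linear functional.\<close>
  note result = that
  have main: thesis if l_add: "\<And>x y. x \<in> V \<Longrightarrow> y \<in> V \<Longrightarrow> l (x + y) = l x + l y"
    and l_scale: "\<And>c x. x \<in> V \<Longrightarrow> l (s c x) = c * l x"
    and Re_l: "\<And>x. x \<in> V \<Longrightarrow> Re (to_complex (l x)) = f x" for l :: "'v \<Rightarrow> 'k"
  proof -
    have l_le: "norm (l x) \<le> p x" if x: "x \<in> V" for x
    proof (cases "l x = 0")
      case True
      have "f x = 0" "f (- x) = 0" using Re_l[OF x] f_neg[OF x] True to_complex_of_real[of 0, where 'k = 'k] by auto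
      then show ?thesis using f_le[OF x] True by simp
    next
      case False
      \<comment> \<open>A scalar of modulus 1 rotates \<open>l x\<close> to its absolute value,
        where \<open>l\<close> agrees with \<open>f\<close>, and \<open>p\<close> does not increase
        under this rotation.\<close>
      define u where "u = of_real (norm (l x)) / l x"
      have u: "norm u = 1" using False by (simp add: u_def norm_divide)
      have "l (s u x) = of_real (norm (l x))" using l_scale[OF x, of u] False by (simp add: u_def)
      then have "norm (l x) = f (s u x)" using Re_l[OF VI(2)[OF x], of u] by (simp add: to_complex_of_real)
      also have "\<dots> \<le> p x" using f_le[OF VI(2)[OF x, of u]] p_scale[OF x, of u] u by simp
      finally show ?thesis .
    qed
    have "l x0 = of_real (p x0)"
    proof (rule injD[OF inj_to_complex])
      \<comment> \<open>A complex number whose modulus does not exceed its real part has imaginary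
        part 0; hence knowing the real part at \<open>x0\<close> is enough.\<close>
      have "cmod (to_complex (l x0)) \<le> Re (to_complex (l x0))"
        using l_le[OF x0] Re_l[OF x0] f_x0 by (simp add: norm_to_complex)
      then have "(Re (to_complex (l x0)))\<^sup>2 + (Im (to_complex (l x0)))\<^sup>2 \<le> (Re (to_complex (l x0)))\<^sup>2"
        unfolding cmod_power2[symmetric] by (intro power_mono) auto
      then show "to_complex (l x0) = to_complex (of_real (p x0) :: 'k)"
        using Re_l[OF x0] f_x0 by (simp add: to_complex_of_real complex_eq_iff)
    qed
    then show thesis using result[of l] l_add l_scale l_le by blast
  qed
  consider "range (to_complex :: 'k \<Rightarrow> complex) = \<real>" | "range (to_complex :: 'k \<Rightarrow> complex) = UNIV"
    using range_to_complex by blast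
  then show thesis
  proof cases
    case 1
    \<comment> \<open>Over the reals every scalar is an \<open>of_real\<close>, so \<open>f\<close>
      itself, read in the scalar field, is already the functional.\<close>
    have "\<exists>r. c = of_real r" for c :: 'k
    proof -
      obtain r where "to_complex c = of_real r" using 1 by (metis Reals_cases rangeI)
      then have "c = of_real r" using injD[OF inj_to_complex] by (metis to_complex_of_real)
      then show ?thesis ..
    qed
    then have "f (s c x) = Re (to_complex c) * f x" "c = of_real (Re (to_complex c))" if "x \<in> V" for c x
      using f_scale[OF that] by (metis to_complex_of_real Re_complex_of_real)+
    then show thesis
      by (intro main[of "\<lambda>x. of_real (f x)"]) (auto simp: f_add to_complex_of_real)
  next
    case 2
    obtain i :: 'k where i: "to_complex i = \<i>" using 2 by (metis UNIV_I imageE)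
    have ii: "i * i = - 1"
    proof -
      have "to_complex (i * i) = to_complex (of_real (- 1) :: 'k)"
        unfolding to_complex_mult to_complex_of_real i by simp
      then have "i * i = of_real (- 1)" by (rule injD[OF inj_to_complex])
      then show ?thesis by simp
    qed
    have dec: "c = of_real (Re (to_complex c)) + of_real (Im (to_complex c)) * i" for c :: 'k
      by (rule injD[OF inj_to_complex])
        (simp add: to_complex_add to_complex_mult to_complex_of_real i complex_eq_iff)
    \<comment> \<open>The usual complexification f(x) - i f(ix) of a real-linear functional.\<close>
    define l where "l x = of_real (f x) - i * of_real (f (s i x))" for x
    show thesis
    proof (rule main[of l])
      show add: "l (x + y) = l x + l y" if "x \<in> V" "y \<in> V" for x y
        using that by (simp add: l_def f_add VI S.scale_right_distrib algebra_simps)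
      show "l (s c x) = c * l x" if x: "x \<in> V" for c x
      proof -
        have r: "l (s (of_real r) x) = of_real r * l x" if "x \<in> V" for r x
          using f_scale[OF that, of r] f_scale[OF VI(2)[OF that], of r i] that
          by (simp add: l_def algebra_simps)
        have "s i (s i x) = - x" by (simp add: ii)
        then have "l (s i x) = i * l x" using ii f_neg[OF x] by (simp add: l_def algebra_simps flip: mult.assoc)
        then have "l (s (of_real (Re (to_complex c)) + of_real (Im (to_complex c)) * i) x) =
            (of_real (Re (to_complex c)) + of_real (Im (to_complex c)) * i) * l x"
          using r[OF x] r[OF VI(2)[OF x], of "Im (to_complex c)" i]
            add[OF VI(2)[OF x] VI(2)[OF x], of "of_real (Re (to_complex c))" "of_real (Im (to_complex c)) * i"]
          by (simp add: S.scale_left_distrib algebra_simps)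
        then show ?thesis using dec[of c] by simp
      qed
      show "Re (to_complex (l x)) = f x" for x
        by (simp add: l_def to_complex_diff to_complex_mult to_complex_of_real i)
    qed
  qed
qed


section \<open>Duals of normed spaces\<close>

definition lin_on :: "('k::real_or_complex, 'a::ab_group_add) nspace \<Rightarrow> ('a \<Rightarrow> 'k) \<Rightarrow> bool" where
  "lin_on X f \<longleftrightarrow> (\<forall>x\<in>carr X. \<forall>y\<in>carr X. f (x + y) = f x + f y) \<and>
     (\<forall>c. \<forall>x\<in>carr X. f (scl X c x) = c * f x)"

lemma carr_dual:
  "f \<in> carr (dual X) \<longleftrightarrow>
     lin_on X f \<and> (\<exists>C. \<forall>x\<in>carr X. norm (f x) \<le> C * nrm X x) \<and> (\<forall>x. x \<notin> carr X \<longrightarrow> f x = 0)"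
  by (simp add: dual_def lin_on_def)

lemma scl_dual: "scl (dual X) c f = (\<lambda>x. c * f x)"
  by (simp add: dual_def)

lemma dual_add:
  "f \<in> carr (dual X) \<Longrightarrow> x \<in> carr X \<Longrightarrow> y \<in> carr X \<Longrightarrow> f (x + y) = f x + f y"
  by (simp add: carr_dual lin_on_def)

lemma dual_scl: "f \<in> carr (dual X) \<Longrightarrow> x \<in> carr X \<Longrightarrow> f (scl X c x) = c * f x"
  by (simp add: carr_dual lin_on_def)

lemma dual_outside: "f \<in> carr (dual X) \<Longrightarrow> x \<notin> carr X \<Longrightarrow> f x = 0"
  by (simp add: carr_dual)

context normed_space
begin

lemma carr_0 [simp]: "0 \<in> carr X"
  and carr_add [simp]: "x \<in> carr X \<Longrightarrow> y \<in> carr X \<Longrightarrow> x + y \<in> carr X"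
  and carr_diff [simp]: "x \<in> carr X \<Longrightarrow> y \<in> carr X \<Longrightarrow> x - y \<in> carr X"
  and carr_scl [simp]: "x \<in> carr X \<Longrightarrow> scl X c x \<in> carr X"
  and carr_sum: "(\<And>i. i \<in> I \<Longrightarrow> w i \<in> carr X) \<Longrightarrow> sum w I \<in> carr X"
  using subspace_carr
  by (auto intro: subspace_0 subspace_add subspace_diff subspace_scale subspace_sum)

lemma nrm_0 [simp]: "nrm X 0 = 0"
  by (simp add: nrm_eq_0_iff)

lemma dual_0: "f \<in> carr (dual X) \<Longrightarrow> f 0 = 0"
  using dual_scl[of f X 0 0] by simp

lemma dual_sum:
  "f \<in> carr (dual X) \<Longrightarrow> (\<And>i. i \<in> I \<Longrightarrow> w i \<in> carr X) \<Longrightarrow> f (sum w I) = (\<Sum>i\<in>I. f (w i))"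
  by (induction I rule: infinite_finite_induct) (auto simp: dual_0 dual_add carr_sum)

lemma dual_diff:
  "f \<in> carr (dual X) \<Longrightarrow> x \<in> carr X \<Longrightarrow> y \<in> carr X \<Longrightarrow> f (x - y) = f x - f y"
  using dual_add[of f X "x - y" y] by simp

lemma unit_ball_nonempty: "{x \<in> carr X. nrm X x \<le> 1} \<noteq> {}"
proof -
  have "0 \<in> {x \<in> carr X. nrm X x \<le> 1}" by simp
  then show ?thesis by blast
qed

text \<open>The dual norm is a supremum of reals, which has its intended meaning only for a bounded
  set.\<close>

lemma dual_bdd:
  assumes "f \<in> carr (dual X)"
  shows "bdd_above ((\<lambda>x. norm (f x)) ` {x \<in> carr X. nrm X x \<le> 1})"
proof -
  obtain C where C: "\<And>x. x \<in> carr X \<Longrightarrow> norm (f x) \<le> C * nrm X x"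
    using assms by (auto simp: carr_dual)
  show ?thesis
  proof (rule bdd_aboveI2)
    fix x assume "x \<in> {x \<in> carr X. nrm X x \<le> 1}"
    then have "norm (f x) \<le> C * nrm X x" "nrm X x \<le> 1" "0 \<le> nrm X x" using C nrm_nonneg by auto
    moreover have "C * nrm X x \<le> \<bar>C\<bar> * 1"
      using calculation by (intro mult_mono) auto
    ultimately show "norm (f x) \<le> \<bar>C\<bar>" by simp
  qed
qed

lemma dual_nrm_upper:
  "f \<in> carr (dual X) \<Longrightarrow> x \<in> carr X \<Longrightarrow> nrm X x \<le> 1 \<Longrightarrow> norm (f x) \<le> nrm (dual X) f"
  using cSUP_upper[OF _ dual_bdd, of x f] by (simp add: dual_def)

lemma dual_nrm_nonneg: "f \<in> carr (dual X) \<Longrightarrow> 0 \<le> nrm (dual X) f"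
  using dual_nrm_upper[of f 0] by (simp add: dual_0)

lemma dual_nrm_bound:
  assumes f: "f \<in> carr (dual X)" and x: "x \<in> carr X"
  shows "norm (f x) \<le> nrm (dual X) f * nrm X x"
proof (cases "x = 0")
  case False
  then have p: "nrm X x > 0" using nrm_eq_0_iff[OF x] nrm_nonneg[OF x] by simp
  let ?u = "scl X (of_real (1 / nrm X x)) x"
  have "norm (f ?u) \<le> nrm (dual X) f"
    using x p by (intro dual_nrm_upper[OF f]) (auto simp: nrm_scl norm_divide)
  then show ?thesis using p by (simp add: dual_scl[OF f x] norm_mult norm_divide field_simps)
qed (simp add: dual_0[OF f])

lemma dual_nrm_least:
  assumes "\<And>x. x \<in> carr X \<Longrightarrow> norm (f x) \<le> K * nrm X x" "K \<ge> 0"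
  shows "nrm (dual X) f \<le> K"
  unfolding dual_def nspace.simps
proof (rule cSUP_least[OF unit_ball_nonempty])
  fix x assume "x \<in> {x \<in> carr X. nrm X x \<le> 1}"
  then show "norm (f x) \<le> K" using assms(1)[of x] mult_left_mono[of "nrm X x" 1 K] assms(2) by auto
qed

lemma dual_nrm_approx:
  assumes "f \<in> carr (dual X)" "d < nrm (dual X) f"
  obtains x where "x \<in> carr X" "nrm X x \<le> 1" "d < norm (f x)"
proof -
  have "\<exists>x\<in>{x \<in> carr X. nrm X x \<le> 1}. d < norm (f x)"
  proof (rule ccontr)
    assume "\<not> ?thesis"
    then have "nrm (dual X) f \<le> d"
      unfolding dual_def nspace.simps
      by (intro cSUP_least[OF unit_ball_nonempty]) (auto simp: not_less)
    then show False using assms(2) by simp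
  qed
  then show thesis using that by auto
qed

text \<open>An almost norming vector is multiplied by a scalar of modulus 1 that makes the value
  real and nonnegative. Values of several functionals can then be added without cancellation, as the
  proof of local reflexivity requires.\<close>

lemma dual_nrm_attained_approx:
  assumes f: "f \<in> carr (dual X)" and d: "d < nrm (dual X) f"
  obtains x r where "x \<in> carr X" "nrm X x \<le> 1" "f x = of_real r" "d < r" "r \<ge> 0"
proof -
  obtain x where x: "x \<in> carr X" "nrm X x \<le> 1" "d < norm (f x)" by (rule dual_nrm_approx[OF f d])
  show thesis
  proof (cases "f x = 0")
    case True
    then show thesis using that[of x 0] x by simp
  next
    case False
    let ?u = "of_real (norm (f x)) / f x"
    have "norm ?u = 1" using False by (simp add: norm_divide)
    then show thesis
      using that[of "scl X ?u x" "norm (f x)"] x False by (simp add: dual_scl[OF f x(1)] nrm_scl)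
  qed
qed

text \<open>Applied twice, this makes every estimate of the present section available for the bidual
  as well.\<close>

lemma normed_space_dual: "normed_space (dual X)"
proof
  show "scl (dual X) a (x + y) = scl (dual X) a x + scl (dual X) a y"
    "scl (dual X) (a + b) x = scl (dual X) a x + scl (dual X) b x"
    "scl (dual X) a (scl (dual X) b x) = scl (dual X) (a * b) x"
    "scl (dual X) 1 x = x" for a b x y
    by (auto simp: scl_dual fun_eq_iff algebra_simps)
  then interpret D: vector_space "scl (dual X)" by unfold_locales
  show "D.subspace (carr (dual X))"
    unfolding D.subspace_def
  proof (intro conjI ballI allI)
    show "0 \<in> carr (dual X)"
      by (auto simp: carr_dual lin_on_def intro!: exI[of _ 0])
    fix f assume f: "f \<in> carr (dual X)"
    show "scl (dual X) c f \<in> carr (dual X)" for c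
    proof -
      have "norm (c * f x) \<le> (norm c * nrm (dual X) f) * nrm X x" if "x \<in> carr X" for x
        using dual_nrm_bound[OF f that] by (simp add: norm_mult mult.assoc mult_left_mono)
      then show ?thesis
        using dual_add[OF f] dual_scl[OF f] dual_outside[OF f]
        unfolding carr_dual lin_on_def scl_dual
        by (intro conjI exI[of _ "norm c * nrm (dual X) f"]) (auto simp: algebra_simps)
    qed
    fix g assume g: "g \<in> carr (dual X)"
    have "norm (f x + g x) \<le> (nrm (dual X) f + nrm (dual X) g) * nrm X x" if "x \<in> carr X" for x
      using dual_nrm_bound[OF f that] dual_nrm_bound[OF g that] norm_triangle_ineq[of "f x" "g x"]
      by (simp add: algebra_simps)
    then show "f + g \<in> carr (dual X)"
      using dual_add[OF f] dual_scl[OF f] dual_outside[OF f] dual_add[OF g] dual_scl[OF g] dual_outside[OF g]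
      unfolding carr_dual lin_on_def
      by (intro conjI exI[of _ "nrm (dual X) f + nrm (dual X) g"]) (auto simp: algebra_simps)
  qed
  fix f assume f: "f \<in> carr (dual X)"
  show "0 \<le> nrm (dual X) f" using dual_nrm_nonneg[OF f] .
  show "nrm (dual X) f = 0 \<longleftrightarrow> f = 0"
  proof
    assume 0: "nrm (dual X) f = 0"
    have "f x = 0" for x
      using dual_nrm_bound[OF f, of x] dual_outside[OF f, of x] 0 by (cases "x \<in> carr X") auto
    then show "f = 0" by (simp add: fun_eq_iff)
  next
    assume "f = 0"
    then show "nrm (dual X) f = 0"
      using dual_nrm_least[of f 0] dual_nrm_nonneg[OF f] by simp
  qed
  show "nrm (dual X) (scl (dual X) c f) = norm c * nrm (dual X) f" for c
  proof -
    \<comment> \<open>Only one inequality is proved directly; the other is this one for the scaled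
      functional and the scalar 1/c.\<close>
    have le: "nrm (dual X) (scl (dual X) c g) \<le> norm c * nrm (dual X) g" if "g \<in> carr (dual X)" for c g
      using dual_nrm_bound[OF that] dual_nrm_nonneg[OF that]
      by (intro dual_nrm_least) (auto simp: scl_dual norm_mult mult.assoc mult_left_mono)
    show ?thesis
    proof (cases "c = 0")
      case True
      have "scl (dual X) c f \<in> carr (dual X)"
        using D.subspace_scale[OF \<open>D.subspace (carr (dual X))\<close> f] .
      then show ?thesis using le[OF f, of c] dual_nrm_nonneg True by fastforce
    next
      case False
      have "scl (dual X) c f \<in> carr (dual X)"
        using D.subspace_scale[OF \<open>D.subspace (carr (dual X))\<close> f] .
      from le[OF this, of "1 / c"] False have "nrm (dual X) f \<le> norm (1 / c) * nrm (dual X) (scl (dual X) c f)"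
        by simp
      then show ?thesis using le[OF f, of c] False by (simp add: norm_divide field_simps)
    qed
  qed
  fix g assume g: "g \<in> carr (dual X)"
  show "nrm (dual X) (f + g) \<le> nrm (dual X) f + nrm (dual X) g"
  proof (rule dual_nrm_least)
    show "norm ((f + g) x) \<le> (nrm (dual X) f + nrm (dual X) g) * nrm X x" if "x \<in> carr X" for x
      using dual_nrm_bound[OF f that] dual_nrm_bound[OF g that] norm_triangle_ineq[of "f x" "g x"]
      by (simp add: algebra_simps)
  qed (use dual_nrm_nonneg f g in auto)
qed

text \<open>Hahn-Banach with the norm as dominating seminorm; the functional is cut off outside
  \<open>carr X\<close> because members of the dual vanish there.\<close>

lemma norming_functional:
  assumes x: "x \<in> carr X"
  obtains f where "f \<in> carr (dual X)" "nrm (dual X) f \<le> 1" "f x = of_real (nrm X x)"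
proof -
  have "vector_space (scl X)" by unfold_locales
  then obtain l where l: "\<And>x y. x \<in> carr X \<Longrightarrow> y \<in> carr X \<Longrightarrow> l (x + y) = l x + l y"
    "\<And>c x. x \<in> carr X \<Longrightarrow> l (scl X c x) = c * l x" "\<And>x. x \<in> carr X \<Longrightarrow> norm (l x) \<le> nrm X x"
    "l x = of_real (nrm X x)"
    using hahn_banach[OF _ subspace_carr, of "nrm X" x] nrm_triangle nrm_scl x by (metis order_refl)
  let ?f = "\<lambda>x. if x \<in> carr X then l x else 0"
  show thesis
  proof
    show "?f \<in> carr (dual X)" using l by (auto simp: carr_dual lin_on_def intro!: exI[of _ 1])
    show "nrm (dual X) ?f \<le> 1" using l by (intro dual_nrm_least) auto
    show "?f x = of_real (nrm X x)" using l x by simp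
  qed
qed

lemma canon_in_bidual:
  assumes x: "x \<in> carr X"
  shows "canon X x \<in> carr (bidual X)"
proof -
  interpret D: normed_space "dual X" by (rule normed_space_dual)
  have "norm (f x) \<le> nrm X x * nrm (dual X) f" if "f \<in> carr (dual X)" for f
    using dual_nrm_bound[OF that x] by (simp add: mult.commute)
  moreover have "(\<lambda>x. c * f x) \<in> carr (dual X)" if "f \<in> carr (dual X)" for c f
    using D.carr_scl[OF that, of c] by (simp add: scl_dual)
  ultimately show ?thesis
    by (auto simp: carr_dual[of _ "dual X"] lin_on_def canon_def scl_dual)
qed

lemma nrm_canon:
  assumes x: "x \<in> carr X"
  shows "nrm (bidual X) (canon X x) = nrm X x"
proof -
  interpret D: normed_space "dual X" by (rule normed_space_dual)
  obtain f where f: "f \<in> carr (dual X)" "nrm (dual X) f \<le> 1" "f x = of_real (nrm X x)"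
    by (rule norming_functional[OF x])
  have "nrm X x \<le> nrm (bidual X) (canon X x)"
    using D.dual_nrm_upper[OF canon_in_bidual[OF x] f(1,2)] f(1,3) nrm_nonneg[OF x] by (simp add: canon_def)
  moreover have "nrm (bidual X) (canon X x) \<le> nrm X x"
  proof (rule D.dual_nrm_least)
    show "norm (canon X x f) \<le> nrm X x * nrm (dual X) f" if "f \<in> carr (dual X)" for f
      using dual_nrm_bound[OF that x] that by (simp add: canon_def mult.commute)
  qed (rule nrm_nonneg[OF x])
  ultimately show ?thesis by simp
qed

lemma canon_sum_scl:
  assumes "\<And>i. i \<in> I \<Longrightarrow> x i \<in> carr X"
  shows "canon X (\<Sum>i\<in>I. scl X (c i) (x i)) = (\<Sum>i\<in>I. scl (bidual X) (c i) (canon X (x i)))"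
proof
  fix f
  have s: "sum w I f = (\<Sum>i\<in>I. w i f)" for w :: "_ \<Rightarrow> ('a \<Rightarrow> 'k) \<Rightarrow> 'k"
    by (induction I rule: infinite_finite_induct) auto
  show "canon X (\<Sum>i\<in>I. scl X (c i) (x i)) f = (\<Sum>i\<in>I. scl (bidual X) (c i) (canon X (x i))) f"
    using assms by (auto simp: canon_def s scl_dual dual_sum dual_scl)
qed

end


section \<open>Local reflexivity\<close>

context normed_space
begin

interpretation D: normed_space "dual X"
  by (rule normed_space_dual)

text \<open>A functional vanishing on the common kernel of finitely many functionals is a linear
  combination of them, and \<open>y\<close> agrees with evaluation at \<open>x\<close> on each of
  these. The induction strips off one functional at a time and never writes the combination
  down.\<close>

lemma bidual_eq_eval:
  assumes "finite \<Gamma>" "\<Gamma> \<subseteq> carr (dual X)" and y: "y \<in> carr (bidual X)" and x: "x \<in> carr X"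
    and "\<And>\<gamma>. \<gamma> \<in> \<Gamma> \<Longrightarrow> \<gamma> x = y \<gamma>" and "g \<in> carr (dual X)"
    and "\<And>u. u \<in> carr X \<Longrightarrow> (\<And>\<gamma>. \<gamma> \<in> \<Gamma> \<Longrightarrow> \<gamma> u = 0) \<Longrightarrow> g u = 0"
  shows "y g = g x"
  using assms(1,2,5-)
proof (induction \<Gamma> arbitrary: g rule: finite_induct)
  case empty
  then have g: "g = 0" by (auto simp: fun_eq_iff dest: dual_outside)
  have "y g = 0" unfolding g by (rule D.dual_0[OF y])
  moreover have "g x = 0" unfolding g by simp
  ultimately show ?case by (simp only:)
next
  case (insert \<gamma>0 \<Gamma>)
  have \<gamma>0: "\<gamma>0 \<in> carr (dual X)" using insert.prems by simp
  show ?case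
  proof (cases "\<forall>u\<in>carr X. (\<forall>\<gamma>\<in>\<Gamma>. \<gamma> u = 0) \<longrightarrow> \<gamma>0 u = 0")
    case True
    then show ?thesis using insert.prems by (intro insert.IH) auto
  next
    case False
    then obtain v where v: "v \<in> carr X" "\<And>\<gamma>. \<gamma> \<in> \<Gamma> \<Longrightarrow> \<gamma> v = 0" "\<gamma>0 v \<noteq> 0" by blast
    \<comment> \<open>The coefficient \<open>b\<close> makes \<open>g'\<close> vanish at
      \<open>v\<close>. Moving \<open>u\<close> along \<open>v\<close> into the kernel of
      \<open>\<gamma>0\<close> then shows that \<open>g'\<close> vanishes on the common kernel of
      the smaller set.\<close>
    define b where "b = g v / \<gamma>0 v"
    define g' where "g' = g - scl (dual X) b \<gamma>0"
    have g': "g' \<in> carr (dual X)" using insert.prems \<gamma>0 by (auto simp: g'_def)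
    have "y g' = g' x"
    proof (rule insert.IH)
      fix u assume u: "u \<in> carr X" "\<And>\<gamma>. \<gamma> \<in> \<Gamma> \<Longrightarrow> \<gamma> u = 0"
      let ?w = "u - scl X (\<gamma>0 u / \<gamma>0 v) v"
      have "g ?w = 0"
      proof (rule insert.prems(4))
        fix \<gamma> assume \<gamma>: "\<gamma> \<in> insert \<gamma>0 \<Gamma>"
        then have "\<gamma> \<in> carr (dual X)" using insert.prems(1) by blast
        then have *: "\<gamma> ?w = \<gamma> u - \<gamma>0 u / \<gamma>0 v * \<gamma> v"
          using u(1) v(1) by (simp add: dual_diff dual_scl)
        show "\<gamma> ?w = 0"
          using \<gamma> v u(2)[of \<gamma>] unfolding * by (cases "\<gamma> = \<gamma>0") simp_all
      qed (use u v in simp)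
      then show "g' u = 0"
        using insert.prems(3) u v by (simp add: dual_diff dual_scl g'_def b_def scl_dual)
    qed (use g' insert.prems in auto)
    moreover have "y g' = y g - b * y \<gamma>0"
      unfolding g'_def using insert.prems(3) \<gamma>0 y by (subst D.dual_diff) (auto simp: dual_scl)
    ultimately show ?thesis using insert.prems(2)[of \<gamma>0] by (simp add: g'_def scl_dual)
  qed
qed

text \<open>Exact interpolation without control of the norm. A functional that depends on the
  earlier ones is matched automatically by \<open>bidual_eq_eval\<close>; for an independent one,
  \<open>x\<close> is corrected along a vector \<open>v\<close> that the earlier ones
  annihilate.\<close>

lemma bidual_interpolation:
  assumes "finite \<Gamma>" "\<Gamma> \<subseteq> carr (dual X)" and y: "y \<in> carr (bidual X)"
  obtains x where "x \<in> carr X" "\<And>\<gamma>. \<gamma> \<in> \<Gamma> \<Longrightarrow> \<gamma> x = y \<gamma>"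
proof -
  have "\<exists>x\<in>carr X. \<forall>\<gamma>\<in>\<Gamma>. \<gamma> x = y \<gamma>"
    using assms(1,2)
  proof (induction \<Gamma> rule: finite_induct)
    case (insert \<gamma>0 \<Gamma>)
    then obtain x where x: "x \<in> carr X" "\<And>\<gamma>. \<gamma> \<in> \<Gamma> \<Longrightarrow> \<gamma> x = y \<gamma>" by auto
    show ?case
    proof (cases "\<forall>u\<in>carr X. (\<forall>\<gamma>\<in>\<Gamma>. \<gamma> u = 0) \<longrightarrow> \<gamma>0 u = 0")
      case True
      then have "y \<gamma>0 = \<gamma>0 x"
        using insert.hyps(1) insert.prems x by (intro bidual_eq_eval[of \<Gamma>, OF _ _ y x(1) x(2)]) simp_all
      then show ?thesis using x by auto
    next
      case False
      then obtain v where v: "v \<in> carr X" "\<And>\<gamma>. \<gamma> \<in> \<Gamma> \<Longrightarrow> \<gamma> v = 0" "\<gamma>0 v \<noteq> 0" by blast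
      let ?w = "x + scl X ((y \<gamma>0 - \<gamma>0 x) / \<gamma>0 v) v"
      have *: "\<gamma> ?w = \<gamma> x + (y \<gamma>0 - \<gamma>0 x) / \<gamma>0 v * \<gamma> v" if "\<gamma> \<in> insert \<gamma>0 \<Gamma>" for \<gamma>
        using that insert.prems v x by (subst dual_add[of _ X]) (auto simp: dual_scl)
      have "\<forall>\<gamma>\<in>insert \<gamma>0 \<Gamma>. \<gamma> ?w = y \<gamma>"
      proof
        show "\<gamma> ?w = y \<gamma>" if "\<gamma> \<in> insert \<gamma>0 \<Gamma>" for \<gamma>
          using *[OF that] that v x by auto
      qed
      moreover have "?w \<in> carr X" using v x by simp
      ultimately show ?thesis by blast
    qed
  qed (use carr_0 in blast)
  then show thesis using that by blast
qed

text \<open>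
  A weak form of the principle of local reflexivity.  The gauge \<open>q\<close> below lives on \<open>X\<^sup>I\<close> and
  measures the combinations modulo the common kernel of \<open>\<Gamma>\<close>; a Hahn-Banach functional for \<open>q\<close> splits
  into functionals \<open>\<lambda> c\<close> on \<open>X\<close>, and its value can be computed in the bidual.
\<close>

theorem local_reflexivity:
  fixes a :: "('j \<Rightarrow> 'k) \<Rightarrow> real" and y :: "'j \<Rightarrow> ('a \<Rightarrow> 'k) \<Rightarrow> 'k"
  assumes J: "finite J" and I: "finite I" and \<Gamma>: "finite \<Gamma>" "\<Gamma> \<subseteq> carr (dual X)"
    and y: "\<And>j. j \<in> J \<Longrightarrow> y j \<in> carr (bidual X)"
    and a: "\<And>c. c \<in> I \<Longrightarrow> nrm (bidual X) (\<Sum>j\<in>J. scl (bidual X) (c j) (y j)) < a c"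
  obtains x where "\<And>j. j \<in> J \<Longrightarrow> x j \<in> carr X" "\<And>j g. j \<in> J \<Longrightarrow> g \<in> \<Gamma> \<Longrightarrow> g (x j) = y j g"
    "\<And>c. c \<in> I \<Longrightarrow> nrm X (\<Sum>j\<in>J. scl X (c j) (x j)) \<le> a c"
proof -
  interpret B: normed_space "bidual X" by (rule D.normed_space_dual)
  \<comment> \<open>\<open>N\<close> consists of the corrections invisible to
    \<open>\<Gamma>\<close>, and \<open>S\<close> sends a family to its combinations. Thus
    \<open>q w\<close> is the infimum over corrections n of the largest ratio of
    \<open>nrm X (w c + S n c)\<close> to \<open>a c\<close>, and the aim becomes
    \<open>q (S x0) < 1\<close> for some interpolating family \<open>x0\<close>.\<close>
  define N where "N = {n. \<forall>j\<in>J. n j \<in> carr X \<and> (\<forall>\<gamma>\<in>\<Gamma>. \<gamma> (n j) = 0)}"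
  define S where "S x = (\<lambda>c. if c \<in> I then \<Sum>j\<in>J. scl X (c j) (x j) else 0)" for x
  define z where "z c = (\<Sum>j\<in>J. scl (bidual X) (c j) (y j))" for c
  define V where "V = {w :: ('j \<Rightarrow> 'k) \<Rightarrow> 'a. \<forall>c. w c \<in> carr X}"
  define sw where "sw b w = (\<lambda>c. scl X b (w c))" for b and w :: "('j \<Rightarrow> 'k) \<Rightarrow> 'a"
  define R where "R w = {r. 0 \<le> r \<and> (\<exists>n\<in>N. \<forall>c\<in>I. nrm X (w c + S n c) \<le> r * a c)}" for w
  define q where "q w = Inf (R w)" for w
  have z: "z c \<in> carr (bidual X)" for c using y by (auto simp: z_def intro!: B.carr_sum)
  have a0: "a c > 0" if "c \<in> I" for c
    using a[OF that] B.nrm_nonneg[OF z[of c]] by (simp add: z_def)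
  have vsw: "vector_space sw" by unfold_locales (auto simp: sw_def fun_eq_iff algebra_simps)
  interpret W: vector_space sw by fact
  have V: "W.subspace V" by (auto simp: W.subspace_def V_def sw_def)
  have SN: "S n \<in> V" if "n \<in> N" for n using that by (auto simp: V_def S_def N_def intro!: carr_sum)
  have S_add: "S (\<lambda>j. n j + m j) = S n + S m" for n m
    by (auto simp: S_def fun_eq_iff algebra_simps sum.distrib)
  have S_scl: "S (\<lambda>j. scl X b (n j)) = sw b (S n)" for n b
    by (auto simp: S_def sw_def fun_eq_iff scale_sum_right mult.commute)
  have N_add: "(\<lambda>j. n j + m j) \<in> N" if "n \<in> N" "m \<in> N" for n m
  proof -
    have "\<gamma> (n j + m j) = 0" if "j \<in> J" "\<gamma> \<in> \<Gamma>" for j \<gamma>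
    proof -
      have "n j \<in> carr X" "m j \<in> carr X" "\<gamma> (n j) = 0" "\<gamma> (m j) = 0"
        using that \<open>n \<in> N\<close> \<open>m \<in> N\<close> by (auto simp: N_def)
      then show ?thesis using dual_add[of \<gamma> X] that \<Gamma> by auto
    qed
    then show ?thesis using that by (auto simp: N_def)
  qed
  have N_scl: "(\<lambda>j. scl X b (n j)) \<in> N" if "n \<in> N" for n b
    using that \<Gamma> by (auto simp: N_def dual_scl subset_iff)
  have N_0: "(\<lambda>j. 0) \<in> N" using \<Gamma> by (auto simp: N_def dual_0 subset_iff)
  have S_0: "S (\<lambda>j. 0) = 0" by (auto simp: S_def fun_eq_iff)
  have q_le: "q w \<le> r" if "r \<in> R w" for w r
    unfolding q_def by (rule cInf_lower[OF that]) (auto simp: R_def intro!: bdd_belowI[of _ 0])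
  have R_ne: "R w \<noteq> {}" if "w \<in> V" for w
  proof -
    \<comment> \<open>Without correction, the sum of the ratios over the finite set \<open>I\<close>
      dominates each of them and is therefore admissible.\<close>
    have "nrm X (w c) / a c \<le> (\<Sum>c\<in>I. nrm X (w c) / a c)" if "c \<in> I" for c
      using that I \<open>w \<in> V\<close> a0 nrm_nonneg by (intro member_le_sum) (auto simp: V_def less_imp_le)
    then have "(\<Sum>c\<in>I. nrm X (w c) / a c) \<in> R w"
      using N_0 a0 nrm_nonneg \<open>w \<in> V\<close>
      by (auto simp: R_def S_0 V_def field_simps less_imp_le intro!: sum_nonneg bexI[of _ "\<lambda>j. 0"])
    then show ?thesis by blast
  qed
  have q_add: "q (w + w') \<le> q w + q w'" if w: "w \<in> V" "w' \<in> V" for w w'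
  proof (rule field_le_epsilon)
    fix e :: real assume "e > 0"
    then obtain r r' where r: "r \<in> R w" "r < q w + e / 2" "r' \<in> R w'" "r' < q w' + e / 2"
      using cInf_lessD[OF R_ne[OF w(1)], of "q w + e / 2"] cInf_lessD[OF R_ne[OF w(2)], of "q w' + e / 2"]
      unfolding q_def by force
    obtain n n' where n: "n \<in> N" "n' \<in> N" "\<And>c. c \<in> I \<Longrightarrow> nrm X (w c + S n c) \<le> r * a c"
      "\<And>c. c \<in> I \<Longrightarrow> nrm X (w' c + S n' c) \<le> r' * a c"
      using r by (auto simp: R_def)
    have "nrm X ((w + w') c + S (\<lambda>j. n j + n' j) c) \<le> (r + r') * a c" if "c \<in> I" for c
    proof -
      have "(w + w') c + S (\<lambda>j. n j + n' j) c = (w c + S n c) + (w' c + S n' c)"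
        by (simp add: S_add algebra_simps)
      then show ?thesis
        using nrm_triangle[of "w c + S n c" "w' c + S n' c"] n(3,4)[OF that] w SN[OF n(1)] SN[OF n(2)]
        by (simp add: V_def algebra_simps)
    qed
    then have "r + r' \<in> R (w + w')" using r N_add[OF n(1,2)] by (auto simp: R_def)
    then show "q (w + w') \<le> q w + q w' + e" using q_le r by fastforce
  qed
  have q_scl: "q (sw b w) \<le> norm b * q w" if w: "w \<in> V" for b w
  proof -
    have 1: "q (sw b w) \<le> norm b * r" if r: "r \<in> R w" for r
    proof (rule q_le)
      obtain n where n: "n \<in> N" "\<And>c. c \<in> I \<Longrightarrow> nrm X (w c + S n c) \<le> r * a c" "0 \<le> r"
        using r by (auto simp: R_def)
      have "nrm X (sw b w c + S (\<lambda>j. scl X b (n j)) c) \<le> norm b * r * a c" if "c \<in> I" for c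
      proof -
        have "sw b w c + S (\<lambda>j. scl X b (n j)) c = scl X b (w c + S n c)"
          by (simp add: S_scl sw_def algebra_simps)
        then show ?thesis
          using n(2)[OF that] w SN[OF n(1)] nrm_scl[of "w c + S n c" b]
          by (simp add: V_def mult.assoc mult_left_mono)
      qed
      then show "norm b * r \<in> R (sw b w)" using n(3) N_scl[OF n(1)] by (auto simp: R_def)
    qed
    show ?thesis
    proof (cases "b = 0")
      case False
      then have "q (sw b w) / norm b \<le> q w"
        using 1 unfolding q_def[of w] by (intro cInf_greatest[OF R_ne[OF w]]) (simp add: field_simps)
      then show ?thesis using False by (simp add: field_simps)
    qed (use 1 R_ne[OF w] in auto)
  qed
  \<comment> \<open>Any interpolating family will do; its norms are not controlled and are repaired
    by a correction from \<open>N\<close> at the end.\<close>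
  obtain x0 where x0: "\<And>j. j \<in> J \<Longrightarrow> x0 j \<in> carr X" "\<And>j \<gamma>. j \<in> J \<Longrightarrow> \<gamma> \<in> \<Gamma> \<Longrightarrow> \<gamma> (x0 j) = y j \<gamma>"
  proof -
    have "\<exists>x. \<forall>j\<in>J. x j \<in> carr X \<and> (\<forall>\<gamma>\<in>\<Gamma>. \<gamma> (x j) = y j \<gamma>)"
      by (rule bchoice) (meson bidual_interpolation[OF \<Gamma> y])
    then show thesis using that by blast
  qed
  have Sx0: "S x0 \<in> V" using x0 by (auto simp: V_def S_def intro!: carr_sum)
  obtain l where l_add: "\<And>x y. x \<in> V \<Longrightarrow> y \<in> V \<Longrightarrow> l (x + y) = l x + l y"
    and l_scl: "\<And>c x. x \<in> V \<Longrightarrow> l (sw c x) = c * l x" and l_le: "\<And>x. x \<in> V \<Longrightarrow> norm (l x) \<le> q x"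
    and l_Sx0: "l (S x0) = of_real (q (S x0))"
    using hahn_banach[OF vsw V q_add q_scl Sx0] by metis
  \<comment> \<open>\<open>\<delta> c\<close> embeds \<open>X\<close> as the coordinate
    \<open>c\<close>, so \<open>\<Lambda> c\<close> is the component of \<open>l\<close> there. It
    is continuous because the gauge of \<open>\<delta> c u\<close> is at most
    \<open>nrm X u / a c\<close>.\<close>
  define \<delta> where "\<delta> c u = (\<lambda>c'. if c' = c then u else 0 :: 'a)" for c :: "'j \<Rightarrow> 'k" and u
  define \<Lambda> where "\<Lambda> c u = (if u \<in> carr X then l (\<delta> c u) else 0)" for c u
  have \<delta>V: "\<delta> c u \<in> V" if "u \<in> carr X" for c u using that by (auto simp: \<delta>_def V_def)
  have l_0: "l 0 = 0" using l_scl[of 0 0] W.subspace_0[OF V] by simp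
  have l_sum: "l (\<Sum>c\<in>C. w c) = (\<Sum>c\<in>C. l (w c))" if "finite C" "\<And>c. c \<in> C \<Longrightarrow> w c \<in> V"
    for C :: "('j \<Rightarrow> 'k) set" and w
    using that by (induction C rule: finite_induct) (auto simp: l_0 l_add W.subspace_sum[OF V])
  have sum_\<delta>: "(\<Sum>c\<in>I. \<delta> c (u c)) = (\<lambda>c. if c \<in> I then u c else 0)" for u
  proof
    fix c
    have "(\<Sum>c\<in>C. \<delta> c (u c)) c = (\<Sum>c'\<in>C. \<delta> c' (u c') c)" if "finite C" for C
      using that by (induction C rule: finite_induct) auto
    then show "(\<Sum>c\<in>I. \<delta> c (u c)) c = (if c \<in> I then u c else 0)" using I by (simp add: \<delta>_def)
  qed
  have l_split: "l (\<lambda>c. if c \<in> I then u c else 0) = (\<Sum>c\<in>I. \<Lambda> c (u c))"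
    if "\<And>c. c \<in> I \<Longrightarrow> u c \<in> carr X" for u
    unfolding sum_\<delta>[symmetric] using that by (subst l_sum[OF I]) (auto simp: \<delta>V \<Lambda>_def)
  have \<Lambda>: "\<Lambda> c \<in> carr (dual X)" if "c \<in> I" for c
  proof -
    have q_\<delta>: "q (\<delta> c u) \<le> 1 / a c * nrm X u" if u: "u \<in> carr X" for u
    proof (rule q_le)
      show "1 / a c * nrm X u \<in> R (\<delta> c u)"
        using u nrm_nonneg[OF u] N_0 a0 \<open>c \<in> I\<close>
        by (force simp: R_def \<delta>_def S_0 less_imp_le intro!: bexI[of _ "\<lambda>j. 0"])
    qed
    have "norm (\<Lambda> c u) \<le> 1 / a c * nrm X u" if "u \<in> carr X" for u
      using order_trans[OF l_le[OF \<delta>V[OF that], of c] q_\<delta>[OF that]] that by (simp add: \<Lambda>_def)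
    moreover have "\<delta> c (u + v) = \<delta> c u + \<delta> c v" "\<delta> c (scl X b u) = sw b (\<delta> c u)" for u v b
      by (auto simp: \<delta>_def sw_def fun_eq_iff)
    ultimately show ?thesis
      unfolding carr_dual lin_on_def
      by (intro conjI exI[of _ "1 / a c"]) (auto simp: \<Lambda>_def l_add l_scl \<delta>V)
  qed
  \<comment> \<open>Duality between a weighted maximum norm and a weighted sum norm: vectors
    \<open>u c\<close> that almost norm \<open>\<Lambda> c\<close>, with nonnegative real values and
    multiplied by \<open>a c\<close>, form a family of gauge at most 1 on which \<open>l\<close>
    nearly reaches the sum.\<close>
  have \<Lambda>_sum: "(\<Sum>c\<in>I. a c * nrm (dual X) (\<Lambda> c)) \<le> 1"
  proof (rule field_le_epsilon)
    fix e :: real assume e: "e > 0"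
    \<comment> \<open>The summand 1 keeps the denominator positive even when \<open>I\<close> is
      empty.\<close>
    define e' where "e' = e / (1 + sum a I)"
    have s0: "sum a I \<ge> 0" using a0 by (auto intro!: sum_nonneg simp: less_imp_le)
    then have e': "e' > 0" "sum a I * e' \<le> e" using e by (auto simp: e'_def field_simps)
    have "\<exists>u r. u \<in> carr X \<and> nrm X u \<le> 1 \<and> \<Lambda> c u = of_real r \<and> nrm (dual X) (\<Lambda> c) - e' < r"
      if "c \<in> I" for c
      using dual_nrm_attained_approx[OF \<Lambda>[OF that], of "nrm (dual X) (\<Lambda> c) - e'"] e' by fastforce
    then obtain u r where ur: "\<And>c. c \<in> I \<Longrightarrow> u c \<in> carr X \<and> nrm X (u c) \<le> 1 \<and> \<Lambda> c (u c) = of_real (r c)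
        \<and> nrm (dual X) (\<Lambda> c) - e' < r c"
      by metis
    define w where "w = (\<lambda>c. if c \<in> I then scl X (of_real (a c)) (u c) else 0)"
    have wV: "w \<in> V" using ur by (auto simp: V_def w_def)
    have "l w = (\<Sum>c\<in>I. \<Lambda> c (scl X (of_real (a c)) (u c)))"
      unfolding w_def using ur by (intro l_split) auto
    also have "\<dots> = of_real (\<Sum>c\<in>I. a c * r c)"
      using ur \<Lambda> by (simp add: dual_scl)
    finally have "(\<Sum>c\<in>I. a c * r c) \<le> norm (l w)" by (simp only: norm_of_real abs_ge_self)
    also have "\<dots> \<le> q w" using l_le[OF wV] .
    also have "q w \<le> 1"
      using ur N_0 a0 by (intro q_le) (auto simp: R_def w_def S_0 nrm_scl abs_of_pos intro!: bexI[of _ "\<lambda>j. 0"])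
    finally have *: "(\<Sum>c\<in>I. a c * r c) \<le> 1" .
    have "(\<Sum>c\<in>I. a c * nrm (dual X) (\<Lambda> c)) \<le> (\<Sum>c\<in>I. a c * r c + a c * e')"
      using ur a0 by (intro sum_mono) (force simp: less_imp_le simp flip: distrib_left intro!: mult_left_mono)
    also have "\<dots> = (\<Sum>c\<in>I. a c * r c) + sum a I * e'" by (simp add: sum.distrib sum_distrib_right)
    finally show "(\<Sum>c\<in>I. a c * nrm (dual X) (\<Lambda> c)) \<le> 1 + e" using * e' by linarith
  qed
  \<comment> \<open>The adjoint of \<open>S\<close> applied to \<open>l\<close>: on families of
    vectors of \<open>X\<close>, \<open>l (S x)\<close> is the sum of the values
    \<open>g j (x j)\<close>.\<close>
  define g where "g j = (\<Sum>c\<in>I. scl (dual X) (c j) (\<Lambda> c))" for j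
  have g: "g j \<in> carr (dual X)" for j using \<Lambda> by (auto simp: g_def intro!: D.carr_sum)
  have g_apply: "g j u = (\<Sum>c\<in>I. c j * \<Lambda> c u)" for j u
  proof -
    have "(\<Sum>c\<in>C. scl (dual X) (c j) (\<Lambda> c)) u = (\<Sum>c\<in>C. c j * \<Lambda> c u)" if "finite C" for C
      using that by (induction C rule: finite_induct) (auto simp: scl_dual)
    then show ?thesis using I by (simp add: g_def)
  qed
  have l_S: "l (S x) = (\<Sum>j\<in>J. g j (x j))" if x: "\<And>j. j \<in> J \<Longrightarrow> x j \<in> carr X" for x
  proof -
    have "l (S x) = (\<Sum>c\<in>I. \<Lambda> c (\<Sum>j\<in>J. scl X (c j) (x j)))"
      unfolding S_def using x by (intro l_split) (auto intro!: carr_sum)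
    also have "\<dots> = (\<Sum>c\<in>I. \<Sum>j\<in>J. c j * \<Lambda> c (x j))"
      using x \<Lambda> by (intro sum.cong) (auto simp: dual_sum dual_scl)
    also have "\<dots> = (\<Sum>j\<in>J. g j (x j))" unfolding g_apply by (rule sum.swap)
    finally show ?thesis .
  qed
  \<comment> \<open>A correction has gauge at most 0, since its negative cancels it, so
    \<open>l\<close> vanishes on its image. Corrections supported in the single index
    \<open>j\<close> show that \<open>g j\<close> vanishes on the common kernel of
    \<open>\<Gamma>\<close>, where \<open>bidual_eq_eval\<close> applies.\<close>
  have y_g: "y j (g j) = g j (x0 j)" if j: "j \<in> J" for j
  proof (rule bidual_eq_eval[OF \<Gamma> y[OF j] x0(1)[OF j] x0(2)[OF j] g])
    fix u assume u: "u \<in> carr X" "\<And>\<gamma>. \<gamma> \<in> \<Gamma> \<Longrightarrow> \<gamma> u = 0"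
    define n where "n = (\<lambda>j'. if j' = j then u else 0)"
    have n: "n \<in> N" using u \<Gamma> by (auto simp: N_def n_def dual_0 subset_iff)
    have R0: "0 \<in> R (S n)"
    proof -
      have "S n + S (\<lambda>j. scl X (- 1) (n j)) = 0" unfolding S_scl by (auto simp: sw_def fun_eq_iff)
      then have "S n c + S (\<lambda>j. scl X (- 1) (n j)) c = 0" for c by (auto simp: fun_eq_iff)
      then have "\<forall>c\<in>I. nrm X (S n c + S (\<lambda>j. scl X (- 1) (n j)) c) \<le> 0 * a c"
        by (simp only: nrm_0 mult_zero_left order_refl) simp
      then show ?thesis unfolding R_def using N_scl[OF n, of "- 1"] by blast
    qed
    have "l (S n) = 0" using order_trans[OF l_le[OF SN[OF n]] q_le[OF R0]] by simp
    moreover have "l (S n) = (\<Sum>j\<in>J. g j (n j))" using n by (intro l_S) (auto simp: N_def)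
    moreover have "g j' (n j') = (if j' = j then g j u else 0)" for j'
      using g by (simp add: n_def dual_0)
    ultimately show "g j u = 0" using J j by simp
  qed
  \<comment> \<open>Regrouping by \<open>c\<close> instead of \<open>j\<close> expresses the gauge
    through the combinations \<open>z c\<close> in the bidual, whose norms are below
    \<open>a c\<close> by hypothesis.\<close>
  have "of_real (q (S x0)) = (\<Sum>j\<in>J. y j (g j))" using l_Sx0 l_S[of x0] x0 y_g by simp
  also have "\<dots> = (\<Sum>j\<in>J. \<Sum>c\<in>I. c j * y j (\<Lambda> c))"
    unfolding g_def using y \<Lambda> by (intro sum.cong) (auto simp: D.dual_sum dual_scl[of _ "dual X"])
  also have "\<dots> = (\<Sum>c\<in>I. \<Sum>j\<in>J. c j * y j (\<Lambda> c))" by (rule sum.swap)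
  also have "\<dots> = (\<Sum>c\<in>I. z c (\<Lambda> c))"
  proof (rule sum.cong)
    fix c
    have "(\<Sum>j\<in>K. scl (bidual X) (c j) (y j)) (\<Lambda> c) = (\<Sum>j\<in>K. c j * y j (\<Lambda> c))" if "finite K" for K
      using that by (induction K rule: finite_induct) (auto simp: scl_dual)
    then show "(\<Sum>j\<in>J. c j * y j (\<Lambda> c)) = z c (\<Lambda> c)" using J by (simp add: z_def)
  qed simp
  finally have "\<bar>q (S x0)\<bar> = norm (\<Sum>c\<in>I. z c (\<Lambda> c))" by (metis norm_of_real)
  also have "\<dots> \<le> (\<Sum>c\<in>I. nrm (bidual X) (z c) * nrm (dual X) (\<Lambda> c))"
    using D.dual_nrm_bound[OF z \<Lambda>] by (intro sum_norm_le) auto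
  also have "\<dots> < 1"
  \<comment> \<open>Strictness needs one nonzero \<open>\<Lambda> c\<close>; if all of them have
    norm 0, the sum itself is 0.\<close>
  proof (cases "\<forall>c\<in>I. nrm (dual X) (\<Lambda> c) = 0")
    case False
    then obtain c where c: "c \<in> I" "nrm (dual X) (\<Lambda> c) > 0" using D.nrm_nonneg \<Lambda> by force
    have "(\<Sum>c\<in>I. nrm (bidual X) (z c) * nrm (dual X) (\<Lambda> c)) < (\<Sum>c\<in>I. a c * nrm (dual X) (\<Lambda> c))"
    proof (intro sum_strict_mono_ex1[OF I] ballI bexI[OF _ c(1)])
      show "nrm (bidual X) (z c) * nrm (dual X) (\<Lambda> c) < a c * nrm (dual X) (\<Lambda> c)"
        using a[OF c(1)] c(2) by (simp add: z_def)
      show "nrm (bidual X) (z c) * nrm (dual X) (\<Lambda> c) \<le> a c * nrm (dual X) (\<Lambda> c)" if "c \<in> I" for c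
        using a[OF that] D.nrm_nonneg[OF \<Lambda>[OF that]] by (simp add: z_def less_imp_le mult_right_mono)
    qed
    then show ?thesis using \<Lambda>_sum by simp
  qed simp
  finally have "Inf (R (S x0)) < 1" by (simp add: q_def)
  \<comment> \<open>A gauge below 1 provides a correction \<open>n\<close> under which every
    combination has norm at most \<open>a c\<close>.\<close>
  then obtain r n where rn: "r < 1" "n \<in> N" "\<And>c. c \<in> I \<Longrightarrow> nrm X (S x0 c + S n c) \<le> r * a c"
    using cInf_lessD[OF R_ne[OF Sx0]] by (force simp: R_def)
  show thesis
  proof
    show "x0 j + n j \<in> carr X" if "j \<in> J" for j using that x0 rn by (auto simp: N_def)
    show "\<gamma> (x0 j + n j) = y j \<gamma>" if "j \<in> J" "\<gamma> \<in> \<Gamma>" for j \<gamma>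
      using that x0 rn(2) \<Gamma> by (auto simp: N_def dual_add[of _ X] subset_iff)
    show "nrm X (\<Sum>j\<in>J. scl X (c j) (x0 j + n j)) \<le> a c" if "c \<in> I" for c
    proof -
      have "(\<Sum>j\<in>J. scl X (c j) (x0 j + n j)) = S x0 c + S n c"
        using that fun_cong[OF S_add[of x0 n], of c] by (simp add: S_def)
      moreover have "r * a c \<le> a c" using rn(1) a0[OF that] by simp
      ultimately show ?thesis using rn(3)[OF that] by simp
    qed
  qed
qed

end


section \<open>Continuity of multilinear maps\<close>

locale normed_family =
  fixes n :: nat and E :: "nat \<Rightarrow> ('k::real_or_complex, 'a::ab_group_add) nspace"
  assumes normed_E: "\<And>i. i \<in> {1..n} \<Longrightarrow> normed_space (E i)"
begin

abbreviation points :: "(nat \<Rightarrow> 'a) set" where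
  "points \<equiv> \<Pi>\<^sub>E i\<in>{1..n}. carr (E i)"

end

locale multilinear = normed_family n E
  for n :: nat and E :: "nat \<Rightarrow> ('k::real_or_complex, 'a::ab_group_add) nspace" +
  fixes F :: "('k, 'b::ab_group_add) nspace" and T :: "(nat \<Rightarrow> 'a) \<Rightarrow> 'b"
  assumes normed_F: "normed_space F"
    and T_in: "T \<in> (\<Pi>\<^sub>E x\<in>(\<Pi>\<^sub>E i\<in>{1..n}. carr (E i)). carr F)"
    and T_add: "\<And>x i u v. x \<in> (\<Pi>\<^sub>E i\<in>{1..n}. carr (E i)) \<Longrightarrow> i \<in> {1..n} \<Longrightarrow> u \<in> carr (E i) \<Longrightarrow>
      v \<in> carr (E i) \<Longrightarrow> T (x(i := u + v)) = T (x(i := u)) + T (x(i := v))"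
    and T_scl: "\<And>x i u c. x \<in> (\<Pi>\<^sub>E i\<in>{1..n}. carr (E i)) \<Longrightarrow> i \<in> {1..n} \<Longrightarrow> u \<in> carr (E i) \<Longrightarrow>
      T (x(i := scl (E i) c u)) = scl F c (T (x(i := u)))"
begin

sublocale F: normed_space F by (rule normed_F)

lemma T_carr: "x \<in> points \<Longrightarrow> T x \<in> carr F"
  using T_in by auto

lemma points_upd: "x \<in> points \<Longrightarrow> i \<in> {1..n} \<Longrightarrow> u \<in> carr (E i) \<Longrightarrow> x(i := u) \<in> points"
  by (auto simp: PiE_iff extensional_def)

lemma points_diff: "x \<in> points \<Longrightarrow> y \<in> points \<Longrightarrow> i \<in> {1..n} \<Longrightarrow> x i - y i \<in> carr (E i)"
  using normed_space.carr_diff[OF normed_E] by (auto simp: PiE_iff)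

lemma points_nonneg: "x \<in> points \<Longrightarrow> i \<in> {1..n} \<Longrightarrow> 0 \<le> nrm (E i) (x i)"
  using normed_space.nrm_nonneg[OF normed_E] by (auto simp: PiE_iff)

lemma T_eq_0:
  assumes x: "x \<in> points" and i: "i \<in> {1..n}" "x i = 0"
  shows "T x = 0"
proof -
  interpret Ei: normed_space "E i" using i by (intro normed_E)
  have "T (x(i := scl (E i) 0 0)) = scl F 0 (T (x(i := 0)))" using x i by (intro T_scl) auto
  then show ?thesis using i by (simp add: fun_upd_idem)
qed

lemma T_scl_all:
  assumes x: "x \<in> points" and S: "S \<subseteq> {1..n}"
  shows "T (\<lambda>i. if i \<in> S then scl (E i) (c i) (x i) else x i) = scl F (\<Prod>i\<in>S. c i) (T x)"
proof -
  have "finite S" using S finite_subset by blast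
  then show ?thesis
    using S
  proof (induction S rule: finite_induct)
    case (insert j S)
    let ?y = "\<lambda>i. if i \<in> S then scl (E i) (c i) (x i) else x i"
    have "scl (E i) (c i) (x i) \<in> carr (E i)" if "i \<in> {1..n}" for i
      using normed_space.carr_scl[OF normed_E] that x by (auto simp: PiE_iff)
    then have y: "?y \<in> points" using x insert.prems by (auto simp: PiE_iff extensional_def)
    have eq: "(\<lambda>i. if i \<in> insert j S then scl (E i) (c i) (x i) else x i) = ?y(j := scl (E j) (c j) (x j))"
      by auto
    have "T (?y(j := scl (E j) (c j) (x j))) = scl F (c j) (T (?y(j := x j)))"
      using insert.prems x by (intro T_scl y) (auto simp: PiE_iff)
    also have "?y(j := x j) = ?y" using insert.hyps by (simp add: fun_upd_idem)
    finally have *: "T (?y(j := scl (E j) (c j) (x j))) = scl F (c j) (T ?y)" .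
    have IH: "T ?y = scl F (prod c S) (T x)" using insert by blast
    show ?case unfolding eq * IH using insert.hyps by simp
  qed simp
qed

text \<open>Continuity at the origin gives some d; rescaling every coordinate to norm d/2 brings a
  point into that neighbourhood, and homogeneity in the n variables produces the factor
  \<open>(2 / d) ^ n\<close>.\<close>

lemma multilinear_ops_bound:
  assumes n: "n \<ge> 1" and T: "T \<in> multilinear_ops n E F"
  obtains C where "C \<ge> 0" "\<And>x. x \<in> points \<Longrightarrow> nrm F (T x) \<le> C * (\<Prod>i=1..n. nrm (E i) (x i))"
proof -
  define z where "z = (\<lambda>i\<in>{1..n}. 0 :: 'a)"
  have z: "z \<in> points" using normed_space.carr_0[OF normed_E] by (auto simp: z_def)
  \<comment> \<open>The value at the origin is 0 because at least one coordinate exists.\<close>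
  have Tz: "T z = 0" using T_eq_0[OF z, of 1] n by (simp add: z_def)
  obtain d where d: "d > 0"
    "\<And>y. y \<in> points \<Longrightarrow> (\<forall>i\<in>{1..n}. nrm (E i) (y i - z i) < d) \<Longrightarrow> nrm F (T y - T z) < 1"
  proof -
    have "\<forall>x\<in>points. \<forall>e>0. \<exists>d>0. \<forall>y\<in>points. (\<forall>i\<in>{1..n}. nrm (E i) (y i - x i) < d) \<longrightarrow>
        nrm F (T y - T x) < e"
      using T by (simp add: multilinear_ops_def)
    from this[rule_format, OF z zero_less_one] show thesis using that by blast
  qed
  show thesis
  proof (rule that[of "(2 / d) ^ n"])
    fix x assume x: "x \<in> points"
    show "nrm F (T x) \<le> (2 / d) ^ n * (\<Prod>i=1..n. nrm (E i) (x i))"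
    proof (cases "\<exists>i\<in>{1..n}. x i = 0")
      case True
      then show ?thesis using T_eq_0[OF x] points_nonneg[OF x] d by (auto intro!: mult_nonneg_nonneg prod_nonneg)
    next
      case False
      then have pos: "nrm (E i) (x i) > 0" if "i \<in> {1..n}" for i
        using that points_nonneg[OF x that] normed_space.nrm_eq_0_iff[OF normed_E[OF that], of "x i"] x
        by (auto simp: PiE_iff order.strict_iff_order)
      define c where "c i = d / (2 * nrm (E i) (x i))" for i
      have P: "(\<Prod>i=1..n. c i) > 0" using pos d by (intro prod_pos) (auto simp: c_def)
      define y where "y = (\<lambda>i. if i \<in> {1..n} then scl (E i) (of_real (c i)) (x i) else x i)"
      have y: "y \<in> points" using x normed_space.carr_scl[OF normed_E]
        by (auto simp: y_def PiE_iff extensional_def)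
      have "nrm (E i) (y i - z i) < d" if "i \<in> {1..n}" for i
      proof -
        have "norm (of_real (c i) :: 'k) = c i" using pos[OF that] d by (simp add: c_def del: of_real_divide)
        moreover have "c i * nrm (E i) (x i) < d" using pos[OF that] d by (simp add: c_def)
        ultimately show ?thesis
          using normed_space.nrm_scl[OF normed_E[OF that], of "x i"] x that
          by (simp add: y_def z_def PiE_iff)
      qed
      then have "nrm F (T y) < 1" using d(2)[OF y] Tz by simp
      also have "T y = scl F (of_real (\<Prod>i=1..n. c i)) (T x)"
        unfolding y_def using T_scl_all[OF x, of "{1..n}" "\<lambda>i. of_real (c i)"] by simp
      finally have "(\<Prod>i=1..n. c i) * nrm F (T x) < 1"
        using P T_carr[OF x] by (simp add: F.nrm_scl del: of_real_prod)
      moreover have "(\<Prod>i=1..n. c i) * ((2 / d) ^ n * (\<Prod>i=1..n. nrm (E i) (x i))) = 1"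
      proof -
        have "(2 / d) ^ n = (\<Prod>i=1..n. 2 / d)" by simp
        then have "(\<Prod>i=1..n. c i) * ((2 / d) ^ n * (\<Prod>i=1..n. nrm (E i) (x i))) =
            (\<Prod>i=1..n. c i * (2 / d * nrm (E i) (x i)))" by (simp only: prod.distrib)
        also have "\<dots> = 1" 
        proof (intro prod.neutral ballI)
          show "c i * (2 / d * nrm (E i) (x i)) = 1" if "i \<in> {1..n}" for i
            using pos[OF that] d by (simp add: c_def)
        qed
        finally show ?thesis .
      qed
      ultimately have "(\<Prod>i=1..n. c i) * nrm F (T x) \<le> (\<Prod>i=1..n. c i) * ((2 / d) ^ n * (\<Prod>i=1..n. nrm (E i) (x i)))"
        by linarith
      then show ?thesis using P by (simp only: mult_le_cancel_left_pos)
    qed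
  qed (use d in simp)
qed

text \<open>A telescoping argument in which \<open>S\<close> is the set of coordinates already
  switched from \<open>x\<close> to \<open>y\<close>. Each switch costs one factor \<open>d\<close>;
  the at most n - 1 remaining factors are bounded by \<open>R ^ n\<close> because
  \<open>R \<ge> 1\<close>.\<close>

lemma bounded_diff:
  fixes C R d :: real
  assumes C: "\<And>x. x \<in> points \<Longrightarrow> nrm F (T x) \<le> C * (\<Prod>i=1..n. nrm (E i) (x i))" "C \<ge> 0"
    and x: "x \<in> points" and y: "y \<in> points" and R: "\<And>i. i \<in> {1..n} \<Longrightarrow> nrm (E i) (x i) \<le> R"
    "\<And>i. i \<in> {1..n} \<Longrightarrow> nrm (E i) (y i) \<le> R" "R \<ge> 1"
    and d: "\<And>i. i \<in> {1..n} \<Longrightarrow> nrm (E i) (y i - x i) \<le> d" and S: "S \<subseteq> {1..n}"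
  shows "nrm F (T (\<lambda>i. if i \<in> S then y i else x i) - T x) \<le> card S * (C * R ^ n * d)"
proof -
  have "finite S" using S finite_subset by blast
  then show ?thesis
    using S
  proof (induction S rule: finite_induct)
    case (insert j S)
    let ?w = "\<lambda>i. if i \<in> S then y i else x i"
    let ?w' = "\<lambda>i. if i \<in> insert j S then y i else x i"
    have j: "j \<in> {1..n}" using insert.prems by simp
    have w: "?w \<in> points" and w': "?w' \<in> points" using x y insert.prems by (auto simp: PiE_iff extensional_def)
    let ?v = "?w(j := y j - x j)"
    have v: "?v \<in> points" using points_upd[OF w j] points_diff[OF y x j] by simp
    have d0: "d \<ge> 0" using d[OF j] normed_space.nrm_nonneg[OF normed_E[OF j] points_diff[OF y x j]] by simp
    have "T (?w(j := (y j - x j) + x j)) = T ?v + T (?w(j := x j))"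
      using x by (intro T_add w j points_diff[OF y x j]) (use j in \<open>auto simp: PiE_iff\<close>)
    moreover have "?w(j := (y j - x j) + x j) = ?w'" "?w(j := x j) = ?w" using insert.hyps by auto
    ultimately have eq: "T ?w' - T x = T ?v + (T ?w - T x)" by (simp add: algebra_simps)
    have "(\<Prod>i=1..n. nrm (E i) (?v i)) = nrm (E j) (y j - x j) * (\<Prod>i\<in>{1..n} - {j}. nrm (E i) (?v i))"
      using j by (subst prod.remove[of _ j]) auto
    also have "\<dots> \<le> d * R ^ n"
    proof (rule mult_mono)
      have "(\<Prod>i\<in>{1..n} - {j}. nrm (E i) (?v i)) \<le> (\<Prod>i\<in>{1..n} - {j}. R)"
        using R points_nonneg[OF x] points_nonneg[OF y] by (intro prod_mono) auto
      also have "\<dots> \<le> R ^ n"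
        using R(3) card_mono[of "{1..n}" "{1..n} - {j}"] by (auto intro!: power_increasing)
      finally show "(\<Prod>i\<in>{1..n} - {j}. nrm (E i) (?v i)) \<le> R ^ n" .
      show "0 \<le> (\<Prod>i\<in>{1..n} - {j}. nrm (E i) (?v i))"
        using points_nonneg[OF v] by (intro prod_nonneg ballI) blast
    qed (use d[OF j] d0 in auto)
    finally have "(\<Prod>i=1..n. nrm (E i) (?v i)) \<le> d * R ^ n" .
    from order_trans[OF C(1)[OF v] mult_left_mono[OF this C(2)]]
    have v_le: "nrm F (T ?v) \<le> C * R ^ n * d" by (simp only: mult_ac)
    have "nrm F (T ?w' - T x) \<le> nrm F (T ?v) + nrm F (T ?w - T x)"
      unfolding eq using T_carr x v w by (intro F.nrm_triangle) auto
    moreover have "nrm F (T ?w - T x) \<le> card S * (C * R ^ n * d)" using insert by simp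
    ultimately have "nrm F (T ?w' - T x) \<le> C * R ^ n * d + card S * (C * R ^ n * d)"
      using v_le by linarith
    moreover have "real (card (insert j S)) * (C * R ^ n * d) = C * R ^ n * d + card S * (C * R ^ n * d)"
      using insert.hyps by (simp add: algebra_simps)
    ultimately show ?case by (simp only:)
  qed simp
qed

lemma multilinear_opsI:
  assumes C: "\<And>x. x \<in> points \<Longrightarrow> nrm F (T x) \<le> C * (\<Prod>i=1..n. nrm (E i) (x i))" "C \<ge> 0"
  shows "T \<in> multilinear_ops n E F"
  unfolding multilinear_ops_def
proof (intro CollectI conjI ballI allI impI)
  fix x and e :: real assume x: "x \<in> points" and e: "e > 0"
  define R where "R = 1 + (\<Sum>i=1..n. nrm (E i) (x i))"
  have xR: "nrm (E i) (x i) + 1 \<le> R" if "i \<in> {1..n}" for i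
    using member_le_sum[of i "{1..n}" "\<lambda>i. nrm (E i) (x i)"] points_nonneg[OF x] that by (simp add: R_def)
  have R1: "R \<ge> 1" using sum_nonneg[of "{1..n}", OF points_nonneg[OF x]] by (simp add: R_def)
  \<comment> \<open>The bound 1 keeps the coordinates of \<open>y\<close> within the radius
    \<open>R\<close>; the extra 1 in the denominator avoids division by 0 and makes the final
    estimate strict.\<close>
  define d where "d = min 1 (e / (1 + n * (C * R ^ n)))"
  have nn: "0 \<le> n * (C * R ^ n)" using C(2) R1 by simp
  have d: "d > 0" "d \<le> 1" using e nn by (auto simp: d_def intro!: divide_pos_pos add_pos_nonneg)
  have "n * (C * R ^ n * d) < e"
  proof -
    have "(1 + n * (C * R ^ n)) * d \<le> (1 + n * (C * R ^ n)) * (e / (1 + n * (C * R ^ n)))"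
      using nn by (intro mult_left_mono) (auto simp: d_def)
    also have "\<dots> = e" using nn by simp
    finally show ?thesis using d by (simp add: algebra_simps)
  qed
  moreover have "nrm F (T y - T x) \<le> n * (C * R ^ n * d)"
    if y: "y \<in> points" "\<forall>i\<in>{1..n}. nrm (E i) (y i - x i) < d" for y
  proof -
    have "nrm (E i) (y i) \<le> R" if "i \<in> {1..n}" for i
      using normed_space.nrm_triangle[OF normed_E[OF that] points_diff[OF y(1) x that], of "x i"]
        x xR[OF that] y(2) d(2) that by (force simp: PiE_iff)
    then have "nrm F (T (\<lambda>i. if i \<in> {1..n} then y i else x i) - T x) \<le> card {1..n} * (C * R ^ n * d)"
      using xR y R1 by (intro bounded_diff C x) (force simp: less_imp_le)+
    moreover have "(\<lambda>i. if i \<in> {1..n} then y i else x i) = y"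
      using x y(1) by (auto simp: PiE_iff extensional_def)
    ultimately show ?thesis by simp
  qed
  ultimately show "\<exists>d>0. \<forall>y\<in>points. (\<forall>i\<in>{1..n}. nrm (E i) (y i - x i) < d) \<longrightarrow> nrm F (T y - T x) < e"
    using d by (intro exI[of _ d]) (auto intro: le_less_trans)
qed (use T_in T_add T_scl in auto)

end

lemma multilinear_of_ops:
  assumes "\<And>i. i \<in> {1..n} \<Longrightarrow> normed_space (E i)" "normed_space F" "T \<in> multilinear_ops n E F"
  shows "multilinear n E F T"
  using assms by (auto simp: multilinear_def multilinear_axioms_def normed_family_def multilinear_ops_def)


section \<open>Extending multilinear forms to the bidual\<close>

text \<open>
  \<open>bidual_ext E [j\<^sub>1, \<dots>, j\<^sub>m] G y x\<close> extends the scalar form \<open>G\<close> to the bidual in the coordinates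
  \<open>j\<^sub>1, \<dots>, j\<^sub>m\<close>, innermost \<open>j\<^sub>m\<close>: it is \<open>y j\<^sub>1 (\<lambda>u\<^sub>1. \<dots> y j\<^sub>m (\<lambda>u\<^sub>m. G (x(j\<^sub>1 := u\<^sub>1, \<dots>, j\<^sub>m := u\<^sub>m))))\<close>.
\<close>

primrec bidual_ext ::
    "(nat \<Rightarrow> ('k::real_or_complex, 'a::ab_group_add) nspace) \<Rightarrow> nat list \<Rightarrow> ((nat \<Rightarrow> 'a) \<Rightarrow> 'k) \<Rightarrow>
     (nat \<Rightarrow> ('a \<Rightarrow> 'k) \<Rightarrow> 'k) \<Rightarrow> (nat \<Rightarrow> 'a) \<Rightarrow> 'k" where
  "bidual_ext E [] G y x = G x"
| "bidual_ext E (j # js) G y x =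
     y j (\<lambda>u. if u \<in> carr (E j) then bidual_ext E js G y (x(j := u)) else 0)"

text \<open>The functional to which \<open>y j\<close> is applied; it is 0 outside
  \<open>carr (E j)\<close> as membership in the dual demands.\<close>

definition slice ::
    "(nat \<Rightarrow> ('k::real_or_complex, 'a::ab_group_add) nspace) \<Rightarrow> nat \<Rightarrow> nat list \<Rightarrow> ((nat \<Rightarrow> 'a) \<Rightarrow> 'k) \<Rightarrow>
     (nat \<Rightarrow> ('a \<Rightarrow> 'k) \<Rightarrow> 'k) \<Rightarrow> (nat \<Rightarrow> 'a) \<Rightarrow> 'a \<Rightarrow> 'k" where
  "slice E j js G y x = (\<lambda>u. if u \<in> carr (E j) then bidual_ext E js G y (x(j := u)) else 0)"

lemma bidual_ext_Cons: "bidual_ext E (j # js) G y x = y j (slice E j js G y x)"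
  by (simp add: slice_def)

lemma bidual_ext_cong:
  "(\<And>j. j \<in> set js \<Longrightarrow> y j = y' j) \<Longrightarrow> bidual_ext E js G y x = bidual_ext E js G y' x"
  by (induction js arbitrary: x) (auto cong: if_cong)

context normed_family
begin

text \<open>Points whose coordinates in \<open>js\<close> are still to be filled in.\<close>

definition partial_points :: "nat list \<Rightarrow> (nat \<Rightarrow> 'a) set" where
  "partial_points js = {x. (\<forall>i\<in>{1..n} - set js. x i \<in> carr (E i)) \<and> (\<forall>i. i \<notin> {1..n} \<longrightarrow> x i = undefined)}"

lemma partial_points_Nil: "partial_points [] = points"
  by (auto simp: partial_points_def PiE_iff extensional_def)

lemma partial_points_upd:
  "x \<in> partial_points (j # js) \<Longrightarrow> j \<in> {1..n} \<Longrightarrow> u \<in> carr (E j) \<Longrightarrow> x(j := u) \<in> partial_points js"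
  by (auto simp: partial_points_def)

lemma partial_points_upd_same:
  "x \<in> partial_points js \<Longrightarrow> i \<in> {1..n} \<Longrightarrow> u \<in> carr (E i) \<Longrightarrow> x(i := u) \<in> partial_points js"
  by (auto simp: partial_points_def)

definition bounded_form :: "real \<Rightarrow> ((nat \<Rightarrow> 'a) \<Rightarrow> 'k) \<Rightarrow> bool" where
  "bounded_form K G \<longleftrightarrow> 0 \<le> K \<and>
     (\<forall>x\<in>points. norm (G x) \<le> K * (\<Prod>i=1..n. nrm (E i) (x i)) \<and>
        (\<forall>i\<in>{1..n}. lin_on (E i) (\<lambda>u. G (x(i := u)))))"

definition bidual_point :: "nat list \<Rightarrow> (nat \<Rightarrow> ('a \<Rightarrow> 'k) \<Rightarrow> 'k) \<Rightarrow> bool" where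
  "bidual_point js y \<longleftrightarrow> distinct js \<and> set js \<subseteq> {1..n} \<and> (\<forall>j\<in>set js. y j \<in> carr (bidual (E j)))"

lemma bidual_pointD:
  assumes "bidual_point (j # js) y"
  shows "bidual_point js y" "j \<in> {1..n}" "j \<notin> set js" "y j \<in> carr (bidual (E j))"
  using assms by (auto simp: bidual_point_def)

lemma normed_dual: "i \<in> {1..n} \<Longrightarrow> normed_space (dual (E i))"
  and normed_bidual: "i \<in> {1..n} \<Longrightarrow> normed_space (bidual (E i))"
  using normed_space.normed_space_dual[OF normed_E] normed_space.normed_space_dual by blast+

lemma bidual_nonneg: "j \<in> {1..n} \<Longrightarrow> z \<in> carr (bidual (E j)) \<Longrightarrow> 0 \<le> nrm (bidual (E j)) z"
  by (rule normed_space.nrm_nonneg[OF normed_bidual])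

lemma bidual_apply_bound:
  "j \<in> {1..n} \<Longrightarrow> z \<in> carr (bidual (E j)) \<Longrightarrow> f \<in> carr (dual (E j)) \<Longrightarrow>
     norm (z f) \<le> nrm (bidual (E j)) z * nrm (dual (E j)) f"
  by (rule normed_space.dual_nrm_bound[OF normed_dual])

text \<open>The three claims support each other: a slice belongs to the dual by the bound and the
  linearity for the shorter list, and the bound and the linearity for the longer list apply
  \<open>y j\<close> to slices known to lie in the dual.\<close>

lemma bidual_ext_bounded_linear:
  assumes G: "bounded_form K G" and y: "bidual_point js y"
  shows "\<forall>x\<in>partial_points js.
    norm (bidual_ext E js G y x) \<le>
      K * (\<Prod>i\<in>{1..n} - set js. nrm (E i) (x i)) * (\<Prod>j\<in>set js. nrm (bidual (E j)) (y j)) \<and>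
    (\<forall>i\<in>{1..n} - set js. lin_on (E i) (\<lambda>u. bidual_ext E js G y (x(i := u)))) \<and>
    (\<forall>j js'. js = j # js' \<longrightarrow> slice E j js' G y x \<in> carr (dual (E j)))"
  using y
proof (induction js)
  case Nil
  then show ?case using G by (auto simp: bounded_form_def partial_points_Nil simp del: fun_upd_apply)
next
  case (Cons j js)
  note y = bidual_pointD[OF Cons.prems]
  note IH = Cons.IH[OF y(1), rule_format]
  interpret Ej: normed_space "E j" by (rule normed_E[OF y(2)])
  let ?S = "{1..n} - set (j # js)"
  let ?K = "\<lambda>x. K * (\<Prod>i\<in>?S. nrm (E i) (x i)) * (\<Prod>j\<in>set js. nrm (bidual (E j)) (y j))"
  have slice_bound: "norm (slice E j js G y x u) \<le> ?K x * nrm (E j) u"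
    if x: "x \<in> partial_points (j # js)" and u: "u \<in> carr (E j)" for x u
  proof -
    have "norm (bidual_ext E js G y (x(j := u))) \<le>
        K * (\<Prod>i\<in>{1..n} - set js. nrm (E i) ((x(j := u)) i)) * (\<Prod>j\<in>set js. nrm (bidual (E j)) (y j))"
      using IH[OF partial_points_upd[OF x y(2) u]] by blast
    also have "(\<Prod>i\<in>{1..n} - set js. nrm (E i) ((x(j := u)) i)) =
        nrm (E j) u * (\<Prod>i\<in>{1..n} - set js - {j}. nrm (E i) ((x(j := u)) i))"
      using y(2,3) by (subst prod.remove[of _ j]) auto
    also have "(\<Prod>i\<in>{1..n} - set js - {j}. nrm (E i) ((x(j := u)) i)) = (\<Prod>i\<in>?S. nrm (E i) (x i))"
      by (intro prod.cong) auto
    finally show ?thesis using u by (simp add: slice_def mult_ac del: fun_upd_apply)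
  qed
  have K0: "?K x \<ge> 0" if x: "x \<in> partial_points (j # js)" for x
  proof -
    have "0 \<le> (\<Prod>i\<in>?S. nrm (E i) (x i))"
      using x normed_space.nrm_nonneg[OF normed_E] by (intro prod_nonneg) (auto simp: partial_points_def)
    moreover have "0 \<le> (\<Prod>j\<in>set js. nrm (bidual (E j)) (y j))"
      using Cons.prems bidual_nonneg by (intro prod_nonneg) (auto simp: bidual_point_def subset_iff)
    ultimately show ?thesis using G by (simp add: bounded_form_def)
  qed
  have slice: "slice E j js G y x \<in> carr (dual (E j))" if x: "x \<in> partial_points (j # js)" for x
  proof -
    \<comment> \<open>The coordinate \<open>j\<close> of \<open>x\<close> may still be arbitrary; 0
      is inserted to obtain a legitimate point and is overwritten at once.\<close>
    have "lin_on (E j) (\<lambda>u. bidual_ext E js G y ((x(j := 0))(j := u)))"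
      using IH[OF partial_points_upd[OF x y(2) Ej.carr_0]] y(2,3) by blast
    then have "lin_on (E j) (slice E j js G y x)" by (auto simp: lin_on_def slice_def)
    then show ?thesis using slice_bound[OF x] by (auto simp: carr_dual slice_def)
  qed
  show ?case
  proof (intro ballI conjI allI impI)
    fix x assume x: "x \<in> partial_points (j # js)"
    show "slice E j' js' G y x \<in> carr (dual (E j'))" if "j # js = j' # js'" for j' js'
      using slice[OF x] that by simp
    have "nrm (dual (E j)) (slice E j js G y x) \<le> ?K x"
      using slice_bound[OF x] K0[OF x] by (intro Ej.dual_nrm_least)
    then have "norm (bidual_ext E (j # js) G y x) \<le> nrm (bidual (E j)) (y j) * ?K x"
      unfolding bidual_ext_Cons
      using bidual_apply_bound[OF y(2,4) slice[OF x]] bidual_nonneg[OF y(2,4)]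
      by (meson mult_left_mono order_trans)
    also have "\<dots> = K * (\<Prod>i\<in>?S. nrm (E i) (x i)) * (\<Prod>j\<in>set (j # js). nrm (bidual (E j)) (y j))"
      using y(3) by simp
    finally show "norm (bidual_ext E (j # js) G y x) \<le>
        K * (\<Prod>i\<in>?S. nrm (E i) (x i)) * (\<Prod>j\<in>set (j # js). nrm (bidual (E j)) (y j))" .
    fix i assume i: "i \<in> ?S"
    have lin: "lin_on (E i) (\<lambda>u. bidual_ext E js G y (x(i := u, j := v)))" if v: "v \<in> carr (E j)" for v
      using conjunct1[OF conjunct2[OF IH[OF partial_points_upd[OF x y(2) v]]], rule_format, of i] i
      by (simp add: fun_upd_twist)
    have sl: "slice E j js G y (x(i := u)) \<in> carr (dual (E j))" if "u \<in> carr (E i)" for u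
      using that i by (intro slice partial_points_upd_same x) auto
    have "slice E j js G y (x(i := u + v)) = slice E j js G y (x(i := u)) + slice E j js G y (x(i := v))"
      if "u \<in> carr (E i)" "v \<in> carr (E i)" for u v
      using lin that by (auto simp: slice_def lin_on_def fun_eq_iff)
    moreover have "slice E j js G y (x(i := scl (E i) c u)) = scl (dual (E j)) c (slice E j js G y (x(i := u)))"
      if "u \<in> carr (E i)" for u c
      using lin that by (auto simp: slice_def lin_on_def fun_eq_iff scl_dual)
    ultimately show "lin_on (E i) (\<lambda>u. bidual_ext E (j # js) G y (x(i := u)))"
      unfolding lin_on_def bidual_ext_Cons using y(4) sl
      by (auto simp: dual_add[of _ "dual (E j)"] dual_scl[of _ "dual (E j)"])
  qed
qed

lemma bidual_ext_bound:
  assumes "bounded_form K G" "bidual_point js y" "x \<in> partial_points js"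
  shows "norm (bidual_ext E js G y x) \<le>
      K * (\<Prod>i\<in>{1..n} - set js. nrm (E i) (x i)) * (\<Prod>j\<in>set js. nrm (bidual (E j)) (y j))"
  using bidual_ext_bounded_linear[OF assms(1,2)] assms(3) by blast

lemma slice_in_dual:
  assumes "bounded_form K G" "bidual_point (j # js) y" "x \<in> partial_points (j # js)"
  shows "slice E j js G y x \<in> carr (dual (E j))"
  using bidual_ext_bounded_linear[OF assms(1,2)] assms(3) by blast

text \<open>Additivity in the form is what makes the extension additive in the functional on
  \<open>F\<close> that tests it.\<close>

lemma bidual_ext_add_form:
  assumes G: "bounded_form K G" "bounded_form K' G'" and "bidual_point js y" "x \<in> partial_points js"
  shows "bidual_ext E js (\<lambda>x. G x + G' x) y x = bidual_ext E js G y x + bidual_ext E js G' y x"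
  using assms(3,4)
proof (induction js arbitrary: x)
  case (Cons j js)
  note y = bidual_pointD[OF Cons.prems(1)]
  have "slice E j js (\<lambda>x. G x + G' x) y x = slice E j js G y x + slice E j js G' y x"
    by (rule ext) (simp del: fun_upd_apply add: slice_def Cons.IH[OF y(1) partial_points_upd[OF Cons.prems(2) y(2)]])
  then show ?case
    using y(4) slice_in_dual[OF G(1) Cons.prems] slice_in_dual[OF G(2) Cons.prems]
    by (simp only: bidual_ext_Cons dual_add[of _ "dual (E j)"])
qed simp

lemma bidual_ext_scl_form:
  assumes G: "bounded_form K G" and "bidual_point js y" "x \<in> partial_points js"
  shows "bidual_ext E js (\<lambda>x. c * G x) y x = c * bidual_ext E js G y x"
  using assms(2,3)
proof (induction js arbitrary: x)
  case (Cons j js)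
  note y = bidual_pointD[OF Cons.prems(1)]
  have "slice E j js (\<lambda>x. c * G x) y x = scl (dual (E j)) c (slice E j js G y x)"
    by (rule ext) (simp del: fun_upd_apply add: slice_def scl_dual Cons.IH[OF y(1) partial_points_upd[OF Cons.prems(2) y(2)]])
  then show ?case
    using y(4) slice_in_dual[OF G Cons.prems]
    by (simp only: bidual_ext_Cons dual_scl[of _ "dual (E j)"])
qed simp

lemma bidual_ext_zero_form:
  assumes "bidual_point js y"
  shows "bidual_ext E js (\<lambda>x. 0) y x = 0"
proof -
  from assms show ?thesis
  proof (induction js arbitrary: x)
    case (Cons j js)
    note y = bidual_pointD[OF Cons.prems]
    have "slice E j js (\<lambda>x. 0) y x = 0" using Cons.IH[OF y(1)] by (auto simp: slice_def)
    then show ?case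
      using normed_space.dual_0[OF normed_dual[OF y(2)] y(4)] by (simp only: bidual_ext_Cons)
  qed simp
qed

text \<open>If \<open>i\<close> is the outermost coordinate, the slice does not contain
  \<open>y i\<close> and the sum of bidual elements acts pointwise; otherwise the slices add up by
  induction and \<open>y j\<close> is additive.\<close>

lemma bidual_ext_add_point:
  assumes G: "bounded_form K G" and "bidual_point js (y(i := a))" "bidual_point js (y(i := b))"
    "i \<in> set js" "x \<in> partial_points js"
  shows "bidual_ext E js G (y(i := a + b)) x = bidual_ext E js G (y(i := a)) x + bidual_ext E js G (y(i := b)) x"
  using assms(2-)
proof (induction js arbitrary: x)
  case (Cons j js)
  note y = bidual_pointD[OF Cons.prems(1)] bidual_pointD[OF Cons.prems(2)]
  show ?case
  proof (cases "i = j")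
    case True
    have "slice E j js G (y(i := c)) x = slice E j js G y x" for c
      unfolding slice_def using True y(3) by (auto intro!: ext bidual_ext_cong)
    then show ?thesis unfolding bidual_ext_Cons using True by simp
  next
    case False
    then have i: "i \<in> set js" using Cons.prems by simp
    have "slice E j js G (y(i := a + b)) x = slice E j js G (y(i := a)) x + slice E j js G (y(i := b)) x"
      by (rule ext) (simp del: fun_upd_apply add: slice_def Cons.IH[OF y(1,5) i partial_points_upd[OF Cons.prems(4) y(2)]])
    then show ?thesis
      unfolding bidual_ext_Cons
      using y(4) False slice_in_dual[OF G Cons.prems(1,4)] slice_in_dual[OF G Cons.prems(2,4)]
      by (simp add: dual_add[of _ "dual (E j)"] fun_upd_other del: fun_upd_apply plus_fun_apply)
  qed
qed simp

lemma bidual_ext_scl_point: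
  assumes G: "bounded_form K G" and "bidual_point js (y(i := a))" "i \<in> set js" "x \<in> partial_points js"
  shows "bidual_ext E js G (y(i := scl (bidual (E i)) c a)) x = c * bidual_ext E js G (y(i := a)) x"
  using assms(2-)
proof (induction js arbitrary: x)
  case (Cons j js)
  note y = bidual_pointD[OF Cons.prems(1)]
  show ?case
  proof (cases "i = j")
    case True
    have "slice E j js G (y(i := c)) x = slice E j js G y x" for c
      unfolding slice_def using True y(3) by (auto intro!: ext bidual_ext_cong)
    then show ?thesis unfolding bidual_ext_Cons using True by (simp add: scl_dual)
  next
    case False
    then have i: "i \<in> set js" using Cons.prems by simp
    have "slice E j js G (y(i := scl (bidual (E i)) c a)) x = scl (dual (E j)) c (slice E j js G (y(i := a)) x)"
      by (rule ext) (simp del: fun_upd_apply add: slice_def scl_dual[of "E j"] Cons.IH[OF y(1) i partial_points_upd[OF Cons.prems(3) y(2)]])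
    then show ?thesis
      unfolding bidual_ext_Cons
      using y(4) False slice_in_dual[OF G Cons.prems(1,3)]
      by (simp add: dual_scl[of _ "dual (E j)"] fun_upd_other del: fun_upd_apply)
  qed
qed simp

text \<open>At canonical images each application of \<open>y j\<close> is evaluation at
  \<open>x j\<close>. The coordinates of \<open>x'\<close> in \<open>js\<close> are free since all
  of them are overwritten.\<close>

lemma bidual_ext_canon:
  assumes "x \<in> points" "bounded_form K G"
  shows "set js \<subseteq> {1..n} \<Longrightarrow> distinct js \<Longrightarrow> (\<And>i. i \<in> {1..n} - set js \<Longrightarrow> x' i = x i) \<Longrightarrow>
    (\<And>i. i \<notin> {1..n} \<Longrightarrow> x' i = undefined) \<Longrightarrow> bidual_ext E js G (\<lambda>i. canon (E i) (x i)) x' = G x"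
proof (induction js arbitrary: x')
  case Nil
  have "x' i = x i" for i
    using Nil(3)[of i] Nil(4)[of i] PiE_arb[OF assms(1), of i] by (cases "i \<in> {1..n}") simp_all
  then have "x' = x" by blast
  then show ?case by simp
next
  case (Cons j js)
  have j: "j \<in> {1..n}" using Cons.prems by simp
  have "bidual_point (j # js) (\<lambda>i. canon (E i) (x i))"
    using Cons.prems assms(1) normed_space.canon_in_bidual[OF normed_E]
    by (auto simp: bidual_point_def PiE_iff subset_iff)
  moreover have "x' \<in> partial_points (j # js)"
    using Cons.prems assms(1) by (auto simp: partial_points_def PiE_iff)
  ultimately have "slice E j js G (\<lambda>i. canon (E i) (x i)) x' \<in> carr (dual (E j))"
    by (rule slice_in_dual[OF assms(2)])
  then have "bidual_ext E (j # js) G (\<lambda>i. canon (E i) (x i)) x' =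
      slice E j js G (\<lambda>i. canon (E i) (x i)) x' (x j)"
    unfolding bidual_ext_Cons by (simp add: canon_def)
  also have "\<dots> = bidual_ext E js G (\<lambda>i. canon (E i) (x i)) (x'(j := x j))"
    using assms(1) j by (auto simp: slice_def PiE_iff)
  also have "\<dots> = G x" using Cons.prems by (intro Cons.IH) auto
  finally show ?case .
qed

text \<open>
  Local reflexivity is applied one coordinate at a time, starting with the outermost one.
\<close>

lemma bidual_ext_realize:
  fixes y :: "'j \<Rightarrow> nat \<Rightarrow> ('a \<Rightarrow> 'k) \<Rightarrow> 'k" and a :: "nat \<Rightarrow> ('j \<Rightarrow> 'k) \<Rightarrow> real"
  assumes J: "finite J" and I: "finite I" and \<G>: "finite \<G>" "\<And>G. G \<in> \<G> \<Longrightarrow> \<exists>K. bounded_form K G"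
  shows "set js \<subseteq> {1..n} \<Longrightarrow> distinct js \<Longrightarrow> (\<And>l. l \<in> J \<Longrightarrow> bidual_point js (y l)) \<Longrightarrow> (\<And>l. l \<in> J \<Longrightarrow> x l \<in> partial_points js) \<Longrightarrow>
    (\<And>j c. j \<in> set js \<Longrightarrow> c \<in> I \<Longrightarrow>
       nrm (bidual (E j)) (\<Sum>l\<in>J. scl (bidual (E j)) (c l) (y l j)) < a j c) \<Longrightarrow>
    \<exists>x'. (\<forall>l\<in>J. x' l \<in> points \<and> (\<forall>i. i \<notin> set js \<longrightarrow> x' l i = x l i) \<and>
           (\<forall>G\<in>\<G>. bidual_ext E js G (y l) (x l) = G (x' l))) \<and>
         (\<forall>j\<in>set js. \<forall>c\<in>I. nrm (E j) (\<Sum>l\<in>J. scl (E j) (c l) (x' l j)) \<le> a j c)"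
proof (induction js arbitrary: x)
  case Nil
  then show ?case by (intro exI[of _ x]) (auto simp: partial_points_Nil)
next
  case (Cons j js)
  note y = bidual_pointD[OF Cons.prems(3)]
  have j: "j \<in> {1..n}" "j \<notin> set js" and js: "set js \<subseteq> {1..n}" "distinct js"
    using Cons.prems(1,2) by auto
  interpret Ej: normed_space "E j" by (rule normed_E[OF j(1)])
  \<comment> \<open>All pairs of a point and a form are treated together, because the norms of
    combinations couple the points; \<open>u l\<close> is later tested only on its own
    slices.\<close>
  let ?\<Gamma> = "(\<lambda>(l, G). slice E j js G (y l) (x l)) ` (J \<times> \<G>)"
  have \<Gamma>: "finite ?\<Gamma>" "?\<Gamma> \<subseteq> carr (dual (E j))"
  proof -
    show "finite ?\<Gamma>" using J \<G>(1) by simp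
    have "slice E j js G (y l) (x l) \<in> carr (dual (E j))" if "l \<in> J" "G \<in> \<G>" for l G
      using \<G>(2)[OF that(2)] slice_in_dual[OF _ Cons.prems(3,4)[OF that(1)]] by blast
    then show "?\<Gamma> \<subseteq> carr (dual (E j))" by auto
  qed
  obtain u where u: "\<And>l. l \<in> J \<Longrightarrow> u l \<in> carr (E j)"
    "\<And>l g. l \<in> J \<Longrightarrow> g \<in> ?\<Gamma> \<Longrightarrow> g (u l) = y l j g"
    "\<And>c. c \<in> I \<Longrightarrow> nrm (E j) (\<Sum>l\<in>J. scl (E j) (c l) (u l)) \<le> a j c"
    using Ej.local_reflexivity[OF J I \<Gamma>, of "\<lambda>l. y l j" "a j"] y(4) Cons.prems(5)[of j] by auto
  obtain x' where x': "\<And>l. l \<in> J \<Longrightarrow> x' l \<in> points"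
    "\<And>l i. l \<in> J \<Longrightarrow> i \<notin> set js \<Longrightarrow> x' l i = ((x l)(j := u l)) i"
    "\<And>l G. l \<in> J \<Longrightarrow> G \<in> \<G> \<Longrightarrow> bidual_ext E js G (y l) ((x l)(j := u l)) = G (x' l)"
    "\<And>j c. j \<in> set js \<Longrightarrow> c \<in> I \<Longrightarrow> nrm (E j) (\<Sum>l\<in>J. scl (E j) (c l) (x' l j)) \<le> a j c"
    \<comment> \<open>The chosen vectors are inserted before the induction hypothesis is used, as
      the slices of the inner variables depend on them.\<close>
    using Cons.IH[of "\<lambda>l. (x l)(j := u l)"] y(1) partial_points_upd[OF Cons.prems(4) j(1) u(1)]
      Cons.prems(5) js by fastforce
  have ext_eq: "bidual_ext E (j # js) G (y l) (x l) = G (x' l)" if l: "l \<in> J" and G: "G \<in> \<G>" for l G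
  proof -
    have "bidual_ext E (j # js) G (y l) (x l) = slice E j js G (y l) (x l) (u l)"
      unfolding bidual_ext_Cons using u(2)[OF l, of "slice E j js G (y l) (x l)"] l G by force
    also have "\<dots> = G (x' l)" using u(1)[OF l] x'(3)[OF l G] by (simp add: slice_def)
    finally show ?thesis .
  qed
  show ?case
  proof (intro exI[of _ x'] conjI ballI allI impI)
    show "x' l \<in> points" if "l \<in> J" for l using x'(1) that .
    show "x' l i = x l i" if "l \<in> J" "i \<notin> set (j # js)" for l i using x'(2)[of l i] that by simp
    show "bidual_ext E (j # js) G (y l) (x l) = G (x' l)" if "l \<in> J" "G \<in> \<G>" for l G
      using ext_eq that .
    show "nrm (E j') (\<Sum>l\<in>J. scl (E j') (c l) (x' l j')) \<le> a j' c" if "j' \<in> set (j # js)" "c \<in> I" for j' c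
      using that u(3)[of c] x'(2,4) j(2) by (cases "j' = j") simp_all
  qed
qed

end


section \<open>Aron-Berner extensions\<close>

text \<open>The net is indexed by the finite sets of functionals, ordered by inclusion, and its term
  at \<open>\<Gamma>\<close> interpolates \<open>y\<close> on \<open>\<Gamma>\<close>. Tested on a
  fixed functional it is eventually constant.\<close>

lemma (in normed_space) weak_star_net_exists:
  assumes y: "y \<in> carr (bidual X)"
  obtains N where "N \<noteq> bot" "\<forall>\<^sub>F u in N. u \<in> carr X" "weak_star_lim (dual X) (canon X) y N"
proof -
  have "\<exists>x. finite \<Gamma> \<and> \<Gamma> \<subseteq> carr (dual X) \<longrightarrow> x \<in> carr X \<and> (\<forall>\<gamma>\<in>\<Gamma>. \<gamma> x = y \<gamma>)" for \<Gamma>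
    using bidual_interpolation[OF _ _ y, of \<Gamma>] by metis
  then obtain x where x: "finite \<Gamma> \<Longrightarrow> \<Gamma> \<subseteq> carr (dual X) \<Longrightarrow> x \<Gamma> \<in> carr X \<and> (\<forall>\<gamma>\<in>\<Gamma>. \<gamma> (x \<Gamma>) = y \<gamma>)" for \<Gamma>
    by metis
  let ?N = "filtermap x (finite_subsets_at_top (carr (dual X)))"
  have ev: "\<forall>\<^sub>F u in ?N. u \<in> carr X \<and> f u = y f" if "f \<in> carr (dual X)" for f
    unfolding eventually_filtermap eventually_finite_subsets_at_top
    using that x by (intro exI[of _ "{f}"]) auto
  have "\<forall>\<^sub>F u in ?N. u \<in> carr X"
    using ev[of 0] normed_space.carr_0[OF normed_space_dual] by (simp add: eventually_mono)
  moreover have "weak_star_lim (dual X) (canon X) y ?N"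
    unfolding weak_star_lim_def
  proof (intro conjI ballI)
    show "\<forall>\<^sub>F u in ?N. canon X u \<in> carr (bidual X)"
      using \<open>\<forall>\<^sub>F u in ?N. u \<in> carr X\<close> by (rule eventually_mono) (rule canon_in_bidual)
    fix f assume f: "f \<in> carr (dual X)"
    show "((\<lambda>u. canon X u f) \<longlongrightarrow> y f) ?N"
      using ev[OF f] f by (intro tendsto_eventually) (auto elim!: eventually_mono simp: canon_def)
  qed (rule y)
  moreover have "?N \<noteq> bot" by (simp add: filtermap_bot_iff)
  ultimately show thesis using that by blast
qed

text \<open>Inner limits agree eventually by induction, so the outer limits agree on
  \<open>carr Y\<close>; elsewhere both vanish, being elements of the dual.\<close>

lemma iter_weak_star_lim_unique:
  assumes "\<And>j. j \<in> set js \<Longrightarrow> N j \<noteq> bot"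
    and "iter_weak_star_lim Y N js G x z" "iter_weak_star_lim Y N js G x z'"
  shows "z = z'"
  using assms
proof (induction js arbitrary: x z z')
  case (Cons j js)
  obtain h where h: "\<forall>\<^sub>F u in N j. iter_weak_star_lim Y N js G (x(j := u)) (h u)" "weak_star_lim Y h z (N j)"
    using Cons.prems(2) by auto
  obtain h' where h': "\<forall>\<^sub>F u in N j. iter_weak_star_lim Y N js G (x(j := u)) (h' u)" "weak_star_lim Y h' z' (N j)"
    using Cons.prems(3) by auto
  have eq: "\<forall>\<^sub>F u in N j. h u = h' u"
    using h(1) h'(1) by eventually_elim (use Cons in auto)
  show ?case
  proof
    fix f
    show "z f = z' f"
    proof (cases "f \<in> carr Y")
      case True
      have "((\<lambda>u. h u f) \<longlongrightarrow> z f) (N j)" using h(2) True by (simp add: weak_star_lim_def)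
      moreover have "((\<lambda>u. h u f) \<longlongrightarrow> z' f) (N j)"
        using h'(2) True eq by (subst tendsto_cong[of _ "\<lambda>u. h' u f"]) (auto simp: weak_star_lim_def elim: eventually_mono)
      ultimately show ?thesis using Cons.prems(1)[of j] by (auto intro: tendsto_unique)
    next
      case False
      then show ?thesis using h(2) h'(2) by (simp add: weak_star_lim_def dual_outside[of _ Y])
    qed
  qed
qed simp

section \<open>An explicit formula for the iterated limits\<close>

locale bounded_multilinear = multilinear n E F T
  for n :: nat and E :: "nat \<Rightarrow> ('k::real_or_complex, 'a::ab_group_add) nspace"
    and F :: "('k, 'b::ab_group_add) nspace" and T :: "(nat \<Rightarrow> 'a) \<Rightarrow> 'b" +
  fixes C :: real
  assumes C_nonneg: "C \<ge> 0"
    and T_bound: "\<And>x. x \<in> points \<Longrightarrow> nrm F (T x) \<le> C * (\<Prod>i=1..n. nrm (E i) (x i))"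
begin

abbreviation bidual_points :: "(nat \<Rightarrow> ('a \<Rightarrow> 'k) \<Rightarrow> 'k) set" where
  "bidual_points \<equiv> \<Pi>\<^sub>E i\<in>{1..n}. carr (bidual (E i))"

text \<open>The argument \<open>x\<close> carries the variables outside \<open>js\<close>, so that
  the intermediate limits are of the same shape as the final one. Using \<open>canon F\<close>
  forces the value 0 at functions outside the dual of \<open>F\<close>.\<close>

definition ab :: "nat list \<Rightarrow> (nat \<Rightarrow> ('a \<Rightarrow> 'k) \<Rightarrow> 'k) \<Rightarrow> (nat \<Rightarrow> 'a) \<Rightarrow> ('b \<Rightarrow> 'k) \<Rightarrow> 'k" where
  "ab js y x = (\<lambda>\<phi>. bidual_ext E js (\<lambda>x. canon F (T x) \<phi>) y x)"

sublocale DF: normed_space "dual F"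
  by (rule F.normed_space_dual)

lemma bounded_form_canon:
  assumes \<phi>: "\<phi> \<in> carr (dual F)"
  shows "bounded_form (nrm (dual F) \<phi> * C) (\<lambda>x. canon F (T x) \<phi>)"
  unfolding bounded_form_def
proof (intro conjI ballI)
  show "0 \<le> nrm (dual F) \<phi> * C" using DF.nrm_nonneg[OF \<phi>] C_nonneg by simp
  fix x assume x: "x \<in> points"
  have "norm (\<phi> (T x)) \<le> nrm (dual F) \<phi> * nrm F (T x)"
    using F.dual_nrm_bound[OF \<phi> T_carr[OF x]] .
  also have "\<dots> \<le> nrm (dual F) \<phi> * (C * (\<Prod>i=1..n. nrm (E i) (x i)))"
    using T_bound[OF x] DF.nrm_nonneg[OF \<phi>] by (rule mult_left_mono)
  finally show "norm (canon F (T x) \<phi>) \<le> nrm (dual F) \<phi> * C * (\<Prod>i=1..n. nrm (E i) (x i))"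
    using \<phi> by (simp add: canon_def mult.assoc)
  fix i assume i: "i \<in> {1..n}"
  show "lin_on (E i) (\<lambda>u. canon F (T (x(i := u))) \<phi>)"
    unfolding lin_on_def
    using \<phi> T_carr[OF points_upd[OF x i]]
    by (simp add: canon_def T_add[OF x i] T_scl[OF x i] dual_add[OF \<phi>] dual_scl[OF \<phi>])
qed

lemma ab_outside:
  "bidual_point js y \<Longrightarrow> \<phi> \<notin> carr (dual F) \<Longrightarrow> ab js y x \<phi> = 0"
  by (simp add: ab_def canon_def bidual_ext_zero_form)

lemma ab_bound:
  assumes "bidual_point js y" "x \<in> partial_points js" and \<phi>: "\<phi> \<in> carr (dual F)"
  shows "norm (ab js y x \<phi>) \<le>
    C * (\<Prod>i\<in>{1..n} - set js. nrm (E i) (x i)) * (\<Prod>j\<in>set js. nrm (bidual (E j)) (y j)) * nrm (dual F) \<phi>"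
  using bidual_ext_bound[OF bounded_form_canon[OF \<phi>] assms(1,2)] by (simp add: ab_def mult_ac)

lemma ab_in_bidual:
  assumes y: "bidual_point js y" and x: "x \<in> partial_points js"
  shows "ab js y x \<in> carr (bidual F)"
  unfolding carr_dual[of _ "dual F"] lin_on_def
proof (intro conjI ballI allI impI exI)
  fix \<phi> assume \<phi>: "\<phi> \<in> carr (dual F)"
  show "norm (ab js y x \<phi>) \<le>
    C * (\<Prod>i\<in>{1..n} - set js. nrm (E i) (x i)) * (\<Prod>j\<in>set js. nrm (bidual (E j)) (y j)) * nrm (dual F) \<phi>"
    by (rule ab_bound[OF y x \<phi>])
  show "ab js y x (scl (dual F) c \<phi>) = c * ab js y x \<phi>" for c
  proof -
    have "(\<lambda>x. canon F (T x) (scl (dual F) c \<phi>)) = (\<lambda>x. c * canon F (T x) \<phi>)"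
      using \<phi> DF.carr_scl[OF \<phi>, of c] by (auto simp: canon_def scl_dual)
    then show ?thesis unfolding ab_def using bidual_ext_scl_form[OF bounded_form_canon[OF \<phi>] y x] by (simp only:)
  qed
  fix \<psi> assume \<psi>: "\<psi> \<in> carr (dual F)"
  have "(\<lambda>x. canon F (T x) (\<phi> + \<psi>)) = (\<lambda>x. canon F (T x) \<phi> + canon F (T x) \<psi>)"
    using \<phi> \<psi> DF.carr_add[OF \<phi> \<psi>] by (auto simp: canon_def)
  then show "ab js y x (\<phi> + \<psi>) = ab js y x \<phi> + ab js y x \<psi>"
    unfolding ab_def
    using bidual_ext_add_form[OF bounded_form_canon[OF \<phi>] bounded_form_canon[OF \<psi>] y x] by (simp only:)
qed (rule ab_outside[OF y])

text \<open>Evaluating the slice at \<open>u\<close> gives the inner limit with \<open>u\<close>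
  inserted, and the slice lies in the dual of \<open>E j\<close>; weak-star convergence of
  \<open>N j\<close> tested on it is exactly the outer limit.\<close>

lemma iter_weak_star_lim_ab:
  assumes "bidual_point js y" "x \<in> partial_points js"
    and N: "\<And>i. i \<in> {1..n} \<Longrightarrow> \<forall>\<^sub>F u in N i. u \<in> carr (E i)"
    "\<And>i. i \<in> {1..n} \<Longrightarrow> weak_star_lim (dual (E i)) (canon (E i)) (y i) (N i)"
  shows "iter_weak_star_lim (dual F) N js (\<lambda>x. canon F (T x)) x (ab js y x)"
  using assms(1,2)
proof (induction js arbitrary: x)
  case Nil
  show ?case by (simp add: ab_def)
next
  case (Cons j js)
  note y = bidual_pointD[OF Cons.prems(1)]
  have pp: "\<forall>\<^sub>F u in N j. u \<in> carr (E j) \<and> x(j := u) \<in> partial_points js"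
    using N(1)[OF y(2)] by eventually_elim (use partial_points_upd[OF Cons.prems(2) y(2)] in blast)
  have "\<forall>\<^sub>F u in N j. iter_weak_star_lim (dual F) N js (\<lambda>x. canon F (T x)) (x(j := u)) (ab js y (x(j := u)))"
    using pp by eventually_elim (use Cons.IH[OF y(1)] in blast)
  moreover have "weak_star_lim (dual F) (\<lambda>u. ab js y (x(j := u))) (ab (j # js) y x) (N j)"
    unfolding weak_star_lim_def
  proof (intro conjI ballI)
    show "ab (j # js) y x \<in> carr (bidual F)" by (rule ab_in_bidual[OF Cons.prems])
    show "\<forall>\<^sub>F u in N j. ab js y (x(j := u)) \<in> carr (bidual F)"
      using pp by eventually_elim (use ab_in_bidual[OF y(1)] in blast)
    fix \<phi> assume \<phi>: "\<phi> \<in> carr (dual F)"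
    let ?f = "slice E j js (\<lambda>x. canon F (T x) \<phi>) y x"
    have f: "?f \<in> carr (dual (E j))"
      by (rule slice_in_dual[OF bounded_form_canon[OF \<phi>] Cons.prems])
    have "((\<lambda>u. canon (E j) u ?f) \<longlongrightarrow> y j ?f) (N j)"
      using N(2)[OF y(2)] f by (simp add: weak_star_lim_def)
    moreover have "\<forall>\<^sub>F u in N j. canon (E j) u ?f = ab js y (x(j := u)) \<phi>"
      using pp by eventually_elim (use f in \<open>simp add: canon_def slice_def ab_def\<close>)
    ultimately show "((\<lambda>u. ab js y (x(j := u)) \<phi>) \<longlongrightarrow> ab (j # js) y x \<phi>) (N j)"
      unfolding ab_def bidual_ext_Cons by (rule Lim_transform_eventually)
  qed
  ultimately show ?case
    unfolding iter_weak_star_lim.simps by (intro exI[of _ "\<lambda>u. ab js y (x(j := u))"] conjI)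
qed

lemma start_point: "set js = {1..n} \<Longrightarrow> (\<lambda>_. undefined) \<in> partial_points js"
  by (simp add: partial_points_def)

lemma bidual_points_point:
  "y \<in> bidual_points \<Longrightarrow> set js = {1..n} \<Longrightarrow> distinct js \<Longrightarrow> bidual_point js y"
  by (auto simp: bidual_point_def PiE_iff)

lemma permutation_list:
  assumes "\<sigma> permutes {1..n}"
  shows "set (map \<sigma> [1..<n + 1]) = {1..n}" "distinct (map \<sigma> [1..<n + 1])"
proof -
  have "{1..<n + 1} = {1..n}" by auto
  then show "set (map \<sigma> [1..<n + 1]) = {1..n}"
    using permutes_image[OF assms] by (simp only: set_map set_upt)
  show "distinct (map \<sigma> [1..<n + 1])"
    using permutes_inj_on[OF assms] by (simp add: distinct_map)
qed

text \<open>The defining condition speaks about \<open>B y\<close> only if suitable nets at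
  \<open>y\<close> exist. One choice of nets then suffices, because the iterated limit is unique and
  \<open>ab\<close> is one.\<close>

lemma aron_berner_eq_ab:
  assumes "B \<in> aron_berner_extensions n E F T"
  obtains js where "set js = {1..n}" "distinct js"
    "\<And>y. y \<in> bidual_points \<Longrightarrow> B y = ab js y (\<lambda>_. undefined)"
proof -
  obtain \<sigma> where \<sigma>: "\<sigma> permutes {1..n}" and lim: "\<And>y N. y \<in> bidual_points \<Longrightarrow>
      (\<And>i. i \<in> {1..n} \<Longrightarrow> N i \<noteq> bot \<and> (\<forall>\<^sub>F u in N i. u \<in> carr (E i)) \<and>
         weak_star_lim (dual (E i)) (canon (E i)) (y i) (N i)) \<Longrightarrow>
      iter_weak_star_lim (dual F) N (map \<sigma> [1..<n + 1]) (\<lambda>x. canon F (T x)) (\<lambda>_. undefined) (B y)"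
    using assms unfolding aron_berner_extensions_def by blast
  note js = permutation_list[OF \<sigma>]
  show thesis
  proof (rule that[OF js])
    fix y assume y: "y \<in> bidual_points"
    have "\<exists>N. \<forall>i\<in>{1..n}. N i \<noteq> bot \<and> (\<forall>\<^sub>F u in N i. u \<in> carr (E i)) \<and>
        weak_star_lim (dual (E i)) (canon (E i)) (y i) (N i)"
    proof (rule bchoice, intro ballI)
      fix i assume i: "i \<in> {1..n}"
      then have "y i \<in> carr (bidual (E i))" using y by (auto simp: PiE_iff)
      from normed_space.weak_star_net_exists[OF normed_E[OF i] this]
      show "\<exists>N. N \<noteq> bot \<and> (\<forall>\<^sub>F u in N. u \<in> carr (E i)) \<and> weak_star_lim (dual (E i)) (canon (E i)) (y i) N"
        by metis
    qed
    then obtain N where N: "\<And>i. i \<in> {1..n} \<Longrightarrow> N i \<noteq> bot \<and> (\<forall>\<^sub>F u in N i. u \<in> carr (E i)) \<and>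
        weak_star_lim (dual (E i)) (canon (E i)) (y i) (N i)"
      by blast
    show "B y = ab (map \<sigma> [1..<n + 1]) y (\<lambda>_. undefined)"
    proof (rule iter_weak_star_lim_unique)
      show "N j \<noteq> bot" if "j \<in> set (map \<sigma> [1..<n + 1])" for j using that N unfolding js by blast
      show "iter_weak_star_lim (dual F) N (map \<sigma> [1..<n + 1]) (\<lambda>x. canon F (T x)) (\<lambda>_. undefined) (B y)"
        by (rule lim[OF y N])
      show "iter_weak_star_lim (dual F) N (map \<sigma> [1..<n + 1]) (\<lambda>x. canon F (T x)) (\<lambda>_. undefined)
          (ab (map \<sigma> [1..<n + 1]) y (\<lambda>_. undefined))"
        using N by (intro iter_weak_star_lim_ab bidual_points_point[OF y js] start_point[OF js(1)]) blast+
    qed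
  qed
qed

text \<open>This rules out that the statement about all extensions holds vacuously. The witness
  takes the limits in the order of the identity permutation and inherits the bound \<open>C\<close>
  of \<open>T\<close>.\<close>

lemma aron_berner_exists: "aron_berner_extensions n E F T \<noteq> {}"
proof -
  let ?js = "map id [1..<n + 1]"
  have id: "id permutes {1..n}" by (rule permutes_id)
  note js = permutation_list[OF id]
  \<comment> \<open>Restricted to the bidual points, as operators are represented by extensional
    functions.\<close>
  define B where "B = (\<lambda>y\<in>bidual_points. ab ?js y (\<lambda>_. undefined))"
  note pt = bidual_points_point[OF _ js]
  note st = start_point[OF js(1)]
  have upd: "y(i := u) \<in> bidual_points" if "y \<in> bidual_points" "i \<in> {1..n}" "u \<in> carr (bidual (E i))" for y i u
    using that by (auto simp: PiE_iff extensional_def)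
  have add: "B (y(i := u + v)) = B (y(i := u)) + B (y(i := v))"
    if y: "y \<in> bidual_points" and i: "i \<in> {1..n}" and u: "u \<in> carr (bidual (E i))" and v: "v \<in> carr (bidual (E i))"
    for y i u v
  proof
    fix \<phi>
    note uv = normed_space.carr_add[OF normed_bidual[OF i] u v]
    have "ab ?js (y(i := u + v)) (\<lambda>_. undefined) \<phi> =
        ab ?js (y(i := u)) (\<lambda>_. undefined) \<phi> + ab ?js (y(i := v)) (\<lambda>_. undefined) \<phi>"
    proof (cases "\<phi> \<in> carr (dual F)")
      case True
      have "i \<in> set ?js" using i unfolding js .
      then show ?thesis
        unfolding ab_def
        by (intro bidual_ext_add_point[OF bounded_form_canon[OF True] pt[OF upd[OF y i u]] pt[OF upd[OF y i v]] _ st])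
    next
      case False
      show ?thesis
        unfolding ab_outside[OF pt[OF upd[OF y i u]] False] ab_outside[OF pt[OF upd[OF y i v]] False]
            ab_outside[OF pt[OF upd[OF y i uv]] False] by simp
    qed
    then show "B (y(i := u + v)) \<phi> = (B (y(i := u)) + B (y(i := v))) \<phi>"
      using upd[OF y i u] upd[OF y i v] upd[OF y i uv] by (simp add: B_def del: fun_upd_apply)
  qed
  have scale: "B (y(i := scl (bidual (E i)) c u)) = scl (bidual F) c (B (y(i := u)))"
    if y: "y \<in> bidual_points" and i: "i \<in> {1..n}" and u: "u \<in> carr (bidual (E i))" for y i u c
  proof
    fix \<phi>
    note cu = normed_space.carr_scl[OF normed_bidual[OF i] u, of c]
    have "ab ?js (y(i := scl (bidual (E i)) c u)) (\<lambda>_. undefined) \<phi> = c * ab ?js (y(i := u)) (\<lambda>_. undefined) \<phi>"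
    proof (cases "\<phi> \<in> carr (dual F)")
      case True
      have "i \<in> set ?js" using i unfolding js .
      then show ?thesis
        unfolding ab_def
        by (intro bidual_ext_scl_point[OF bounded_form_canon[OF True] pt[OF upd[OF y i u]] _ st])
    next
      case False
      show ?thesis
        unfolding ab_outside[OF pt[OF upd[OF y i u]] False] ab_outside[OF pt[OF upd[OF y i cu]] False] by simp
    qed
    then show "B (y(i := scl (bidual (E i)) c u)) \<phi> = scl (bidual F) c (B (y(i := u))) \<phi>"
      using upd[OF y i u] upd[OF y i cu] by (simp add: B_def scl_dual[of "dual F"] del: fun_upd_apply)
  qed
  interpret M: multilinear n "\<lambda>i. bidual (E i)" "bidual F" B
  proof (intro multilinear.intro normed_family.intro multilinear_axioms.intro)
    show "normed_space (bidual (E i))" if "i \<in> {1..n}" for i using normed_bidual[OF that] .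
    show "normed_space (bidual F)" by (rule DF.normed_space_dual)
    show "B \<in> bidual_points \<rightarrow>\<^sub>E carr (bidual F)"
      unfolding B_def using ab_in_bidual[OF pt st] by auto
  qed (fact add scale)+
  have "B \<in> multilinear_ops n (\<lambda>i. bidual (E i)) (bidual F)"
  proof (rule M.multilinear_opsI[OF _ C_nonneg])
    fix y assume y: "y \<in> bidual_points"
    show "nrm (bidual F) (B y) \<le> C * (\<Prod>i=1..n. nrm (bidual (E i)) (y i))"
    proof (rule DF.dual_nrm_least)
      show "norm (B y \<phi>) \<le> C * (\<Prod>i=1..n. nrm (bidual (E i)) (y i)) * nrm (dual F) \<phi>"
        if "\<phi> \<in> carr (dual F)" for \<phi>
        using ab_bound[OF pt[OF y] st that] y unfolding js by (simp add: B_def)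
      show "0 \<le> C * (\<Prod>i=1..n. nrm (bidual (E i)) (y i))"
        using C_nonneg M.points_nonneg[OF y] by (intro mult_nonneg_nonneg prod_nonneg) auto
    qed
  qed
  moreover have "iter_weak_star_lim (dual F) N ?js (\<lambda>x. canon F (T x)) (\<lambda>_. undefined) (B y)"
    if y: "y \<in> bidual_points" and N: "\<forall>i\<in>{1..n}. N i \<noteq> bot \<and> (\<forall>\<^sub>F u in N i. u \<in> carr (E i)) \<and>
      weak_star_lim (dual (E i)) (canon (E i)) (y i) (N i)" for y N
    using iter_weak_star_lim_ab[OF pt[OF y] st, of N] N y by (simp add: B_def)
  ultimately have "B \<in> aron_berner_extensions n E F T"
    unfolding aron_berner_extensions_def using id by blast
  then show ?thesis by blast
qed

lemma aron_berner_canon: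
  assumes B: "B \<in> aron_berner_extensions n E F T" and x: "x \<in> points"
  shows "B (\<lambda>i\<in>{1..n}. canon (E i) (x i)) = canon F (T x)"
proof -
  obtain js where js: "set js = {1..n}" "distinct js"
    "\<And>y. y \<in> bidual_points \<Longrightarrow> B y = ab js y (\<lambda>_. undefined)"
    using aron_berner_eq_ab[OF B] by blast
  let ?y = "\<lambda>i\<in>{1..n}. canon (E i) (x i)"
  have y: "?y \<in> bidual_points"
    using x normed_space.canon_in_bidual[OF normed_E] by (auto simp: PiE_iff)
  have "ab js ?y (\<lambda>_. undefined) \<phi> = canon F (T x) \<phi>" for \<phi>
  proof (cases "\<phi> \<in> carr (dual F)")
    case True
    have "ab js ?y (\<lambda>_. undefined) \<phi> =
        bidual_ext E js (\<lambda>x. canon F (T x) \<phi>) (\<lambda>i. canon (E i) (x i)) (\<lambda>_. undefined)"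
      unfolding ab_def using js(1) by (intro bidual_ext_cong) auto
    also have "\<dots> = canon F (T x) \<phi>"
      using js by (intro bidual_ext_canon[OF x bounded_form_canon[OF True]]) auto
    finally show ?thesis .
  next
    case False
    then show ?thesis using ab_outside[OF bidual_points_point[OF y js(1,2)]] by (simp add: canon_def)
  qed
  then show ?thesis using js(3)[OF y] by (simp add: fun_eq_iff)
qed

lemma aron_berner_in_bidual:
  assumes B: "B \<in> aron_berner_extensions n E F T" and y: "y \<in> bidual_points"
  shows "B y \<in> carr (bidual F)"
  using B y by (auto simp: aron_berner_extensions_def multilinear_ops_def)

text \<open>\<open>bidual_ext_realize\<close> for the forms obtained by testing \<open>T\<close>
  with the functionals in \<open>\<Phi>\<close>. The tested values are matched exactly; slack is
  needed only in the norms.\<close>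

lemma aron_berner_realize:
  assumes B: "B \<in> aron_berner_extensions n E F T" and J: "finite J" and I: "finite I"
    and \<Phi>: "finite \<Phi>" "\<Phi> \<subseteq> carr (dual F)" and y: "\<And>l. l \<in> J \<Longrightarrow> y l \<in> bidual_points"
    and a: "\<And>i c. i \<in> {1..n} \<Longrightarrow> c \<in> I \<Longrightarrow>
      nrm (bidual (E i)) (\<Sum>l\<in>J. scl (bidual (E i)) (c l) (y l i)) < a i c"
  obtains x where "\<And>l. l \<in> J \<Longrightarrow> x l \<in> points" "\<And>l \<phi>. l \<in> J \<Longrightarrow> \<phi> \<in> \<Phi> \<Longrightarrow> B (y l) \<phi> = \<phi> (T (x l))"
    "\<And>i c. i \<in> {1..n} \<Longrightarrow> c \<in> I \<Longrightarrow> nrm (E i) (\<Sum>l\<in>J. scl (E i) (c l) (x l i)) \<le> a i c"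
proof -
  obtain js where js: "set js = {1..n}" "distinct js"
    "\<And>y. y \<in> bidual_points \<Longrightarrow> B y = ab js y (\<lambda>_. undefined)"
    using aron_berner_eq_ab[OF B] by blast
  let ?\<G> = "(\<lambda>\<phi> x. canon F (T x) \<phi>) ` \<Phi>"
  have "\<exists>x'. (\<forall>l\<in>J. x' l \<in> points \<and> (\<forall>i. i \<notin> set js \<longrightarrow> x' l i = undefined) \<and>
           (\<forall>G\<in>?\<G>. bidual_ext E js G (y l) (\<lambda>_. undefined) = G (x' l))) \<and>
         (\<forall>j\<in>set js. \<forall>c\<in>I. nrm (E j) (\<Sum>l\<in>J. scl (E j) (c l) (x' l j)) \<le> a j c)"
  proof (rule bidual_ext_realize[OF J I])
    show "\<exists>K. bounded_form K G" if "G \<in> ?\<G>" for G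
      using that bounded_form_canon \<Phi>(2) by blast
    show "bidual_point js (y l)" if "l \<in> J" for l
      by (rule bidual_points_point[OF y[OF that] js(1,2)])
    show "(\<lambda>_. undefined) \<in> partial_points js" by (rule start_point[OF js(1)])
  qed (use js(1,2) \<Phi>(1) a in simp_all)
  then obtain x where x: "\<forall>l\<in>J. x l \<in> points \<and> (\<forall>i. i \<notin> set js \<longrightarrow> x l i = undefined) \<and>
      (\<forall>G\<in>?\<G>. bidual_ext E js G (y l) (\<lambda>_. undefined) = G (x l))"
    "\<forall>j\<in>set js. \<forall>c\<in>I. nrm (E j) (\<Sum>l\<in>J. scl (E j) (c l) (x l j)) \<le> a j c"
    by (elim exE conjE)
  show thesis
  proof (rule that)
    show "x l \<in> points" if "l \<in> J" for l using x(1) that by blast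
    show "B (y l) \<phi> = \<phi> (T (x l))" if l: "l \<in> J" and \<phi>: "\<phi> \<in> \<Phi>" for l \<phi>
    proof -
      have "ab js (y l) (\<lambda>_. undefined) \<phi> = canon F (T (x l)) \<phi>"
        using x(1)[rule_format, OF l, THEN conjunct2, THEN conjunct2, rule_format, OF imageI[OF \<phi>]]
        unfolding ab_def .
      then show ?thesis using js(3)[OF y[OF l]] \<Phi>(2) \<phi> by (auto simp: canon_def)
    qed
    show "nrm (E i) (\<Sum>l\<in>J. scl (E i) (c l) (x l i)) \<le> a i c" if "i \<in> {1..n}" "c \<in> I" for i c
      using x(2) that unfolding js(1) by blast
  qed
qed

end


section \<open>Type and cotype\<close>

definition signs :: "nat \<Rightarrow> (nat \<Rightarrow> real) set" where
  "signs k = {1..k} \<rightarrow>\<^sub>E {- 1, 0, 1}"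

definition rad_set :: "nat \<Rightarrow> (nat \<Rightarrow> real) \<Rightarrow> real set" where
  "rad_set k c = {0..1} \<inter> {t. \<forall>j\<in>{1..k}. rademacher j t = c j}"

lemma finite_signs: "finite (signs k)"
  by (simp add: signs_def finite_PiE)

lemma rademacher_signs: "(\<lambda>j\<in>{1..k}. rademacher j t) \<in> signs k"
  by (auto simp: signs_def rademacher_def sgn_real_def)

lemma borel_measurable_rademacher: "rademacher j \<in> borel_measurable borel"
  unfolding rademacher_def sgn_real_def by measurable

lemma rad_set_borel: "rad_set k c \<in> sets lborel"
proof -
  have [measurable]: "rademacher j \<in> borel_measurable borel" for j
    by (rule borel_measurable_rademacher)
  have "{t \<in> space borel. \<forall>j\<in>{1..k}. rademacher j t = c j} \<in> sets borel" by measurable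
  then show ?thesis by (simp add: rad_set_def)
qed

text \<open>The integrand depends on t only through the sign pattern, so the integral is a finite
  sum over level sets. Their measures are left unevaluated and serve as nonnegative weights.\<close>

lemma rademacher_integral:
  "(LINT t:{0..1}|lborel. H (\<lambda>j\<in>{1..k}. rademacher j t)) = (\<Sum>c\<in>signs k. measure lborel (rad_set k c) * H c)"
    (is "?L = _")
proof -
  have "indicator {0..1} t *\<^sub>R H (\<lambda>j\<in>{1..k}. rademacher j t) = (\<Sum>c\<in>signs k. indicator (rad_set k c) t * H c)"
    for t :: real
  proof -
    let ?r = "\<lambda>j\<in>{1..k}. rademacher j t"
    \<comment> \<open>Exactly one pattern survives at each t of the interval; extensionality
      identifies a matching pattern with the restricted one.\<close>
    have "indicator (rad_set k c) t * H c = (if c = ?r then indicator {0..1} t * H ?r else 0)"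
      if "c \<in> signs k" for c
    proof (cases "c = ?r")
      case True
      then have "t \<in> rad_set k c \<longleftrightarrow> t \<in> {0..1}" by (simp add: rad_set_def)
      then show ?thesis using True by (simp add: indicator_def)
    next
      case False
      then have "\<exists>j\<in>{1..k}. rademacher j t \<noteq> c j"
        using PiE_ext[OF that[unfolded signs_def] rademacher_signs[of t k, unfolded signs_def]] by fastforce
      then have "t \<notin> rad_set k c" by (auto simp: rad_set_def)
      then show ?thesis using False by simp
    qed
    then show ?thesis using rademacher_signs[of t k] finite_signs[of k] by simp
  qed
  moreover have "integrable lborel (\<lambda>t. indicator (rad_set k c) t * H c)" for c
  proof -
    have "emeasure lborel (rad_set k c) \<le> emeasure lborel {0..1 :: real}"
      by (rule emeasure_mono) (auto simp: rad_set_def)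
    also have "\<dots> < \<infinity>" by simp
    finally have "integrable lborel (indicator (rad_set k c) :: real \<Rightarrow> real)"
      by (intro integrable_real_indicator rad_set_borel)
    then show ?thesis by (rule integrable_mult_left)
  qed
  ultimately show ?thesis
    unfolding set_lebesgue_integral_def using rad_set_borel by (simp add: Bochner_Integration.integral_sum)
qed

text \<open>With general scalar coefficients, sign combinations and, through \<open>unit\<close>,
  single terms become instances of one expression, so type and cotype share a single approximation
  lemma.\<close>

definition rad_comb ::
    "('k::real_or_complex, 'a::ab_group_add) nspace \<Rightarrow> nat \<Rightarrow> (nat \<Rightarrow> 'a) \<Rightarrow> (nat \<Rightarrow> 'k) \<Rightarrow> 'a" where
  "rad_comb X k x c = (\<Sum>j=1..k. scl X (c j) (x j))"

definition rad_mean :: "nat \<Rightarrow> ((nat \<Rightarrow> real) \<Rightarrow> real) \<Rightarrow> real" where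
  "rad_mean k v = sqrt (\<Sum>c\<in>signs k. measure lborel (rad_set k c) * (v c)\<^sup>2)"

lemma rad_norm_eq_rad_mean:
  "rad_norm X k x = rad_mean k (\<lambda>c. nrm X (rad_comb X k x (\<lambda>j. of_real (c j))))"
proof -
  have "(nrm X (\<Sum>j=1..k. scl X (of_real (rademacher j t)) (x j)))\<^sup>2 =
      (nrm X (rad_comb X k x (\<lambda>j. of_real ((\<lambda>j\<in>{1..k}. rademacher j t) j))))\<^sup>2" for t
    by (simp add: rad_comb_def)
  then show ?thesis
    unfolding rad_norm_def rad_mean_def rademacher_integral[symmetric] by (simp only:)
qed

lemma rad_mean_mono: "(\<And>c. c \<in> signs k \<Longrightarrow> 0 \<le> v c \<and> v c \<le> w c) \<Longrightarrow> rad_mean k v \<le> rad_mean k w"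
  unfolding rad_mean_def by (intro real_sqrt_le_mono sum_mono mult_left_mono power_mono) auto

lemma rad_mean_nonneg: "0 \<le> rad_mean k v"
  by (simp add: rad_mean_def sum_nonneg)

definition lp_mean :: "real \<Rightarrow> nat \<Rightarrow> (nat \<Rightarrow> real) \<Rightarrow> real" where
  "lp_mean p k v = (\<Sum>j=1..k. v j powr p) powr (1 / p)"

lemma lp_norm_eq_lp_mean: "lp_norm X p k x = lp_mean p k (\<lambda>j. nrm X (x j))"
  by (simp add: lp_norm_def lp_mean_def)

lemma lp_mean_mono:
  "p > 0 \<Longrightarrow> (\<And>j. j \<in> {1..k} \<Longrightarrow> 0 \<le> v j \<and> v j \<le> w j) \<Longrightarrow> lp_mean p k v \<le> lp_mean p k w"
  unfolding lp_mean_def by (intro powr_mono2 sum_mono sum_nonneg) auto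

lemma lp_mean_nonneg: "0 \<le> lp_mean p k v"
  by (simp add: lp_mean_def)

lemma tendsto_rad_mean:
  "(\<And>c. c \<in> signs k \<Longrightarrow> ((\<lambda>d. v d c) \<longlongrightarrow> w c) G) \<Longrightarrow> ((\<lambda>d. rad_mean k (v d)) \<longlongrightarrow> rad_mean k w) G"
  unfolding rad_mean_def by (intro tendsto_intros)

text \<open>Some entries may tend to 0, where continuity of \<open>powr\<close> needs a positive
  exponent and nonnegative bases.\<close>

lemma tendsto_lp_mean:
  assumes p: "p > 0" and v: "\<And>j. j \<in> {1..k} \<Longrightarrow> ((\<lambda>d. v d j) \<longlongrightarrow> w j) G"
    and nonneg: "\<And>j. j \<in> {1..k} \<Longrightarrow> \<forall>\<^sub>F d in G. 0 \<le> v d j"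
  shows "((\<lambda>d. lp_mean p k (v d)) \<longlongrightarrow> lp_mean p k w) G"
proof -
  have "((\<lambda>d. v d j powr p) \<longlongrightarrow> w j powr p) G" if "j \<in> {1..k}" for j
    using p v[OF that] nonneg[OF that] by (intro tendsto_powr') auto
  then have "((\<lambda>d. \<Sum>j=1..k. v d j powr p) \<longlongrightarrow> (\<Sum>j=1..k. w j powr p)) G"
    by (intro tendsto_sum)
  then show ?thesis unfolding lp_mean_def using p by (intro tendsto_powr') (auto intro!: always_eventually sum_nonneg)
qed

definition unit :: "nat \<Rightarrow> nat \<Rightarrow> 'k::real_or_complex" where
  "unit l = (\<lambda>j. if j = l then 1 else 0)"

lemma (in normed_space) rad_comb_unit: "l \<in> {1..k} \<Longrightarrow> rad_comb X k x (unit l) = x l"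
proof -
  assume l: "l \<in> {1..k}"
  have "rad_comb X k x (unit l) = (\<Sum>j=1..k. if j = l then x j else 0)"
    unfolding rad_comb_def unit_def by (intro sum.cong) auto
  then show ?thesis using l by simp
qed

lemma (in normed_space) rad_comb_carr: "(\<And>j. j \<in> {1..k} \<Longrightarrow> x j \<in> carr X) \<Longrightarrow> rad_comb X k x c \<in> carr X"
  unfolding rad_comb_def by (intro carr_sum carr_scl)

lemma (in normed_space) nrm_rad_comb_canon:
  assumes "\<And>j. j \<in> {1..k} \<Longrightarrow> x j \<in> carr X"
  shows "nrm (bidual X) (rad_comb (bidual X) k (\<lambda>j. canon X (x j)) c) = nrm X (rad_comb X k x c)"
proof -
  have "rad_comb (bidual X) k (\<lambda>j. canon X (x j)) c = canon X (rad_comb X k x c)"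
    unfolding rad_comb_def using canon_sum_scl[of "{1..k}" x c] assms by simp
  then show ?thesis using nrm_canon[OF rad_comb_carr[OF assms]] by simp
qed

section \<open>Transfer of type and cotype between an operator and its extensions\<close>

context bounded_multilinear
begin

text \<open>For each \<open>c\<close> in \<open>D\<close> a functional of norm at most 1 almost
  norms the combination of values of \<open>B\<close>. The realizing vectors reproduce its value on
  the corresponding combination of values of \<open>T\<close>, which bounds that norm from below.
  Keeping \<open>I\<close> and \<open>D\<close> separate allows different combinations in domain and
  range.\<close>

lemma aron_berner_approx:
  assumes B: "B \<in> aron_berner_extensions n E F T" and I: "finite I" and D: "finite D" and d: "d > 0"
    and y: "\<And>j. j \<in> {1..k} \<Longrightarrow> y j \<in> bidual_points"
  obtains x where "\<forall>j\<in>{1..k}. x j \<in> points"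
    "\<forall>i\<in>{1..n}. \<forall>c\<in>I. nrm (E i) (rad_comb (E i) k (\<lambda>j. x j i) c) \<le>
      nrm (bidual (E i)) (rad_comb (bidual (E i)) k (\<lambda>j. y j i) c) + d"
    "\<forall>c\<in>D. nrm (bidual F) (rad_comb (bidual F) k (\<lambda>j. B (y j)) c) - d \<le>
      nrm F (rad_comb F k (\<lambda>j. T (x j)) c)"
proof -
  interpret BF: normed_space "bidual F" by (rule DF.normed_space_dual)
  let ?z = "\<lambda>c. rad_comb (bidual F) k (\<lambda>j. B (y j)) c"
  have z: "?z c \<in> carr (bidual F)" for c
    using aron_berner_in_bidual[OF B y] by (intro BF.rad_comb_carr)
  have "\<exists>\<phi>. \<phi> \<in> carr (dual F) \<and> nrm (dual F) \<phi> \<le> 1 \<and> nrm (bidual F) (?z c) - d < norm (?z c \<phi>)" for c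
    using DF.dual_nrm_approx[OF z[of c], of "nrm (bidual F) (?z c) - d"] d by (metis diff_less_eq less_add_same_cancel1)
  then obtain \<phi> where \<phi>: "\<phi> c \<in> carr (dual F)" "nrm (dual F) (\<phi> c) \<le> 1"
    "nrm (bidual F) (?z c) - d < norm (?z c (\<phi> c))" for c by metis
  obtain x where x: "\<And>j. j \<in> {1..k} \<Longrightarrow> x j \<in> points"
    "\<And>j \<psi>. j \<in> {1..k} \<Longrightarrow> \<psi> \<in> \<phi> ` D \<Longrightarrow> B (y j) \<psi> = \<psi> (T (x j))"
    "\<And>i c. i \<in> {1..n} \<Longrightarrow> c \<in> I \<Longrightarrow> nrm (E i) (\<Sum>j=1..k. scl (E i) (c j) (x j i)) \<le>
      nrm (bidual (E i)) (rad_comb (bidual (E i)) k (\<lambda>j. y j i) c) + d"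
    by (rule aron_berner_realize[OF B, of "{1..k}" I "\<phi> ` D" y
          "\<lambda>i c. nrm (bidual (E i)) (rad_comb (bidual (E i)) k (\<lambda>j. y j i) c) + d"])
      (use I D \<phi>(1) y d in \<open>auto simp: rad_comb_def\<close>)
  show thesis
  proof (rule that[of x]; intro ballI)
    show "x j \<in> points" if "j \<in> {1..k}" for j using x(1)[OF that] .
    show "nrm (E i) (rad_comb (E i) k (\<lambda>j. x j i) c) \<le>
        nrm (bidual (E i)) (rad_comb (bidual (E i)) k (\<lambda>j. y j i) c) + d" if "i \<in> {1..n}" "c \<in> I" for i c
      using x(3)[OF that] by (simp add: rad_comb_def[of "E i"])
    fix c assume c: "c \<in> D"
    have Tx: "T (x j) \<in> carr F" if "j \<in> {1..k}" for j using T_carr[OF x(1)[OF that]] .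
    have s: "sum w {1..k} f = (\<Sum>j=1..k. w j f)" for w :: "nat \<Rightarrow> ('b \<Rightarrow> 'k) \<Rightarrow> 'k" and f
      by (induction k) auto
    have "?z c (\<phi> c) = (\<Sum>j=1..k. c j * B (y j) (\<phi> c))"
      unfolding rad_comb_def s by (simp add: scl_dual)
    also have "\<dots> = (\<Sum>j=1..k. \<phi> c (scl F (c j) (T (x j))))"
      using x(2) c by (intro sum.cong) (auto simp: dual_scl[OF \<phi>(1) Tx])
    also have "\<dots> = \<phi> c (rad_comb F k (\<lambda>j. T (x j)) c)"
      unfolding rad_comb_def by (intro F.dual_sum[OF \<phi>(1), symmetric] F.carr_scl Tx)
    finally have "norm (?z c (\<phi> c)) \<le> nrm (dual F) (\<phi> c) * nrm F (rad_comb F k (\<lambda>j. T (x j)) c)"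
      using F.dual_nrm_bound[OF \<phi>(1) F.rad_comb_carr[of k "\<lambda>j. T (x j)", OF Tx]] by simp
    also have "\<dots> \<le> nrm F (rad_comb F k (\<lambda>j. T (x j)) c)"
      using \<phi>(2)[of c] F.nrm_nonneg[OF F.rad_comb_carr[of k "\<lambda>j. T (x j)", OF Tx]] DF.nrm_nonneg[OF \<phi>(1)]
      by (intro mult_left_le_one_le)
    finally show "nrm (bidual F) (?z c) - d \<le> nrm F (rad_comb F k (\<lambda>j. T (x j)) c)"
      using \<phi>(3)[of c] by simp
  qed
qed

text \<open>The type inequality of \<open>T\<close> at the approximating vectors becomes one for
  \<open>B\<close> with an error d in every norm; both sides are continuous in d, so the constant
  survives the limit.\<close>

lemma has_type_aron_berner:
  assumes B: "B \<in> aron_berner_extensions n E F T" and p: "\<And>i. i \<in> {1..n} \<Longrightarrow> 0 < p i"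
    and T: "has_type n E F p T"
  shows "has_type n (\<lambda>i. bidual (E i)) (bidual F) p B"
proof -
  obtain K where K: "K > 0" "\<And>k x. (\<forall>i\<in>{1..n}. \<forall>j\<in>{1..k}. x i j \<in> carr (E i)) \<Longrightarrow>
      rad_norm F k (\<lambda>j. T (\<lambda>i\<in>{1..n}. x i j)) \<le> K * (\<Prod>i=1..n. lp_norm (E i) (p i) k (x i))"
    using T unfolding has_type_def by blast
  have "rad_norm (bidual F) k (\<lambda>j. B (\<lambda>i\<in>{1..n}. y i j)) \<le> K * (\<Prod>i=1..n. lp_norm (bidual (E i)) (p i) k (y i))"
    if y: "\<forall>i\<in>{1..n}. \<forall>j\<in>{1..k}. y i j \<in> carr (bidual (E i))" for k and y :: "nat \<Rightarrow> nat \<Rightarrow> ('a \<Rightarrow> 'k) \<Rightarrow> 'k"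
  proof -
    define Y where "Y j = (\<lambda>i\<in>{1..n}. y i j)" for j
    have Y: "Y j \<in> bidual_points" if "j \<in> {1..k}" for j using y that by (auto simp: Y_def)
    interpret BF: normed_space "bidual F" by (rule DF.normed_space_dual)
    define w where "w c = nrm (bidual F) (rad_comb (bidual F) k (\<lambda>j. B (Y j)) (\<lambda>j. of_real (c j)))" for c
    have w0: "w c \<ge> 0" for c
      unfolding w_def using aron_berner_in_bidual[OF B Y] by (intro BF.nrm_nonneg BF.rad_comb_carr)
    have y0: "nrm (bidual (E i)) (y i j) \<ge> 0" if "i \<in> {1..n}" "j \<in> {1..k}" for i j
      using y that by (intro bidual_nonneg) auto
    \<comment> \<open>Truncation at 0 provides the nonnegativity that monotonicity of the quadratic
      mean requires; it disappears in the limit since \<open>w c \<ge> 0\<close>.\<close>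
    have main: "rad_mean k (\<lambda>c. max 0 (w c - d)) \<le>
        K * (\<Prod>i=1..n. lp_mean (p i) k (\<lambda>j. nrm (bidual (E i)) (y i j) + d))" if d: "d > 0" for d
    proof -
      have fin: "finite (unit ` {1..k} :: (nat \<Rightarrow> 'k) set)"
        "finite ((\<lambda>c j. of_real (c j)) ` signs k :: (nat \<Rightarrow> 'k) set)"
        using finite_signs by auto
      \<comment> \<open>Type involves single norms in the domain and sign combinations in the range,
        so \<open>unit\<close> vectors are used for \<open>I\<close> and sign patterns for
        \<open>D\<close>.\<close>
      obtain x where "\<forall>j\<in>{1..k}. x j \<in> points"
        "\<forall>i\<in>{1..n}. \<forall>c\<in>unit ` {1..k}. nrm (E i) (rad_comb (E i) k (\<lambda>j. x j i) c) \<le>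
          nrm (bidual (E i)) (rad_comb (bidual (E i)) k (\<lambda>j. Y j i) c) + d"
        "\<forall>c\<in>(\<lambda>c j. of_real (c j)) ` signs k.
          nrm (bidual F) (rad_comb (bidual F) k (\<lambda>j. B (Y j)) c) - d \<le> nrm F (rad_comb F k (\<lambda>j. T (x j)) c)"
        by (rule aron_berner_approx[where k = k and y = Y, OF B fin d]) (erule Y)
      note x = this[rule_format]
      have xc: "x j i \<in> carr (E i)" if "i \<in> {1..n}" "j \<in> {1..k}" for i j
        using x(1)[OF that(2)] that(1) by (auto simp: PiE_iff)
      have xr: "(\<lambda>i\<in>{1..n}. x j i) = x j" if "j \<in> {1..k}" for j
        using x(1)[OF that] by (intro extensional_restrict) (auto simp: PiE_iff)
      have "rad_mean k (\<lambda>c. max 0 (w c - d)) \<le> rad_mean k (\<lambda>c. nrm F (rad_comb F k (\<lambda>j. T (x j)) (\<lambda>j. of_real (c j))))"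
      proof (rule rad_mean_mono)
        fix c assume "c \<in> signs k"
        then have "w c - d \<le> nrm F (rad_comb F k (\<lambda>j. T (x j)) (\<lambda>j. of_real (c j)))"
          unfolding w_def by (intro x(3)) auto
        moreover have "0 \<le> nrm F (rad_comb F k (\<lambda>j. T (x j)) (\<lambda>j. of_real (c j)))"
          by (intro F.nrm_nonneg F.rad_comb_carr T_carr x(1))
        ultimately show "0 \<le> max 0 (w c - d) \<and>
            max 0 (w c - d) \<le> nrm F (rad_comb F k (\<lambda>j. T (x j)) (\<lambda>j. of_real (c j)))" by simp
      qed
      also have "\<dots> = rad_norm F k (\<lambda>j. T (\<lambda>i\<in>{1..n}. x j i))"
      proof -
        have "rad_comb F k (\<lambda>j. T (x j)) c = rad_comb F k (\<lambda>j. T (\<lambda>i\<in>{1..n}. x j i)) c" for c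
          unfolding rad_comb_def using xr by (intro sum.cong) auto
        then show ?thesis unfolding rad_norm_eq_rad_mean by (simp only:)
      qed
      also have "\<dots> \<le> K * (\<Prod>i=1..n. lp_norm (E i) (p i) k (\<lambda>j. x j i))"
        using xc by (intro K(2)[of k "\<lambda>i j. x j i"]) auto
      also have "\<dots> \<le> K * (\<Prod>i=1..n. lp_mean (p i) k (\<lambda>j. nrm (bidual (E i)) (y i j) + d))"
      proof (intro mult_left_mono prod_mono conjI)
        fix i assume i: "i \<in> {1..n}"
        interpret Ei: normed_space "E i" by (rule normed_E[OF i])
        interpret BEi: normed_space "bidual (E i)" by (rule normed_bidual[OF i])
        show "0 \<le> lp_norm (E i) (p i) k (\<lambda>j. x j i)" by (simp add: lp_norm_eq_lp_mean lp_mean_nonneg)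
        show "lp_norm (E i) (p i) k (\<lambda>j. x j i) \<le> lp_mean (p i) k (\<lambda>j. nrm (bidual (E i)) (y i j) + d)"
          unfolding lp_norm_eq_lp_mean
        proof (rule lp_mean_mono[OF p[OF i]])
          show "0 \<le> nrm (E i) (x j i) \<and> nrm (E i) (x j i) \<le> nrm (bidual (E i)) (y i j) + d"
            if "j \<in> {1..k}" for j
            using x(2)[OF i imageI[OF that]] xc[OF i that] i
            by (simp add: Ei.rad_comb_unit[OF that] BEi.rad_comb_unit[OF that] Ei.nrm_nonneg Y_def)
        qed
      qed (use K in simp)
      finally show ?thesis .
    qed
    have "rad_mean k w \<le> K * (\<Prod>i=1..n. lp_mean (p i) k (\<lambda>j. nrm (bidual (E i)) (y i j)))"
    proof (rule tendsto_le)
      have lim: "((\<lambda>d. max 0 (w c - d)) \<longlongrightarrow> max 0 (w c - 0)) (at_right 0)" for c by (intro tendsto_intros)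
      have "((\<lambda>d. max 0 (w c - d)) \<longlongrightarrow> w c) (at_right 0)" for c
        using lim[of c] w0[of c] by (simp add: max_absorb2)
      then show "((\<lambda>d. rad_mean k (\<lambda>c. max 0 (w c - d))) \<longlongrightarrow> rad_mean k w) (at_right 0)"
        by (rule tendsto_rad_mean)
      have "((\<lambda>d. nrm (bidual (E i)) (y i j) + d) \<longlongrightarrow> nrm (bidual (E i)) (y i j) + 0) (at_right 0)" for i j
        by (intro tendsto_intros)
      moreover have "\<forall>\<^sub>F d in at_right 0. 0 \<le> nrm (bidual (E i)) (y i j) + d" if "i \<in> {1..n}" "j \<in> {1..k}" for i j
        using eventually_at_right_less[of 0] by eventually_elim (use y0[OF that] in simp)
      ultimately show "((\<lambda>d. K * (\<Prod>i=1..n. lp_mean (p i) k (\<lambda>j. nrm (bidual (E i)) (y i j) + d))) \<longlongrightarrow>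
          K * (\<Prod>i=1..n. lp_mean (p i) k (\<lambda>j. nrm (bidual (E i)) (y i j)))) (at_right 0)"
        using p by (intro tendsto_intros tendsto_lp_mean) auto
      show "\<forall>\<^sub>F d in at_right 0. rad_mean k (\<lambda>c. max 0 (w c - d)) \<le>
          K * (\<Prod>i=1..n. lp_mean (p i) k (\<lambda>j. nrm (bidual (E i)) (y i j) + d))"
        using eventually_at_right_less[of 0] by eventually_elim (rule main)
    qed simp
    then show ?thesis unfolding rad_norm_eq_rad_mean lp_norm_eq_lp_mean w_def Y_def .
  qed
  then show ?thesis unfolding has_type_def using K(1) by blast
qed

text \<open>The argument for type with the two coefficient sets exchanged: sign combinations are
  bounded above in the domain, single values below in the range.\<close>

lemma has_cotype_aron_berner:
  assumes B: "B \<in> aron_berner_extensions n E F T" and q: "q > 0" and T: "has_cotype n E F q T"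
  shows "has_cotype n (\<lambda>i. bidual (E i)) (bidual F) q B"
proof -
  obtain K where K: "K > 0" "\<And>k x. (\<forall>i\<in>{1..n}. \<forall>j\<in>{1..k}. x i j \<in> carr (E i)) \<Longrightarrow>
      lp_norm F q k (\<lambda>j. T (\<lambda>i\<in>{1..n}. x i j)) \<le> K * (\<Prod>i=1..n. rad_norm (E i) k (x i))"
    using T unfolding has_cotype_def by blast
  have "lp_norm (bidual F) q k (\<lambda>j. B (\<lambda>i\<in>{1..n}. y i j)) \<le> K * (\<Prod>i=1..n. rad_norm (bidual (E i)) k (y i))"
    if y: "\<forall>i\<in>{1..n}. \<forall>j\<in>{1..k}. y i j \<in> carr (bidual (E i))" for k and y :: "nat \<Rightarrow> nat \<Rightarrow> ('a \<Rightarrow> 'k) \<Rightarrow> 'k"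
  proof -
    define Y where "Y j = (\<lambda>i\<in>{1..n}. y i j)" for j
    have Y: "Y j \<in> bidual_points" if "j \<in> {1..k}" for j using y that by (auto simp: Y_def)
    interpret BF: normed_space "bidual F" by (rule DF.normed_space_dual)
    define w where "w j = nrm (bidual F) (B (Y j))" for j
    have w0: "w j \<ge> 0" if "j \<in> {1..k}" for j
      unfolding w_def using aron_berner_in_bidual[OF B Y[OF that]] by (rule BF.nrm_nonneg)
    define v where "v i c = nrm (bidual (E i)) (rad_comb (bidual (E i)) k (y i) (\<lambda>j. of_real (c j)))"
      for i and c :: "nat \<Rightarrow> real"
    have main: "lp_mean q k (\<lambda>j. max 0 (w j - d)) \<le> K * (\<Prod>i=1..n. rad_mean k (\<lambda>c. v i c + d))" if d: "d > 0" for d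
    proof -
      have fin: "finite (unit ` {1..k} :: (nat \<Rightarrow> 'k) set)"
        "finite ((\<lambda>c j. of_real (c j)) ` signs k :: (nat \<Rightarrow> 'k) set)"
        using finite_signs by auto
      obtain x where "\<forall>j\<in>{1..k}. x j \<in> points"
        "\<forall>i\<in>{1..n}. \<forall>c\<in>(\<lambda>c j. of_real (c j)) ` signs k. nrm (E i) (rad_comb (E i) k (\<lambda>j. x j i) c) \<le>
          nrm (bidual (E i)) (rad_comb (bidual (E i)) k (\<lambda>j. Y j i) c) + d"
        "\<forall>c\<in>unit ` {1..k}.
          nrm (bidual F) (rad_comb (bidual F) k (\<lambda>j. B (Y j)) c) - d \<le> nrm F (rad_comb F k (\<lambda>j. T (x j)) c)"
        by (rule aron_berner_approx[where k = k and y = Y, OF B fin(2,1) d]) (erule Y)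
      note x = this[rule_format]
      have xc: "x j i \<in> carr (E i)" if "i \<in> {1..n}" "j \<in> {1..k}" for i j
        using x(1)[OF that(2)] that(1) by (auto simp: PiE_iff)
      have xr: "(\<lambda>i\<in>{1..n}. x j i) = x j" if "j \<in> {1..k}" for j
        using x(1)[OF that] by (intro extensional_restrict) (auto simp: PiE_iff)
      have "lp_mean q k (\<lambda>j. max 0 (w j - d)) \<le> lp_mean q k (\<lambda>j. nrm F (T (\<lambda>i\<in>{1..n}. x j i)))"
      proof (rule lp_mean_mono[OF q])
        fix j assume j: "j \<in> {1..k}"
        have "w j - d \<le> nrm F (T (x j))"
          using x(3)[OF imageI[OF j]] by (simp add: w_def F.rad_comb_unit[OF j] BF.rad_comb_unit[OF j])
        then show "0 \<le> max 0 (w j - d) \<and> max 0 (w j - d) \<le> nrm F (T (\<lambda>i\<in>{1..n}. x j i))"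
          using F.nrm_nonneg[OF T_carr[OF x(1)[OF j]]] xr[OF j] by simp
      qed
      also have "\<dots> = lp_norm F q k (\<lambda>j. T (\<lambda>i\<in>{1..n}. x j i))" by (rule lp_norm_eq_lp_mean[symmetric])
      also have "\<dots> \<le> K * (\<Prod>i=1..n. rad_norm (E i) k (\<lambda>j. x j i))"
        using xc by (intro K(2)[of k "\<lambda>i j. x j i"]) auto
      also have "\<dots> \<le> K * (\<Prod>i=1..n. rad_mean k (\<lambda>c. v i c + d))"
      proof (intro mult_left_mono prod_mono conjI)
        fix i assume i: "i \<in> {1..n}"
        interpret Ei: normed_space "E i" by (rule normed_E[OF i])
        show "0 \<le> rad_norm (E i) k (\<lambda>j. x j i)" by (simp add: rad_norm_eq_rad_mean rad_mean_nonneg)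
        show "rad_norm (E i) k (\<lambda>j. x j i) \<le> rad_mean k (\<lambda>c. v i c + d)"
          unfolding rad_norm_eq_rad_mean
        proof (rule rad_mean_mono, rule conjI)
          fix c assume c: "c \<in> signs k"
          show "0 \<le> nrm (E i) (rad_comb (E i) k (\<lambda>j. x j i) (\<lambda>j. of_real (c j)))"
            using xc[OF i] by (intro Ei.nrm_nonneg Ei.rad_comb_carr)
          have "(\<lambda>j. Y j i) = y i" using i by (simp add: Y_def)
          then show "nrm (E i) (rad_comb (E i) k (\<lambda>j. x j i) (\<lambda>j. of_real (c j))) \<le> v i c + d"
            using x(2)[OF i imageI[OF c]] by (simp only: v_def)
        qed
      qed (use K in simp)
      finally show ?thesis .
    qed
    have "lp_mean q k w \<le> K * (\<Prod>i=1..n. rad_mean k (v i))"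
    proof (rule tendsto_le)
      have lim: "((\<lambda>d. max 0 (w j - d)) \<longlongrightarrow> max 0 (w j - 0)) (at_right 0)" for j by (intro tendsto_intros)
      have "((\<lambda>d. max 0 (w j - d)) \<longlongrightarrow> w j) (at_right 0)" if "j \<in> {1..k}" for j
        using lim[of j] w0[OF that] by (simp add: max_absorb2)
      then show "((\<lambda>d. lp_mean q k (\<lambda>j. max 0 (w j - d))) \<longlongrightarrow> lp_mean q k w) (at_right 0)"
        by (intro tendsto_lp_mean[OF q]) auto
      have "((\<lambda>d. v i c + d) \<longlongrightarrow> v i c + 0) (at_right 0)" for i c by (intro tendsto_intros)
      then show "((\<lambda>d. K * (\<Prod>i=1..n. rad_mean k (\<lambda>c. v i c + d))) \<longlongrightarrow> K * (\<Prod>i=1..n. rad_mean k (v i))) (at_right 0)"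
        by (intro tendsto_intros tendsto_rad_mean) auto
      show "\<forall>\<^sub>F d in at_right 0. lp_mean q k (\<lambda>j. max 0 (w j - d)) \<le> K * (\<Prod>i=1..n. rad_mean k (\<lambda>c. v i c + d))"
        using eventually_at_right_less[of 0] by eventually_elim (rule main)
    qed simp
    then show ?thesis unfolding rad_norm_eq_rad_mean lp_norm_eq_lp_mean w_def Y_def v_def .
  qed
  then show ?thesis unfolding has_cotype_def using K(1) by blast
qed

text \<open>An extension maps canonical images to the canonical image of the value of
  \<open>T\<close>, and canonical embeddings are isometric and linear, so every norm in the two
  inequalities is preserved. The exponent \<open>q\<close> is free and serves for cotype as well as
  for each \<open>p i\<close>.\<close>

lemma canon_family:
  assumes x: "\<forall>i\<in>{1..n}. \<forall>j\<in>{1..k}. x i j \<in> carr (E i)"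
    and B: "B \<in> aron_berner_extensions n E F T"
  shows "\<forall>i\<in>{1..n}. \<forall>j\<in>{1..k}. canon (E i) (x i j) \<in> carr (bidual (E i))"
    and "rad_norm (bidual F) k (\<lambda>j. B (\<lambda>i\<in>{1..n}. canon (E i) (x i j))) = rad_norm F k (\<lambda>j. T (\<lambda>i\<in>{1..n}. x i j))"
    and "lp_norm (bidual F) q k (\<lambda>j. B (\<lambda>i\<in>{1..n}. canon (E i) (x i j))) = lp_norm F q k (\<lambda>j. T (\<lambda>i\<in>{1..n}. x i j))"
    and "i \<in> {1..n} \<Longrightarrow> rad_norm (bidual (E i)) k (\<lambda>j. canon (E i) (x i j)) = rad_norm (E i) k (x i)"
    and "i \<in> {1..n} \<Longrightarrow> lp_norm (bidual (E i)) q k (\<lambda>j. canon (E i) (x i j)) = lp_norm (E i) q k (x i)"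
proof -
  let ?t = "\<lambda>j. T (\<lambda>i\<in>{1..n}. x i j)"
  show "\<forall>i\<in>{1..n}. \<forall>j\<in>{1..k}. canon (E i) (x i j) \<in> carr (bidual (E i))"
    using x normed_space.canon_in_bidual[OF normed_E] by blast
  have pt: "(\<lambda>i\<in>{1..n}. x i j) \<in> points" if "j \<in> {1..k}" for j using x that by auto
  have b: "B (\<lambda>i\<in>{1..n}. canon (E i) (x i j)) = canon F (?t j)" if "j \<in> {1..k}" for j
  proof -
    have "(\<lambda>i\<in>{1..n}. canon (E i) (x i j)) = (\<lambda>i\<in>{1..n}. canon (E i) ((\<lambda>i\<in>{1..n}. x i j) i))" by auto
    then show ?thesis using aron_berner_canon[OF B pt[OF that]] by (simp only:)
  qed
  note t = T_carr[OF pt]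
  have "rad_comb (bidual F) k (\<lambda>j. B (\<lambda>i\<in>{1..n}. canon (E i) (x i j))) c = rad_comb (bidual F) k (\<lambda>j. canon F (?t j)) c" for c
    unfolding rad_comb_def using b by (intro sum.cong) auto
  then show "rad_norm (bidual F) k (\<lambda>j. B (\<lambda>i\<in>{1..n}. canon (E i) (x i j))) = rad_norm F k ?t"
    unfolding rad_norm_eq_rad_mean using F.nrm_rad_comb_canon[of k ?t, OF t] by (simp only:)
  show "lp_norm (bidual F) q k (\<lambda>j. B (\<lambda>i\<in>{1..n}. canon (E i) (x i j))) = lp_norm F q k ?t"
    unfolding lp_norm_def using b F.nrm_canon[OF t] by (intro arg_cong2[of _ _ _ _ "(powr)"] sum.cong) auto
  assume i: "i \<in> {1..n}"
  interpret Ei: normed_space "E i" by (rule normed_E[OF i])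
  have xi: "x i j \<in> carr (E i)" if "j \<in> {1..k}" for j using x i that by blast
  show "rad_norm (bidual (E i)) k (\<lambda>j. canon (E i) (x i j)) = rad_norm (E i) k (x i)"
    unfolding rad_norm_eq_rad_mean using Ei.nrm_rad_comb_canon[of k "x i", OF xi] by (simp only:)
  show "lp_norm (bidual (E i)) q k (\<lambda>j. canon (E i) (x i j)) = lp_norm (E i) q k (x i)"
    unfolding lp_norm_def using Ei.nrm_canon[OF xi] by (intro arg_cong2[of _ _ _ _ "(powr)"] sum.cong) auto
qed

lemma has_type_of_aron_berner:
  assumes B: "B \<in> aron_berner_extensions n E F T"
    and type: "has_type n (\<lambda>i. bidual (E i)) (bidual F) p B"
  shows "has_type n E F p T"
proof -
  obtain K where K: "K > 0" "\<And>k x. (\<forall>i\<in>{1..n}. \<forall>j\<in>{1..k}. x i j \<in> carr (bidual (E i))) \<Longrightarrow>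
      rad_norm (bidual F) k (\<lambda>j. B (\<lambda>i\<in>{1..n}. x i j)) \<le> K * (\<Prod>i=1..n. lp_norm (bidual (E i)) (p i) k (x i))"
    using type unfolding has_type_def by blast
  have "rad_norm F k (\<lambda>j. T (\<lambda>i\<in>{1..n}. x i j)) \<le> K * (\<Prod>i=1..n. lp_norm (E i) (p i) k (x i))"
    if x: "\<forall>i\<in>{1..n}. \<forall>j\<in>{1..k}. x i j \<in> carr (E i)" for k and x :: "nat \<Rightarrow> nat \<Rightarrow> 'a"
    using K(2)[OF canon_family(1)[OF x B]] canon_family(2,5)[OF x B] by simp
  then show ?thesis unfolding has_type_def using K(1) by blast
qed

lemma has_cotype_of_aron_berner:
  assumes B: "B \<in> aron_berner_extensions n E F T"
    and cotype: "has_cotype n (\<lambda>i. bidual (E i)) (bidual F) q B"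
  shows "has_cotype n E F q T"
proof -
  obtain K where K: "K > 0" "\<And>k x. (\<forall>i\<in>{1..n}. \<forall>j\<in>{1..k}. x i j \<in> carr (bidual (E i))) \<Longrightarrow>
      lp_norm (bidual F) q k (\<lambda>j. B (\<lambda>i\<in>{1..n}. x i j)) \<le> K * (\<Prod>i=1..n. rad_norm (bidual (E i)) k (x i))"
    using cotype unfolding has_cotype_def by blast
  have "lp_norm F q k (\<lambda>j. T (\<lambda>i\<in>{1..n}. x i j)) \<le> K * (\<Prod>i=1..n. rad_norm (E i) k (x i))"
    if x: "\<forall>i\<in>{1..n}. \<forall>j\<in>{1..k}. x i j \<in> carr (E i)" for k and x :: "nat \<Rightarrow> nat \<Rightarrow> 'a"
    using K(2)[OF canon_family(1)[OF x B]] canon_family(3,4)[OF x B] by simp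
  then show ?thesis unfolding has_cotype_def using K(1) by blast
qed

end

theorem corollary4p2:
  fixes n :: nat and p :: "nat \<Rightarrow> real" and q :: real
    and E :: "nat \<Rightarrow> ('k::real_or_complex, 'a::ab_group_add) nspace"
    and F :: "('k, 'b::ab_group_add) nspace"
    and A :: "(nat \<Rightarrow> 'a) \<Rightarrow> 'b"
  assumes "n \<ge> 2"
    and "\<And>i. i \<in> {1..n} \<Longrightarrow> 0 < p i"
    and "1 / 2 \<le> (\<Sum>i=1..n. 1 / p i)" and "(\<Sum>i=1..n. 1 / p i) < 1"
    and "2 / real n \<le> q"
    and "\<And>i. i \<in> {1..n} \<Longrightarrow> banach_space (E i)"
    and "banach_space F"
    and "A \<in> multilinear_ops n E F"
  shows
    "(has_type n E F p A \<longleftrightarrow>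
        (\<forall>B\<in>aron_berner_extensions n E F A. has_type n (\<lambda>i. bidual (E i)) (bidual F) p B)) \<and>
     (has_type n E F p A \<longleftrightarrow>
        (\<exists>B\<in>aron_berner_extensions n E F A. has_type n (\<lambda>i. bidual (E i)) (bidual F) p B)) \<and>
     (has_cotype n E F q A \<longleftrightarrow>
        (\<forall>B\<in>aron_berner_extensions n E F A. has_cotype n (\<lambda>i. bidual (E i)) (bidual F) q B)) \<and>
     (has_cotype n E F q A \<longleftrightarrow>
        (\<exists>B\<in>aron_berner_extensions n E F A. has_cotype n (\<lambda>i. bidual (E i)) (bidual F) q B))"
proof -
  interpret multilinear n E F A
    using assms(6-8) by (intro multilinear_of_ops) (auto dest: banach_space.axioms)
  obtain C where "C \<ge> 0" "\<And>x. x \<in> points \<Longrightarrow> nrm F (A x) \<le> C * (\<Prod>i=1..n. nrm (E i) (x i))"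
    using multilinear_ops_bound[OF _ assms(8)] assms(1) by auto
  then interpret bounded_multilinear n E F A C
    by unfold_locales
  \<comment> \<open>Monotonicity and continuity of the mean with exponent \<open>q\<close> rest on
    this.\<close>
  have "q > 0" using assms(1,5) by (auto intro: less_le_trans[rotated])
  \<comment> \<open>Each single extension is already equivalent to \<open>A\<close> in this respect;
    the quantifiers over extensions enter only at the end.\<close>
  have type: "has_type n E F p A \<longleftrightarrow> has_type n (\<lambda>i. bidual (E i)) (bidual F) p B"
    if "B \<in> aron_berner_extensions n E F A" for B
    using has_type_aron_berner[OF that assms(2)] has_type_of_aron_berner[OF that] by (rule iffI)
  have cotype: "has_cotype n E F q A \<longleftrightarrow> has_cotype n (\<lambda>i. bidual (E i)) (bidual F) q B"
    if "B \<in> aron_berner_extensions n E F A" for B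
    using has_cotype_aron_berner[OF that \<open>q > 0\<close>] has_cotype_of_aron_berner[OF that] by (rule iffI)
  \<comment> \<open>The witness gives the existential statements and lets the universal ones return
    to \<open>A\<close>.\<close>
  obtain B0 where "B0 \<in> aron_berner_extensions n E F A" using aron_berner_exists by blast
  then show ?thesis using type cotype by (intro conjI iffI ballI bexI[of _ B0]) (simp_all, (metis)+)
qed

end
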